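(* Let $k\in\{1,\ldots,n-1\}$ and $0<\alpha\leq 1$, and set $\varepsilon_0(k):=2^k\,240^{-k-1}$. Let $E\subset\mathbb{R}^n$ be a Borel set with $\mathcal{H}^k(E)<+\infty$ such that for $\mathcal{H}^k$-a.e. $x\in E$ the following conditions hold: $$\Theta_*^k(E,x)>0,$$ and there exist $\lambda>0$ (possibly depending on $x$) and, for every $r>0$, an affine $k$-plane $V_{x,r}\subset\mathbb{R}^n$ (not necessarily containing $x$) such that $$\limsup_{r\to 0}\frac{1}{r^k}\mathcal{H}^k\big((E\cap B(x,r))\setminus B(V_{x,r},\lambda r^{1+\alpha})\big)<(1-2^{-k})\,\varepsilon_0(k)\,\Theta_*^k(E,x).$$ Then $E$ is $C^{1,\alpha}$ $\mathcal{H}^k$-rectifiable.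
   Context: $B(x,r)$ is the closed Euclidean ball of center $x$ and radius $r$ in $\mathbb{R}^n$. For an affine plane $V$ and $\eta>0$, $B(V,\eta):=\{y\in\mathbb{R}^n:\mathrm{dist}(y,V)<\eta\}$. $\mathcal{H}^k$ is the $k$-dimensional Hausdorff measure with no normalizing factor: $\mathcal{H}^k(E)=\lim_{\delta\to0}\inf\{\sum_i \mathrm{diam}(E_i)^k: E\subset\bigcup_i E_i,\ \mathrm{diam}(E_i)\le\delta\}$. The lower density is $\Theta_*^k(E,x)=\liminf_{r\to0}(2r)^{-k}\mathcal{H}^k(E\cap B(x,r))$. A $k$-dimensional $C^{1,\alpha}$ graph is a set $\{v+f(v):v\in V\}$, where $V$ is a linear $k$-plane of $\mathbb{R}^n$ and $f:V\to V^\perp$ is a $C^{1,\alpha}$ map ($C^1$ with $\alpha$-Hölder derivative). A Borel set $E\subseteq\mathbb{R}^n$ is $C^{1,\alpha}$ $\mathcal{H}^k$-rectifiable if there are countably many $k$-dimensional $C^{1,\alpha}$ graphs $\Gamma_i$ with $\mathcal{H}^k(E\setminus\bigcup_i\Gamma_i)=0$. *)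

theory Defs
  imports "HOL-Analysis.Analysis"
begin

text \<open>Countable covers are sequences; finite covers are included by padding with the empty set,
  which contributes \<open>0 ^ k = 0\<close>.  This requires \<open>k \<ge> 1\<close>.  Boundedness is required explicitly
  because \<^const>\<open>diameter\<close> has no meaningful value on unbounded sets.\<close>

definition hausdorff_pre :: "nat \<Rightarrow> real \<Rightarrow> 'a::metric_space set \<Rightarrow> ennreal" where
  "hausdorff_pre k \<delta> E =
     (INF C \<in> {C :: nat \<Rightarrow> 'a set. E \<subseteq> (\<Union>i. C i) \<and> (\<forall>i. bounded (C i) \<and> diameter (C i) \<le> \<delta>)}.
        \<Sum>i. ennreal (diameter (C i) ^ k))"

text \<open>The limit \<open>\<delta> \<rightarrow> 0\<close> is a supremum by monotonicity in \<open>\<delta>\<close>; see \<open>hausdorff_pre_tendsto\<close>.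
  No normalizing factor is used.\<close>

definition hausdorff :: "nat \<Rightarrow> 'a::metric_space set \<Rightarrow> ennreal" where
  "hausdorff k E = (SUP \<delta> \<in> {0<..}. hausdorff_pre k \<delta> E)"

lemma hausdorff_pre_antimono:
  assumes "\<delta> \<le> \<delta>'"
  shows "hausdorff_pre k \<delta>' E \<le> hausdorff_pre k \<delta> E"
  unfolding hausdorff_pre_def
  by (rule INF_superset_mono) (use assms in \<open>auto intro: order_trans\<close>)

lemma hausdorff_pre_tendsto:
  "((\<lambda>\<delta>. hausdorff_pre k \<delta> E) \<longlongrightarrow> hausdorff k E) (at_right 0)"
proof (rule order_tendstoI)
  fix a assume "a < hausdorff k E"
  then obtain d where d: "d > 0" "a < hausdorff_pre k d E"
    unfolding hausdorff_def less_SUP_iff by auto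
  have "\<forall>\<^sub>F \<delta> in at_right 0. \<delta> < d"
    using d(1) by (auto simp: eventually_at_right_field)
  then show "\<forall>\<^sub>F \<delta> in at_right 0. a < hausdorff_pre k \<delta> E"
    by eventually_elim (use d(2) hausdorff_pre_antimono[of _ d k E] in \<open>auto intro: less_le_trans\<close>)
next
  fix a assume a: "hausdorff k E < a"
  have "hausdorff_pre k \<delta> E \<le> hausdorff k E" if "\<delta> > 0" for \<delta>
    unfolding hausdorff_def using that by (auto intro: SUP_upper)
  then show "\<forall>\<^sub>F \<delta> in at_right 0. hausdorff_pre k \<delta> E < a"
    using a by (auto simp: eventually_at_right_field intro!: exI[of _ 1] intro: le_less_trans)
qed

definition lower_density :: "nat \<Rightarrow> 'a::metric_space set \<Rightarrow> 'a \<Rightarrow> ennreal" where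
  "lower_density k E x =
     Liminf (at_right 0) (\<lambda>r. hausdorff k (E \<inter> cball x r) / ennreal ((2 * r) ^ k))"

definition plane_nbhd :: "'a::metric_space set \<Rightarrow> real \<Rightarrow> 'a set" where
  "plane_nbhd V \<eta> = {y. infdist y V < \<eta>}"

definition affine_plane :: "nat \<Rightarrow> 'a::euclidean_space set \<Rightarrow> bool" where
  "affine_plane k V \<longleftrightarrow> affine V \<and> aff_dim V = int k"

text \<open>The derivative at \<open>v \<in> V\<close> is the derivative along \<open>V\<close>, so only its values on \<open>V\<close> are
  determined; the Hoelder bound is accordingly for the operator norm on \<open>V\<close>, and is global on \<open>V\<close>.
  For \<open>\<alpha> > 0\<close> it implies continuity of the derivative.\<close>

definition C1_holder_on :: "real \<Rightarrow> 'a::euclidean_space set \<Rightarrow> ('a \<Rightarrow> 'a) \<Rightarrow> bool" where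
  "C1_holder_on \<alpha> V f \<longleftrightarrow>
     (\<exists>f' C. (\<forall>v\<in>V. (f has_derivative f' v) (at v within V)) \<and>
             (\<forall>v\<in>V. \<forall>w\<in>V. \<forall>h\<in>V. norm (f' v h - f' w h) \<le> C * dist v w powr \<alpha> * norm h))"

definition C1_holder_graph :: "nat \<Rightarrow> real \<Rightarrow> 'a::euclidean_space set \<Rightarrow> bool" where
  "C1_holder_graph k \<alpha> \<Gamma> \<longleftrightarrow>
     (\<exists>V f. subspace V \<and> dim V = k \<and> (\<forall>v\<in>V. f v \<in> orthogonal_comp V) \<and>
            C1_holder_on \<alpha> V f \<and> \<Gamma> = {v + f v |v. v \<in> V})"

definition C1_holder_rectifiable :: "nat \<Rightarrow> real \<Rightarrow> 'a::euclidean_space set \<Rightarrow> bool" where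
  "C1_holder_rectifiable k \<alpha> E \<longleftrightarrow> E \<in> sets borel \<and>
     (\<exists>\<G>. countable \<G> \<and> (\<forall>\<Gamma>\<in>\<G>. C1_holder_graph k \<alpha> \<Gamma>) \<and> hausdorff k (E - \<Union>\<G>) = 0)"

definition eps0 :: "nat \<Rightarrow> real" where
  "eps0 k = 2 ^ k / 240 ^ (k + 1)"

end

theory Submission
  imports Defs
begin

text \<open>Write \<open>\<mu>\<close> for the restriction of the Hausdorff measure to \<open>E\<close>. Up to a null set, \<open>E\<close> is a countable
  union of pieces on which all constants are uniform and on which, at small scales, \<open>\<mu>\<close> has an upper
  density bound outside a negligible part (Vitali covering). By this bound, little mass lies near a
  \<open>(k - 1)\<close>-plane, so most points of the piece in a ball spread in all \<open>k\<close> directions of a good plane.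
  Hence two good planes at comparable scales and nearby centres, which share most of the mass, are
  within \<open>O(r powr \<alpha>)\<close> of each other. Summing over dyadic scales gives tangent planes \<open>Q x\<close> that are
  Hoelder continuous in \<open>x\<close>, with \<open>dist(y, x + Q x) = O(dist x y powr (1 + \<alpha>))\<close> for \<open>x\<close>, \<open>y\<close> in one piece.
  These are the hypotheses of Whitney's extension theorem, so each piece of small diameter lies in a
  single graph. The value of \<open>eps0 k\<close> matters only through the exceptional mass being a small
  fraction of the lower density.\<close>

subsection \<open>Whitney extension of first-order jets\<close>

text \<open>The obstacle is that \<open>V r\<close> is chosen afresh at each point and radius, need
  not contain the point, and controls only most of the mass. Two such planes can be compared only
  through points of \<open>E\<close> lying near both, so one needs a lower bound on their common
  mass and a quantitative reason why it cannot degenerate. The first is a count: the ball of radius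
  r about y carries at least \<theta> * 2^k * r^k, and the three exceptional sets (two at radius r,
  one at 2 * r) at most c * \<theta> * (2 + 2^k) * r^k, which leaves \<theta> * r^k when c \<le>
  1/4. The second compares powers: inside a neighbourhood of a k-plane, a slab of width r/n needs
  only about n^(k-1) balls of radius comparable to r/n, so its mass is O(r^k / n), and n is fixed
  once in terms of the upper bound and \<theta>. The strict inequality of the hypothesis leaves room
  for a rational \<theta> between its two sides; this makes the ratio of exceptional to total mass
  uniform on countably many pieces. The pieces only have to be covered by graphs, so their
  measurability never comes up.\<close>

lemma powr_subadditive:
  fixes u v q :: real
  assumes "0 \<le> u" "0 \<le> v" "0 < q" "q \<le> 1"
  shows "(u + v) powr q \<le> u powr q + v powr q"
proof (cases "u + v = 0")
  case True
  then show ?thesis using assms by simp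
next
  case False
  then have s: "u + v > 0" using assms by simp
  \<comment> \<open>On [0,1] a power with exponent at most 1 lies above the identity. The two
    fractions add up to 1, so their powers add up to at least 1.\<close>
  have frac: "t / (u + v) \<le> (t / (u + v)) powr q" if "0 \<le> t" "t \<le> u + v" for t
    using powr_mono'[of q 1 "t / (u + v)"] that s assms by simp
  have "1 = u / (u + v) + v / (u + v)"
    using s by (simp flip: add_divide_distrib)
  also have "\<dots> \<le> (u / (u + v)) powr q + (v / (u + v)) powr q"
    using frac[of u] frac[of v] assms by simp
  also have "\<dots> = (u powr q + v powr q) / (u + v) powr q"
    using assms s by (simp add: powr_divide add_divide_distrib)
  finally show ?thesis using s by (simp add: field_simps)
qed

lemma powr_midpoint:
  fixes a b m q :: real
  assumes "0 \<le> a" "0 \<le> b" "a + b = 2 * m" "0 < q" "q \<le> 1"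
  shows "a powr q + b powr q \<le> 2 * m powr q"
proof (cases "m = 0")
  case True
  then have "a = 0" "b = 0" using assms by auto
  then show ?thesis by simp
next
  case False
  then have m: "m > 0" using assms by simp
  have y: "t powr q * m powr (1 - q) \<le> q * t + (1 - q) * m" if "0 \<le> t" for t
    using Youngs_inequality_0[of q "1 - q" t m] that m assms by (cases "t = 0") auto
  have "(a powr q + b powr q) * m powr (1 - q) \<le> q * (a + b) + 2 * ((1 - q) * m)"
    using y[of a] y[of b] assms(1,2) unfolding distrib_left distrib_right by linarith
  also have "\<dots> = 2 * m" using assms(3) by (simp add: algebra_simps)
  also have "\<dots> = 2 * m powr q * m powr (1 - q)"
    using m by (simp add: powr_add[symmetric])
  finally show ?thesis using m by simp
qed

text \<open>The parallelogram law says that the two squared norms on the left have mean |x|^2 +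
  |t|^2; since p/2 \<le> 1, the power p/2 is concave and subadditive. This provides the model
  function for the semiconcavity of the upper envelope below.\<close>

lemma norm_powr_second_difference:
  fixes x t :: "'a::real_inner"
  assumes "0 < p" "p \<le> 2"
  shows "norm (x + t) powr p + norm (x - t) powr p \<le> 2 * norm x powr p + 2 * norm t powr p"
proof -
  have sq: "norm z powr p = ((norm z)\<^sup>2) powr (p / 2)" for z :: 'a
  proof (cases "z = 0")
    case False
    then show ?thesis
      by (simp add: powr_powr flip: powr_numeral)
  qed (use assms in simp)
  have "norm (x + t) powr p + norm (x - t) powr p
      = ((norm (x + t))\<^sup>2) powr (p / 2) + ((norm (x - t))\<^sup>2) powr (p / 2)"
    using sq by simp
  also have "\<dots> \<le> 2 * ((norm x)\<^sup>2 + (norm t)\<^sup>2) powr (p / 2)"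
  proof (rule powr_midpoint)
    show "(norm (x + t))\<^sup>2 + (norm (x - t))\<^sup>2 = 2 * ((norm x)\<^sup>2 + (norm t)\<^sup>2)"
      by (simp add: power2_norm_eq_inner algebra_simps inner_commute)
  qed (use assms in auto)
  also have "\<dots> \<le> 2 * (((norm x)\<^sup>2) powr (p / 2) + ((norm t)\<^sup>2) powr (p / 2))"
    using assms by (intro mult_left_mono powr_subadditive) auto
  finally show ?thesis by (simp add: sq[symmetric])
qed

lemma powr_sum_le:
  fixes a b p :: real
  assumes "0 \<le> a" "0 \<le> b" "0 \<le> p"
  shows "(a + b) powr p \<le> 2 powr p * (a powr p + b powr p)"
proof -
  have "(a + b) powr p \<le> (2 * max a b) powr p"
    using assms by (intro powr_mono2) auto
  also have "\<dots> = 2 powr p * max a b powr p"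
    using assms by (intro powr_mult)
  also have "\<dots> \<le> 2 powr p * (a powr p + b powr p)"
    by (intro mult_left_mono) (auto simp: max_def)
  finally show ?thesis .
qed

lemma dyadic_powr: "((1/2) ^ i) powr a = ((1/2) powr a) ^ i" for a :: real
  by (simp add: powr_power powr_realpow [symmetric] powr_powr mult.commute)

text \<open>Additivity gives homogeneity over the integers, and boundedness on the unit ball
  excludes wild solutions of Cauchy's equation: a defect d of homogeneity at c grows to n * d at n *
  c, yet only a fractional part of n * c can cause it.\<close>

lemma bounded_linear_if_additive_bounded:
  fixes L :: "'a::real_normed_vector \<Rightarrow> real"
  assumes add: "\<And>a b. L (a + b) = L a + L b"
    and bd: "\<And>h. norm h \<le> 1 \<Longrightarrow> \<bar>L h\<bar> \<le> K"
  shows "bounded_linear L"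
proof -
  interpret A: Modules.additive L
    by unfold_locales (rule add)
  have nat: "L (real n *\<^sub>R h) = real n * L h" for n h
    by (induction n) (auto simp: A.zero add scaleR_left_distrib algebra_simps)
  have int: "L (real_of_int i *\<^sub>R h) = real_of_int i * L h" for i h
    by (cases i rule: int_diff_cases) (simp add: scaleR_left_diff_distrib A.diff nat left_diff_distrib)
  have K: "K \<ge> 0" using bd[of 0] by (simp add: A.zero)
  have scal: "L (c *\<^sub>R h) = c * L h" for c h
  proof (rule ccontr)
    assume ne: "L (c *\<^sub>R h) \<noteq> c * L h"
    define d where "d = \<bar>L (c *\<^sub>R h) - c * L h\<bar>"
    define N where "N = nat \<lceil>norm h\<rceil>"
    have N: "norm h \<le> real N" unfolding N_def by linarith
    obtain n :: nat where n: "real n * d > K * real (Suc N) + \<bar>L h\<bar>"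
      using reals_Archimedean3[of d] ne by (auto simp: d_def)
    define m where "m = n * Suc N"
    \<comment> \<open>Integer homogeneity takes care of i, so the defect at n * c is the defect at e
      in [0,1), which is bounded independently of n. The vector e * h is brought into the unit ball
      by dividing by \<open>Suc N\<close>.\<close>
    define i where "i = \<lfloor>real n * c\<rfloor>"
    define e where "e = real n * c - real_of_int i"
    have e: "0 \<le> e" "e < 1" unfolding e_def i_def by linarith+
    have "real n *\<^sub>R c *\<^sub>R h = real_of_int i *\<^sub>R h + e *\<^sub>R h"
      by (simp add: e_def algebra_simps)
    then have "real n * L (c *\<^sub>R h) = real_of_int i * L h + L (e *\<^sub>R h)"
      using nat[of n "c *\<^sub>R h"] int add by metis
    then have "real n * (L (c *\<^sub>R h) - c * L h) = L (e *\<^sub>R h) - e * L h"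
      by (simp add: e_def algebra_simps)
    then have "real n * d = \<bar>L (e *\<^sub>R h) - e * L h\<bar>"
      by (metis d_def abs_mult abs_of_nat)
    also have "\<dots> \<le> \<bar>L (e *\<^sub>R h)\<bar> + \<bar>e * L h\<bar>" by (rule abs_triangle_ineq4)
    also have "\<bar>e * L h\<bar> \<le> \<bar>L h\<bar>" using e by (simp add: abs_mult mult_left_le_one_le)
    also have "\<bar>L (e *\<^sub>R h)\<bar> \<le> real (Suc N) * K"
    proof -
      have "e *\<^sub>R h = real (Suc N) *\<^sub>R ((e / real (Suc N)) *\<^sub>R h)"
        by simp
      then have "\<bar>L (e *\<^sub>R h)\<bar> = real (Suc N) * \<bar>L ((e / real (Suc N)) *\<^sub>R h)\<bar>"
        using nat by (metis abs_mult abs_of_nat)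
      also have "norm ((e / real (Suc N)) *\<^sub>R h) \<le> 1"
      proof -
        have "e * norm h \<le> 1 * real N" using e N by (intro mult_mono) auto
        then show ?thesis using e by (simp add: field_simps)
      qed
      then have "real (Suc N) * \<bar>L ((e / real (Suc N)) *\<^sub>R h)\<bar> \<le> real (Suc N) * K"
        by (intro mult_left_mono bd) auto
      finally show ?thesis .
    qed
    finally show False using n by (simp add: mult.commute)
  qed
  have "norm (L h) \<le> norm h * K" for h
  proof (cases "h = 0")
    case True
    then show ?thesis by (simp add: A.zero)
  next
    case False
    have "\<bar>L h\<bar> = norm h * \<bar>L (h /\<^sub>R norm h)\<bar>"
      using False scal[of "inverse (norm h)" h] by (simp add: abs_mult)
    also have "\<dots> \<le> norm h * K" using False by (intro mult_left_mono bd) auto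
    finally show ?thesis by simp
  qed
  then show ?thesis
    using bounded_linear_intro[of L K] add scal by simp
qed

text \<open>A bound \<open>\<bar>F (x + t) + F (x - t) - 2 * F x\<bar> \<le> C * norm t powr (1 + \<alpha>)\<close> makes the dyadic
  difference quotients converge geometrically, and their limit is the derivative.\<close>

lemma C1_holder_if_second_difference:
  fixes F :: "'a::real_normed_vector \<Rightarrow> real"
  assumes \<alpha>: "0 < \<alpha>" "\<alpha> \<le> 1" and C: "C \<ge> 0"
    and sd: "\<And>x t. \<bar>F (x + t) + F (x - t) - 2 * F x\<bar> \<le> C * norm t powr (1 + \<alpha>)"
    and bd: "\<And>x. \<exists>K. \<forall>h. norm h \<le> 1 \<longrightarrow> \<bar>F (x + h)\<bar> \<le> K"
  shows "\<exists>F' K. (\<forall>x. (F has_derivative F' x) (at x)) \<and>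
    (\<forall>x y h. \<bar>F' x h - F' y h\<bar> \<le> K * dist x y powr \<alpha> * norm h)"
proof -
  define q where "q = (1/2::real) powr \<alpha>"
  have q: "0 < q" "q < 1" using \<alpha> powr_less_mono2[of \<alpha> "1/2" 1] by (auto simp: q_def)
  have qpow: "((1/2) ^ j) powr \<alpha> = q ^ j" for j unfolding q_def by (rule dyadic_powr)
  define D where "D = (\<lambda>x h j. 2 ^ j * (F (x + (1/2) ^ j *\<^sub>R h) - F x))"
  define p where "p = 1 + \<alpha>"
  have step: "\<bar>D x h (Suc j) - D x h j\<bar> \<le> C * norm h powr p * q ^ j" for x h j
  proof -
    define u where "u = (1/2) ^ Suc j *\<^sub>R h"
    have e: "(1/2) ^ j *\<^sub>R h = u + u"
      unfolding u_def by (simp flip: scaleR_left_distrib)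
    \<comment> \<open>Consecutive dyadic quotients differ by a second difference centred at the
      midpoint x + u. The factor 2^j is beaten by the power 1 + \<alpha> of the step, leaving
      q^j.\<close>
    have "D x h (Suc j) - D x h j = - (2 ^ j * (F ((x + u) + u) + F ((x + u) - u) - 2 * F (x + u)))"
      unfolding D_def e u_def[symmetric] by (simp add: algebra_simps)
    then have "\<bar>D x h (Suc j) - D x h j\<bar> = 2 ^ j * \<bar>F ((x + u) + u) + F ((x + u) - u) - 2 * F (x + u)\<bar>"
      by (simp only: abs_minus_cancel abs_mult) simp
    also have "\<dots> \<le> 2 ^ j * (C * norm u powr p)"
      unfolding p_def by (intro mult_left_mono sd) auto
    also have "norm u powr p \<le> (norm ((1/2)^j *\<^sub>R h)) powr p"
      using \<alpha> by (intro powr_mono2) (auto simp: u_def p_def mult_right_mono)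
    then have "2 ^ j * (C * norm u powr p) \<le> 2 ^ j * (C * norm ((1/2)^j *\<^sub>R h) powr p)"
      using C by (intro mult_left_mono) auto
    also have "norm ((1/2)^j *\<^sub>R h) powr p = (1/2)^j * q^j * norm h powr p"
    proof -
      have "norm ((1/2)^j *\<^sub>R h) powr p = ((1/2)^j) powr p * norm h powr p"
        by (simp add: powr_mult)
      also have "((1/2::real)^j) powr p = (1/2)^j * q^j"
        unfolding p_def qpow[symmetric] by (simp add: powr_add)
      finally show ?thesis .
    qed
    finally show ?thesis
      by (simp add: power_one_over field_simps)
  qed
  define L where "L = (\<lambda>x h. lim (D x h))"
  define K where "K = C / (1 - q)"
  have K: "K \<ge> 0" using C q by (simp add: K_def)
  have lim: "D x h \<longlonglongrightarrow> L x h" and est: "\<bar>L x h - D x h 0\<bar> \<le> K * norm h powr p" for x h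
  proof -
    define a where "a = C * norm h powr p"
    have s: "summable (\<lambda>j. a * q ^ j)" using q by (intro summable_mult summable_geometric) auto
    have sa: "summable (\<lambda>j. \<bar>D x h (Suc j) - D x h j\<bar>)"
      by (rule summable_comparison_test'[OF s, of 0]) (use step in \<open>auto simp: a_def\<close>)
    then have "summable (\<lambda>j. D x h (Suc j) - D x h j)" by (rule summable_rabs_cancel)
    then have "convergent (\<lambda>n. \<Sum>j<n. D x h (Suc j) - D x h j)"
      by (simp add: summable_iff_convergent)
    then have "convergent (\<lambda>n. D x h n - D x h 0)" by (simp add: sum_lessThan_telescope)
    then have "convergent (\<lambda>n. D x h n)"
      by (simp add: convergent_diff_const_right_iff)
    then show lim: "D x h \<longlonglongrightarrow> L x h" unfolding L_def by (simp add: convergent_LIMSEQ_iff)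
    have "(\<lambda>n. D x h n - D x h 0) \<longlonglongrightarrow> (\<Sum>j. D x h (Suc j) - D x h j)"
      using summable_LIMSEQ[OF summable_rabs_cancel[OF sa]] by (simp add: sum_lessThan_telescope)
    then have "L x h - D x h 0 = (\<Sum>j. D x h (Suc j) - D x h j)"
      using LIMSEQ_unique[OF tendsto_diff[OF lim tendsto_const]] by blast
    also have "\<bar>\<dots>\<bar> \<le> (\<Sum>j. \<bar>D x h (Suc j) - D x h j\<bar>)" by (rule summable_rabs[OF sa])
    also have "\<dots> \<le> (\<Sum>j. a * q ^ j)" using step by (intro suminf_le sa s) (auto simp: a_def)
    also have "\<dots> = K * norm h powr p"
      using q by (simp add: suminf_mult suminf_geometric summable_geometric K_def a_def)
    finally show "\<bar>L x h - D x h 0\<bar> \<le> K * norm h powr p" .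
  qed
  \<comment> \<open>Term 0 of the dyadic sequence is F (x + h) - F x, so the summed error is already
    a Taylor estimate of order 1 + \<alpha>.\<close>
  have taylor: "\<bar>F (x + h) - F x - L x h\<bar> \<le> K * norm h powr p" for x h
    using est[of x h] by (simp add: D_def abs_minus_commute)
  have double: "L x (2 *\<^sub>R h) = 2 * L x h" for x h
  proof -
    have "(\<lambda>j. D x (2 *\<^sub>R h) (Suc j)) \<longlonglongrightarrow> L x (2 *\<^sub>R h)" using lim by (rule LIMSEQ_Suc)
    moreover have "D x (2 *\<^sub>R h) (Suc j) = 2 * D x h j" for j by (simp add: D_def)
    ultimately have "(\<lambda>j. 2 * D x h j) \<longlonglongrightarrow> L x (2 *\<^sub>R h)" by simp
    then show ?thesis using tendsto_mult_left[OF lim] by (rule LIMSEQ_unique)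
  qed
  \<comment> \<open>The points over 2 * a and 2 * b have the point over a + b as midpoint, so this
    combination is again a second difference, with increment (a - b) / 2^j. Together with
    \<open>double\<close> it gives additivity of L x.\<close>
  have mid: "L x (2 *\<^sub>R a) + L x (2 *\<^sub>R b) - 2 * L x (a + b) = 0" for x a b
  proof -
    define s where "s = (\<lambda>j. D x (2 *\<^sub>R a) j + D x (2 *\<^sub>R b) j - 2 * D x (a + b) j)"
    have "s \<longlonglongrightarrow> L x (2 *\<^sub>R a) + L x (2 *\<^sub>R b) - 2 * L x (a + b)"
      unfolding s_def by (intro tendsto_intros lim)
    moreover have "s \<longlonglongrightarrow> 0"
    proof (rule Lim_null_comparison)
      show "\<forall>\<^sub>F j in sequentially. norm (s j) \<le> C * norm (a - b) powr p * q ^ j"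
      proof (rule always_eventually, rule allI)
        fix j
        define c where "c = x + (1/2) ^ j *\<^sub>R (a + b)"
        define t where "t = (1/2) ^ j *\<^sub>R (a - b)"
        have "s j = 2 ^ j * (F (c + t) + F (c - t) - 2 * F c)"
          unfolding s_def D_def c_def t_def by (simp add: algebra_simps scaleR_2)
        then have "norm (s j) = 2 ^ j * \<bar>F (c + t) + F (c - t) - 2 * F c\<bar>" by (simp add: abs_mult)
        also have "\<dots> \<le> 2 ^ j * (C * norm t powr p)"
          unfolding p_def by (intro mult_left_mono sd) auto
        also have "norm t powr p = ((1/2)^j) powr p * norm (a - b) powr p"
          by (simp add: t_def powr_mult)
        also have "((1/2::real)^j) powr p = (1/2)^j * q^j"
          unfolding p_def qpow[symmetric] by (simp add: powr_add)
        finally show "norm (s j) \<le> C * norm (a - b) powr p * q ^ j"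
          by (simp add: power_one_over field_simps)
      qed
      show "(\<lambda>j. C * norm (a - b) powr p * q ^ j) \<longlonglongrightarrow> 0"
        using q by (intro tendsto_mult_right_zero LIMSEQ_power_zero) auto
    qed
    ultimately show ?thesis using LIMSEQ_unique by blast
  qed
  have bl: "bounded_linear (L x)" for x
  proof -
    obtain B where B: "\<And>h. norm h \<le> 1 \<Longrightarrow> \<bar>F (x + h)\<bar> \<le> B" using bd by blast
    show ?thesis
    proof (rule bounded_linear_if_additive_bounded)
      show "L x (a + b) = L x a + L x b" for a b
        using mid[of x a b] by (simp add: double)
      show "\<bar>L x h\<bar> \<le> 2 * B + K" if "norm h \<le> 1" for h
      proof -
        have "norm h powr p \<le> 1" using that \<alpha> by (intro powr_le1) (auto simp: p_def)
        then have "K * norm h powr p \<le> K" using K by (simp add: mult_left_le)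
        then show ?thesis using taylor[of x h] B[of h] B[of 0] that by simp
      qed
    qed
  qed
  have lin: "linear (L x)" for x using bl by (rule bounded_linear.linear)
  have der: "(F has_derivative L x) (at x)" for x
  proof (rule has_derivative_at[THEN iffD2], intro conjI bl)
    show "(\<lambda>h. norm (F (x + h) - F x - L x h) / norm h) \<midarrow>0\<rightarrow> 0"
    proof (rule Lim_null_comparison)
      show "\<forall>\<^sub>F h in at 0. norm (norm (F (x + h) - F x - L x h) / norm h) \<le> K * norm h powr \<alpha>"
        unfolding eventually_at_filter
      proof (intro always_eventually allI impI)
        fix h :: 'a assume "h \<noteq> 0"
        then show "norm (norm (F (x + h) - F x - L x h) / norm h) \<le> K * norm h powr \<alpha>"
          using taylor[of x h] by (simp add: p_def powr_add field_simps)
      qed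
      have "((\<lambda>h::'a. K * norm h powr \<alpha>) \<longlongrightarrow> K * 0 powr \<alpha>) (at 0)"
        using \<alpha> by (intro tendsto_intros tendsto_powr' tendsto_norm_zero) auto
      then show "((\<lambda>h::'a. K * norm h powr \<alpha>) \<longlongrightarrow> 0) (at 0)" by simp
    qed
  qed
  have "\<bar>L x h - L y h\<bar> \<le> (2 powr p * 2 * K + 2 * K) * dist x y powr \<alpha> * norm h" for x y h
  proof (cases "x = y \<or> h = 0")
    case True
    then show ?thesis using linear_0[OF lin] by auto
  next
    case False
    define d where "d = dist x y"
    have d: "d > 0" using False by (simp add: d_def)
    \<comment> \<open>Rescaling h to length d makes x, y and x + k mutually of distance O(d); the
      three Taylor remainders between them are then all O(d powr (1 + \<alpha>)), and dividing by d
      leaves the Hoelder bound.\<close>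
    define k where "k = (d / norm h) *\<^sub>R h"
    have nk: "norm k = d" using False d by (simp add: k_def)
    have "\<bar>F (x + k) - F x - L x k\<bar> \<le> K * d powr p" using taylor[of x k] nk by simp
    moreover have "\<bar>F (x + k) - F y - L y (x - y + k)\<bar> \<le> K * (2 powr p * (d powr p + d powr p))"
    proof -
      have "norm (x - y + k) powr p \<le> (d + d) powr p"
        using norm_triangle_ineq[of "x - y" k] \<alpha>
        by (intro powr_mono2) (auto simp: nk d_def dist_norm p_def)
      also have "\<dots> \<le> 2 powr p * (d powr p + d powr p)"
        using d \<alpha> by (intro powr_sum_le) (auto simp: p_def)
      finally have "K * norm (x - y + k) powr p \<le> K * (2 powr p * (d powr p + d powr p))"
        using K by (intro mult_left_mono)
      then show ?thesis using taylor[of y "x - y + k"] by (simp add: add.commute)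
    qed
    moreover have "\<bar>F x - F y - L y (x - y)\<bar> \<le> K * d powr p"
      using taylor[of y "x - y"] by (simp add: d_def dist_norm)
    moreover have "L y (x - y + k) = L y (x - y) + L y k" by (rule linear_add[OF lin])
    ultimately have "\<bar>L x k - L y k\<bar> \<le> (2 powr p * 2 * K + 2 * K) * d powr p"
      by (simp add: algebra_simps)
    also have "d powr p = d powr \<alpha> * d" using d by (simp add: p_def powr_add)
    finally have *: "\<bar>L x k - L y k\<bar> \<le> (2 powr p * 2 * K + 2 * K) * d powr \<alpha> * d" by simp
    have "L x k - L y k = (d / norm h) * (L x h - L y h)"
      unfolding k_def by (simp only: linear_scale[OF lin]) (simp add: algebra_simps)
    then have "\<bar>L x k - L y k\<bar> = d * (\<bar>L x h - L y h\<bar> / norm h)"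
      using d by (simp add: abs_mult)
    with * have "d * (\<bar>L x h - L y h\<bar> / norm h) \<le> d * ((2 powr p * 2 * K + 2 * K) * d powr \<alpha>)"
      by (simp add: mult.commute)
    then have "\<bar>L x h - L y h\<bar> / norm h \<le> (2 powr p * 2 * K + 2 * K) * d powr \<alpha>"
      using d by (rule mult_left_le_imp_le)
    then show ?thesis using False by (simp add: d_def divide_le_eq)
  qed
  then show ?thesis using der by blast
qed

text \<open>Perron-type extension: the upper envelope \<open>g\<close> of the jet is semiconcave, and the largest function
  below \<open>g\<close> that is semiconvex with the same modulus inherits the semiconcavity of \<open>g\<close>, because
  averaging a function over \<open>\<plusminus>s\<close> and subtracting a constant preserves the competitors.\<close>

lemma C1_holder_extension:
  fixes f :: "'a::real_inner \<Rightarrow> real" and G :: "'a \<Rightarrow> 'a \<Rightarrow> real"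
  assumes \<alpha>: "0 < \<alpha>" "\<alpha> \<le> 1" and M: "M \<ge> 0" and ne: "A \<noteq> {}"
    and lin: "\<And>a. a \<in> A \<Longrightarrow> bounded_linear (G a)"
    and jet: "\<And>a b z. \<lbrakk>a \<in> A; b \<in> A\<rbrakk> \<Longrightarrow> f a + G a (z - a) - (f b + G b (z - b))
      \<le> M * (norm (z - a) powr (1 + \<alpha>) + norm (z - b) powr (1 + \<alpha>))"
  shows "\<exists>F F' K. (\<forall>a\<in>A. F a = f a) \<and> (\<forall>x. (F has_derivative F' x) (at x)) \<and>
    (\<forall>x y h. \<bar>F' x h - F' y h\<bar> \<le> K * dist x y powr \<alpha> * norm h)"
proof -
  define \<phi> where "\<phi> = (\<lambda>x::'a. norm x powr (1 + \<alpha>))"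
  define P where "P = (\<lambda>a z. f a + G a (z - a))"
  define g where "g = (\<lambda>x. INF a\<in>A. P a x + M * \<phi> (x - a))"
  define u where "u = (\<lambda>a x. P a x - M * \<phi> (x - a))"
  \<comment> \<open>The factor 2 is that of \<open>norm_powr_second_difference\<close>: the second
    differences of M * \<phi> are at most C * \<phi> t.\<close>
  define C where "C = 2 * M"
  define S where "S = {w. (\<forall>x. w x \<le> g x) \<and> (\<forall>x t. w (x + t) + w (x - t) \<ge> 2 * w x - C * \<phi> t)}"
  define F where "F = (\<lambda>x. SUP w\<in>S. w x)"
  have C: "C \<ge> 0" using M by (simp add: C_def)
  have \<phi>0: "\<phi> x \<ge> 0" and \<phi>z: "\<phi> 0 = 0" for x by (simp_all add: \<phi>_def)
  have \<phi>sd: "M * \<phi> (x + t) + M * \<phi> (x - t) \<le> 2 * (M * \<phi> x) + C * \<phi> t" for x t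
    using mult_left_mono[OF norm_powr_second_difference[of "1 + \<alpha>" x t] M] \<alpha>
    by (simp add: \<phi>_def C_def algebra_simps)
  \<comment> \<open>The jet condition says precisely that every lower barrier u b lies below every
    upper barrier. Hence g is finite, each u b is a competitor, and at a point a of A both barriers
    pinch F to the value f a.\<close>
  have jet': "u b x \<le> P a x + M * \<phi> (x - a)" if "a \<in> A" "b \<in> A" for a b x
    using jet[of b a x] that by (simp add: u_def P_def \<phi>_def algebra_simps)
  have Psum: "P a (x + t) + P a (x - t) = 2 * P a x" if "a \<in> A" for a x t
  proof -
    interpret bounded_linear "G a" using lin[OF that] .
    have "G a (x + t - a) = G a (x - a) + G a t" "G a (x - t - a) = G a (x - a) - G a t"
      by (simp_all flip: add diff add: algebra_simps)
    then show ?thesis by (simp add: P_def)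
  qed
  have g_le: "g x \<le> P a x + M * \<phi> (x - a)" if "a \<in> A" for a x
    unfolding g_def using that jet'[OF _ that]
    by (intro cINF_lower bdd_belowI2[where m = "u a x"]) auto
  have le_g: "c \<le> g x" if "\<And>a. a \<in> A \<Longrightarrow> c \<le> P a x + M * \<phi> (x - a)" for c x
    unfolding g_def using that ne by (intro cINF_greatest) auto
  have g_sd: "g (x + t) + g (x - t) \<le> 2 * g x + C * \<phi> t" for x t
  proof -
    have "(g (x + t) + g (x - t) - C * \<phi> t) / 2 \<le> g x"
    proof (rule le_g)
      fix a assume a: "a \<in> A"
      show "(g (x + t) + g (x - t) - C * \<phi> t) / 2 \<le> P a x + M * \<phi> (x - a)"
        using g_le[OF a, of "x + t"] g_le[OF a, of "x - t"] \<phi>sd[of "x - a" t] Psum[OF a, of x t]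
        by (simp add: algebra_simps)
    qed
    then show ?thesis by simp
  qed
  have u_S: "u b \<in> S" if b: "b \<in> A" for b
  proof -
    have "u b (x + t) + u b (x - t) \<ge> 2 * u b x - C * \<phi> t" for x t
      using \<phi>sd[of "x - b" t] Psum[OF b, of x t] by (simp add: u_def algebra_simps)
    then show ?thesis using jet' that le_g by (auto simp: S_def)
  qed
  have bdd: "bdd_above ((\<lambda>w. w x) ` S)" for x
    by (rule bdd_aboveI2[where M = "g x"]) (auto simp: S_def)
  have le_F: "w x \<le> F x" if "w \<in> S" for w x
    unfolding F_def using that bdd by (intro cSUP_upper)
  have S_ne: "S \<noteq> {}" using ne u_S by auto
  have F_le: "F x \<le> c" if "\<And>w. w \<in> S \<Longrightarrow> w x \<le> c" for x c
    unfolding F_def using S_ne that by (intro cSUP_least)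
  have F_g: "F x \<le> g x" for x by (rule F_le) (auto simp: S_def)
  have F_lower: "F (x + t) + F (x - t) \<ge> 2 * F x - C * \<phi> t" for x t
  proof -
    have "F x \<le> (F (x + t) + F (x - t) + C * \<phi> t) / 2"
    proof (rule F_le)
      fix w assume w: "w \<in> S"
      then have "w (x + t) + w (x - t) \<ge> 2 * w x - C * \<phi> t" by (simp add: S_def)
      then show "w x \<le> (F (x + t) + F (x - t) + C * \<phi> t) / 2"
        using le_F[OF w, of "x + t"] le_F[OF w, of "x - t"] by simp
    qed
    then show ?thesis by simp
  qed
  have F_upper: "F (x + s) + F (x - s) \<le> 2 * F x + C * \<phi> s" for x s
  proof -
    define w where "w = (\<lambda>x. (F (x + s) + F (x - s) - C * \<phi> s) / 2)"
    have "w \<in> S"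
    proof -
      have "w x \<le> g x" for x
        using F_g[of "x + s"] F_g[of "x - s"] g_sd[of x s] by (simp add: w_def)
      moreover have "w (x + t) + w (x - t) \<ge> 2 * w x - C * \<phi> t" for x t
        using F_lower[of "x + s" t] F_lower[of "x - s" t] by (simp add: w_def field_simps)
      ultimately show ?thesis by (simp add: S_def)
    qed
    from le_F[OF this, of x] show ?thesis by (simp add: w_def)
  qed
  have sd: "\<bar>F (x + t) + F (x - t) - 2 * F x\<bar> \<le> C * norm t powr (1 + \<alpha>)" for x t
    using F_lower[of x t] F_upper[of x t] by (simp add: \<phi>_def)
  obtain b where b: "b \<in> A" using ne by auto
  interpret bounded_linear "G b" using lin[OF b] .
  \<comment> \<open>One base point b suffices for local boundedness: F lies between the lower and
    the upper barrier at b.\<close>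
  have bd: "\<exists>K. \<forall>h. norm h \<le> 1 \<longrightarrow> \<bar>F (x + h)\<bar> \<le> K" for x
  proof -
    obtain N where N: "\<And>v. norm (G b v) \<le> norm v * N" "N \<ge> 0" using nonneg_bounded by blast
    define R where "R = norm (x - b) + 1"
    have "\<bar>F (x + h)\<bar> \<le> \<bar>f b\<bar> + R * N + M * R powr (1 + \<alpha>)" if "norm h \<le> 1" for h
    proof -
      have n: "norm (x + h - b) \<le> R"
        using norm_triangle_ineq[of "x - b" h] that by (simp add: R_def algebra_simps)
      then have "M * \<phi> (x + h - b) \<le> M * R powr (1 + \<alpha>)"
        using M \<alpha> by (auto simp: \<phi>_def intro!: mult_left_mono powr_mono2)
      moreover have "\<bar>G b (x + h - b)\<bar> \<le> R * N"
        using N(1)[of "x + h - b"] mult_right_mono[OF n N(2)] by simp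
      moreover have "u b (x + h) \<le> F (x + h)" "F (x + h) \<le> P b (x + h) + M * \<phi> (x + h - b)"
        using le_F[OF u_S[OF b]] F_g[of "x + h"] g_le[OF b, of "x + h"] by auto
      ultimately show ?thesis unfolding u_def P_def by linarith
    qed
    then show ?thesis by blast
  qed
  have "F a = f a" if a: "a \<in> A" for a
  proof -
    have "P a a = f a" using bounded_linear.linear[OF lin[OF a]] by (simp add: P_def linear_0)
    then show ?thesis
      using le_F[OF u_S[OF a], of a] F_g[of a] g_le[OF a, of a] by (simp add: u_def \<phi>z)
  qed
  then show ?thesis using C1_holder_if_second_difference[OF \<alpha> C sd bd] by blast
qed

subsection \<open>Hausdorff measure as a Borel measure\<close>

lemma hausdorff_pre_mono: "A \<subseteq> B \<Longrightarrow> hausdorff_pre k \<delta> A \<le> hausdorff_pre k \<delta> B"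
  unfolding hausdorff_pre_def by (rule INF_superset_mono) auto

lemma hausdorff_mono: "A \<subseteq> B \<Longrightarrow> hausdorff k A \<le> hausdorff k B"
  unfolding hausdorff_def by (rule SUP_mono) (use hausdorff_pre_mono in blast)

lemma hausdorff_pre_le_hausdorff: "\<delta> > 0 \<Longrightarrow> hausdorff_pre k \<delta> E \<le> hausdorff k E"
  unfolding hausdorff_def by (rule SUP_upper) auto

text \<open>Brings covers indexed by any countable set, such as the balls selected by Vitali, into a
  definition that admits only sequences. The spare indices receive the empty set, which contributes
  0 ^ k = 0 because k \<ge> 1.\<close>

lemma hausdorff_pre_le_nn_integral:
  assumes "countable I" "k \<ge> 1" "\<delta> \<ge> 0" and B: "B \<subseteq> (\<Union>i\<in>I. D i)"
    and D: "\<And>i. i \<in> I \<Longrightarrow> bounded (D i) \<and> diameter (D i) \<le> \<delta>"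
  shows "hausdorff_pre k \<delta> B \<le> (\<integral>\<^sup>+i. ennreal (diameter (D i) ^ k) \<partial>count_space I)"
proof -
  define C where "C n = (if n \<in> to_nat_on I ` I then D (from_nat_into I n) else {})" for n
  have inj: "inj_on (to_nat_on I) I" using assms(1) by (rule inj_on_to_nat_on)
  have "(\<integral>\<^sup>+i. ennreal (diameter (D i) ^ k) \<partial>count_space I)
      = (\<integral>\<^sup>+i. ennreal (diameter (C (to_nat_on I i)) ^ k) \<partial>count_space I)"
    using assms(1) by (intro nn_integral_cong) (simp add: C_def)
  also have "\<dots> = (\<integral>\<^sup>+n. ennreal (diameter (C n) ^ k) \<partial>count_space (to_nat_on I ` I))"
    using inj by (subst nn_integral_bij_count_space[symmetric, of "to_nat_on I" I])
      (auto simp: bij_betw_def)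
  also have "\<dots> = (\<integral>\<^sup>+n. ennreal (diameter (C n) ^ k) \<partial>count_space UNIV)"
    using assms(2) by (intro nn_integral_count_space_eq) (auto simp: C_def diameter_empty zero_power)
  also have "\<dots> = (\<Sum>n. ennreal (diameter (C n) ^ k))"
    by (rule nn_integral_count_space_nat)
  finally have eq: "(\<integral>\<^sup>+i. ennreal (diameter (D i) ^ k) \<partial>count_space I) = (\<Sum>n. ennreal (diameter (C n) ^ k))" .
  have "C \<in> {C. B \<subseteq> (\<Union>i. C i) \<and> (\<forall>i. bounded (C i) \<and> diameter (C i) \<le> \<delta>)}"
  proof safe
    fix x assume "x \<in> B"
    then obtain i where "i \<in> I" "x \<in> D i" using B by blast
    then have "x \<in> C (to_nat_on I i)" using assms(1) by (simp add: C_def)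
    then show "x \<in> (\<Union>n. C n)" by blast
  qed (use D assms(1,3) in \<open>auto simp: C_def diameter_empty\<close>)
  then show ?thesis unfolding eq hausdorff_pre_def by (rule INF_lower)
qed

lemma hausdorff_pre_empty: "k \<ge> 1 \<Longrightarrow> \<delta> \<ge> 0 \<Longrightarrow> hausdorff_pre k \<delta> {} = 0"
  using hausdorff_pre_le_nn_integral[of "{}" k \<delta> "{}" "\<lambda>_. {}"] by simp

lemma hausdorff_empty [simp]: "k \<ge> 1 \<Longrightarrow> hausdorff k {} = 0"
  by (simp add: hausdorff_def hausdorff_pre_empty)

lemma hausdorff_pre_countable_subadditive:
  "hausdorff_pre k \<delta> (\<Union>n::nat. A n) \<le> (\<Sum>n. hausdorff_pre k \<delta> (A n))"
proof (rule ennreal_le_epsilon)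
  fix e :: real assume fin: "(\<Sum>n. hausdorff_pre k \<delta> (A n)) < top" and e: "e > 0"
  have "hausdorff_pre k \<delta> (A n) < hausdorff_pre k \<delta> (A n) + ennreal (e * (1/2) ^ Suc n)" for n
  proof -
    have "hausdorff_pre k \<delta> (A n) < top"
      using fin by (metis ennreal_suminf_lessD)
    then show ?thesis
      using e ennreal_add_left_cancel_less[of "hausdorff_pre k \<delta> (A n)" 0] by (simp add: less_top)
  qed
  then have "\<exists>C. (A n \<subseteq> (\<Union>i. C i) \<and> (\<forall>i. bounded (C i) \<and> diameter (C i) \<le> \<delta>)) \<and>
      (\<Sum>i. ennreal (diameter (C i) ^ k)) < hausdorff_pre k \<delta> (A n) + ennreal (e * (1/2) ^ Suc n)" for n
    unfolding hausdorff_pre_def INF_less_iff by blast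
  then obtain C where C: "\<And>n. A n \<subseteq> (\<Union>i. C n i)"
      "\<And>n i. bounded (C n i)" "\<And>n i. diameter (C n i) \<le> \<delta>"
      "\<And>n. (\<Sum>i. ennreal (diameter (C n i) ^ k)) < hausdorff_pre k \<delta> (A n) + ennreal (e * (1/2) ^ Suc n)"
    by metis
  define D where "D m = C (fst (prod_decode m)) (snd (prod_decode m))" for m
  have "(\<Union>n. A n) \<subseteq> (\<Union>m. D m)"
  proof
    fix x assume "x \<in> (\<Union>n. A n)"
    then obtain n i where "x \<in> C n i" using C(1) by blast
    then have "x \<in> D (prod_encode (n, i))" by (simp add: D_def)
    then show "x \<in> (\<Union>m. D m)" by blast
  qed
  moreover have "\<forall>m. bounded (D m) \<and> diameter (D m) \<le> \<delta>" using C(2,3) by (simp add: D_def)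
  ultimately have "hausdorff_pre k \<delta> (\<Union>n. A n) \<le> (\<Sum>m. ennreal (diameter (D m) ^ k))"
    unfolding hausdorff_pre_def by (intro INF_lower) simp
  also have "\<dots> = (\<Sum>m. (\<lambda>(n, i). ennreal (diameter (C n i) ^ k)) (prod_decode m))"
    by (simp add: case_prod_beta D_def)
  also have "\<dots> = (\<Sum>n. \<Sum>i. ennreal (diameter (C n i) ^ k))"
    by (rule suminf_ennreal_2dimen) simp
  also have "\<dots> \<le> (\<Sum>n. hausdorff_pre k \<delta> (A n) + ennreal (e * (1/2) ^ Suc n))"
    using C(4) by (intro suminf_le) (auto simp: less_imp_le)
  also have "\<dots> = (\<Sum>n. hausdorff_pre k \<delta> (A n)) + (\<Sum>n. ennreal (e * (1/2) ^ Suc n))"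
    by (rule suminf_add[symmetric]) auto
  also have "(\<Sum>n. ennreal (e * (1/2) ^ Suc n)) = ennreal e"
    using e by (intro suminf_ennreal_eq) (use sums_mult[OF power_half_series, of e] in auto)
  finally show "hausdorff_pre k \<delta> (\<Union>n. A n) \<le> (\<Sum>n. hausdorff_pre k \<delta> (A n)) + ennreal e" .
qed

lemma hausdorff_countable_subadditive:
  "hausdorff k (\<Union>n::nat. A n) \<le> (\<Sum>n. hausdorff k (A n))"
proof -
  have "hausdorff_pre k \<delta> (\<Union>n. A n) \<le> (\<Sum>n. hausdorff k (A n))" if "\<delta> > 0" for \<delta>
    by (rule order_trans[OF hausdorff_pre_countable_subadditive[of k \<delta> A]])
      (intro suminf_le hausdorff_pre_le_hausdorff that summableI)
  then show ?thesis unfolding hausdorff_def[of k "\<Union>n. A n"] by (intro SUP_least) auto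
qed

lemma hausdorff_outer_measure: "k \<ge> 1 \<Longrightarrow> outer_measure_space UNIV (hausdorff k)"
  by (simp add: outer_measure_space_def positive_def increasing_def countably_subadditive_def
      hausdorff_mono hausdorff_countable_subadditive)

lemma hausdorff_subadditive:
  assumes "k \<ge> 1" shows "hausdorff k (A \<union> B) \<le> hausdorff k A + hausdorff k B"
proof -
  have "hausdorff k (\<Union>n::nat. if n = 0 then A else if n = 1 then B else {})
      \<le> (\<Sum>n::nat. hausdorff k (if n = 0 then A else if n = 1 then B else {}))"
    by (rule hausdorff_countable_subadditive)
  also have "\<dots> = (\<Sum>n\<in>{0,1::nat}. hausdorff k (if n = 0 then A else if n = 1 then B else {}))"
    using assms by (intro suminf_finite) auto
  also have "(\<Union>n::nat. if n = 0 then A else if n = 1 then B else {}) = A \<union> B"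
    by (auto split: if_splits)
  finally show ?thesis by simp
qed

lemma hausdorff_countable_null:
  assumes k: "k \<ge> 1" and "countable \<N>" "\<And>N. N \<in> \<N> \<Longrightarrow> hausdorff k N = 0"
  shows "hausdorff k (\<Union>\<N>) = 0"
proof (cases "\<N> = {}")
  case False
  have "hausdorff k (\<Union>n. from_nat_into \<N> n) \<le> (\<Sum>n. hausdorff k (from_nat_into \<N> n))"
    by (rule hausdorff_countable_subadditive)
  also have "\<dots> = 0" using assms(3) from_nat_into[OF False] by simp
  finally show ?thesis using False assms(2) by simp
qed (use k in simp)

text \<open>A set of diameter below the distance of \<open>A\<close> and \<open>B\<close> meets at most one of them.\<close>

lemma hausdorff_metric_additive:
  assumes k: "k \<ge> 1" and d: "d > 0" and sep: "\<And>a b. a \<in> A \<Longrightarrow> b \<in> B \<Longrightarrow> dist a b \<ge> d"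
  shows "hausdorff k A + hausdorff k B \<le> hausdorff k (A \<union> B)"
proof -
  have pre: "hausdorff_pre k \<delta> A + hausdorff_pre k \<delta> B \<le> hausdorff_pre k \<delta> (A \<union> B)"
    if \<delta>: "0 < \<delta>" "\<delta> < d" for \<delta>
    unfolding hausdorff_pre_def[of k \<delta> "A \<union> B"]
  proof (rule INF_greatest)
    fix C assume C: "C \<in> {C :: nat \<Rightarrow> _. A \<union> B \<subseteq> (\<Union>i. C i) \<and> (\<forall>i. bounded (C i) \<and> diameter (C i) \<le> \<delta>)}"
    define CA where "CA i = (if C i \<inter> A = {} then {} else C i)" for i
    define CB where "CB i = (if C i \<inter> A = {} then C i else {})" for i
    have "hausdorff_pre k \<delta> A \<le> (\<Sum>i. ennreal (diameter (CA i) ^ k))"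
      unfolding hausdorff_pre_def using C \<delta>
      by (intro INF_lower) (auto simp: CA_def diameter_empty, blast)
    moreover have "hausdorff_pre k \<delta> B \<le> (\<Sum>i. ennreal (diameter (CB i) ^ k))"
      unfolding hausdorff_pre_def
    proof (intro INF_lower CollectI conjI allI subsetI)
      fix b assume b: "b \<in> B"
      then obtain i where i: "b \<in> C i" using C by auto
      have "C i \<inter> A = {}"
      proof (rule ccontr)
        assume "C i \<inter> A \<noteq> {}"
        then obtain a where a: "a \<in> C i" "a \<in> A" by auto
        have "dist a b \<le> diameter (C i)" using C a i by (intro diameter_bounded_bound) auto
        also have "\<dots> \<le> \<delta>" using C by auto
        finally show False using sep[OF a(2) b] \<delta> by simp
      qed
      then show "b \<in> (\<Union>i. CB i)" using i by (auto simp: CB_def)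
    qed (use C \<delta> in \<open>auto simp: CB_def diameter_empty\<close>)
    ultimately have "hausdorff_pre k \<delta> A + hausdorff_pre k \<delta> B
        \<le> (\<Sum>i. ennreal (diameter (CA i) ^ k)) + (\<Sum>i. ennreal (diameter (CB i) ^ k))"
      by (rule add_mono)
    also have "\<dots> = (\<Sum>i. ennreal (diameter (CA i) ^ k) + ennreal (diameter (CB i) ^ k))"
      by (rule suminf_add) auto
    also have "\<dots> = (\<Sum>i. ennreal (diameter (C i) ^ k))"
      using k by (intro suminf_cong) (auto simp: CA_def CB_def diameter_empty zero_power)
    finally show "hausdorff_pre k \<delta> A + hausdorff_pre k \<delta> B \<le> (\<Sum>i. ennreal (diameter (C i) ^ k))" .
  qed
  have "((\<lambda>\<delta>. hausdorff_pre k \<delta> A + hausdorff_pre k \<delta> B) \<longlongrightarrow> hausdorff k A + hausdorff k B) (at_right 0)"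
    by (intro tendsto_add hausdorff_pre_tendsto)
  moreover have "\<forall>\<^sub>F \<delta> in at_right 0. hausdorff_pre k \<delta> A + hausdorff_pre k \<delta> B \<le> hausdorff_pre k \<delta> (A \<union> B)"
    unfolding eventually_at_right_field using d pre by auto
  ultimately show ?thesis
    using tendsto_le[OF trivial_limit_at_right_real hausdorff_pre_tendsto] by blast
qed

text \<open>Caratheodory's criterion. The layers \<open>R i\<close> of \<open>A - C\<close> around the closed set \<open>C\<close> with indices
  of equal parity are separated, so their measures are summable.\<close>

lemma hausdorff_caratheodory_closed:
  fixes A C :: "'a::metric_space set"
  assumes k: "k \<ge> 1" and C: "closed C" "C \<noteq> {}"
  shows "hausdorff k (A \<inter> C) + hausdorff k (A - C) \<le> hausdorff k A"
proof (cases "hausdorff k A = \<infinity>")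
  case False
  define d where "d x = infdist x C" for x
  define L where "L n = {x \<in> A. d x \<ge> 1 / real (Suc n)}" for n
  define R where "R n = L (Suc n) - L n" for n
  have lip: "d x \<le> d y + dist x y" for x y unfolding d_def by (rule infdist_triangle)
  have Lmono: "L m \<subseteq> L n" if "m \<le> n" for m n
    using that by (auto simp: L_def intro: order_trans[rotated] simp: frac_le)
  have union: "A - C = L n \<union> (\<Union>i. R (i + n))" for n
  proof safe
    fix x assume x: "x \<in> A" "x \<notin> C" "x \<notin> (\<Union>i. R (i + n))"
    have "d x > 0" unfolding d_def using C x in_closed_iff_infdist_zero[of C x]
      infdist_nonneg[of x C] by (simp add: less_le)
    then obtain m where m: "1 / real (Suc m) < d x"
      using reals_Archimedean by (auto simp: inverse_eq_divide)
    have "x \<in> L (n + j) \<Longrightarrow> x \<in> L n" for j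
      using x(3) by (induction j) (auto simp: R_def add.commute)
    moreover have "x \<in> L (n + m)"
      using m x Lmono[of m "n + m"] by (auto simp: L_def)
    ultimately show "x \<in> L n" by blast
  next
    fix x assume "x \<in> L n" "x \<in> C"
    then show False using C by (auto simp: L_def d_def)
  next
    fix x i assume "x \<in> R (i + n)" "x \<in> C"
    then show False using C by (auto simp: R_def L_def d_def)
  qed (auto simp: L_def R_def)
  have par: "(\<Sum>i<N. hausdorff k (R (2 * i + c))) \<le> hausdorff k A" for N c
  proof -
    have "(\<Sum>i<N. hausdorff k (R (2 * i + c))) \<le> hausdorff k (\<Union>i<N. R (2 * i + c))"
    proof (induction N)
      case (Suc N)
      \<comment> \<open>Earlier layers of the same parity lie in L (2 * N - 1 + c), while the new
        layer avoids L (2 * N + c); e is the gap between the two thresholds. For N = 0 the truncated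
        2 * N - 1 would make e vanish, but then there is no earlier layer.\<close>
      define e where "e = 1 / real (Suc (2 * N - 1 + c)) - 1 / real (Suc (2 * N + c))"
      show ?case
      proof (cases "N = 0")
        case False
        have e: "e > 0" using False unfolding e_def diff_gt_0_iff_gt by (intro divide_strict_left_mono) auto
        have sep: "dist x y \<ge> e" if x: "x \<in> (\<Union>i<N. R (2 * i + c))" and y: "y \<in> R (2 * N + c)" for x y
        proof -
          obtain i where i: "i < N" "x \<in> R (2 * i + c)" using x by auto
          have "Suc (2 * i + c) \<le> 2 * N - 1 + c" using i(1) by linarith
          from Lmono[OF this] have "x \<in> L (2 * N - 1 + c)"
            using i(2) by (auto simp: R_def)
          then have "d x \<ge> 1 / real (Suc (2 * N - 1 + c))" by (simp add: L_def)
          moreover have "d y < 1 / real (Suc (2 * N + c))" using y by (auto simp: R_def L_def)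
          ultimately show ?thesis using lip[of x y] by (simp add: e_def)
        qed
        have "(\<Sum>i<Suc N. hausdorff k (R (2 * i + c)))
            \<le> hausdorff k (\<Union>i<N. R (2 * i + c)) + hausdorff k (R (2 * N + c))"
          using Suc.IH by (simp add: add_right_mono)
        also have "\<dots> \<le> hausdorff k ((\<Union>i<N. R (2 * i + c)) \<union> R (2 * N + c))"
          by (rule hausdorff_metric_additive[OF k e sep])
        also have "(\<Union>i<N. R (2 * i + c)) \<union> R (2 * N + c) = (\<Union>i<Suc N. R (2 * i + c))"
          by (auto simp: less_Suc_eq)
        finally show ?thesis .
      qed (simp add: lessThan_Suc)
    qed simp
    also have "\<dots> \<le> hausdorff k A" by (intro hausdorff_mono) (auto simp: R_def L_def)
    finally show ?thesis .
  qed
  have parsum: "(\<Sum>i. hausdorff k (R (2 * i + c))) < \<infinity>" for c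
  proof -
    have "(\<Sum>i. hausdorff k (R (2 * i + c))) \<le> hausdorff k A"
      by (rule suminf_le_const[OF summableI par])
    then show ?thesis using False by (simp add: less_top top.not_eq_extremum le_less_trans)
  qed
  have "(\<Sum>i. hausdorff k (R i)) \<noteq> \<infinity>"
  proof -
    have "(\<Sum>i<n. hausdorff k (R i)) \<le> (\<Sum>i. hausdorff k (R (2 * i + 0))) + (\<Sum>i. hausdorff k (R (2 * i + 1)))" for n
    proof -
      have "(\<Sum>i<n. hausdorff k (R i)) \<le> (\<Sum>i<2 * n. hausdorff k (R i))"
        by (intro sum_mono2) auto
      also have "\<dots> = (\<Sum>i<n. hausdorff k (R (2 * i + 0))) + (\<Sum>i<n. hausdorff k (R (2 * i + 1)))"
        by (induction n) (auto simp: algebra_simps)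
      also have "\<dots> \<le> (\<Sum>i. hausdorff k (R (2 * i + 0))) + (\<Sum>i. hausdorff k (R (2 * i + 1)))"
        by (intro add_mono sum_le_suminf) auto
      finally show ?thesis .
    qed
    then have "(\<Sum>i. hausdorff k (R i)) \<le> (\<Sum>i. hausdorff k (R (2 * i + 0))) + (\<Sum>i. hausdorff k (R (2 * i + 1)))"
      by (intro suminf_le_const summableI) auto
    then show ?thesis using parsum[of 0] parsum[of 1] by (auto simp: top_unique)
  qed
  then have tail: "(\<lambda>n. \<Sum>i. hausdorff k (R (i + n))) \<longlonglongrightarrow> 0"
  proof -
    define g where "g i = enn2real (hausdorff k (R i))" for i
    have R: "hausdorff k (R i) = ennreal (g i)" for i
    proof -
      have "hausdorff k (R i) \<le> hausdorff k A" by (intro hausdorff_mono) (auto simp: R_def L_def)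
      then show ?thesis using False by (simp add: g_def top.not_eq_extremum le_less_trans)
    qed
    have g: "g i \<ge> 0" for i by (simp add: g_def)
    have s: "summable g"
      using \<open>(\<Sum>i. hausdorff k (R i)) \<noteq> \<infinity>\<close> g by (intro summable_suminf_not_top) (auto simp: R)
    have "(\<Sum>i. hausdorff k (R (i + n))) = ennreal (\<Sum>i. g (i + n))" for n
      unfolding R using g s by (intro suminf_ennreal2 summable_ignore_initial_segment)
    moreover have "(\<lambda>n. ennreal (\<Sum>i. g (i + n))) \<longlonglongrightarrow> ennreal 0"
      by (intro tendsto_ennrealI suminf_exist_split2 s)
    ultimately show ?thesis by simp
  qed
  \<comment> \<open>L n stays at distance 1 / (n + 1) from C, so its measure and that of A \<inter>
    C add up; the rest of A - C is bounded by the tail of a convergent series.\<close>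
  have "hausdorff k (A \<inter> C) + hausdorff k (A - C) \<le> hausdorff k A + (\<Sum>i. hausdorff k (R (i + n)))" for n
  proof -
    have "hausdorff k (A - C) \<le> hausdorff k (L n) + hausdorff k (\<Union>i. R (i + n))"
      unfolding union[of n] by (rule hausdorff_subadditive[OF k])
    also have "\<dots> \<le> hausdorff k (L n) + (\<Sum>i. hausdorff k (R (i + n)))"
      by (intro add_left_mono hausdorff_countable_subadditive)
    finally have "hausdorff k (A \<inter> C) + hausdorff k (A - C)
        \<le> (hausdorff k (A \<inter> C) + hausdorff k (L n)) + (\<Sum>i. hausdorff k (R (i + n)))"
      by (simp add: add.assoc add_left_mono)
    also have "hausdorff k (A \<inter> C) + hausdorff k (L n) \<le> hausdorff k ((A \<inter> C) \<union> L n)"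
    proof (rule hausdorff_metric_additive[OF k])
      show "0 < 1 / real (Suc n)" by simp
      show "1 / real (Suc n) \<le> dist a b" if "a \<in> A \<inter> C" "b \<in> L n" for a b
        using that lip[of b a] by (auto simp: L_def d_def dist_commute)
    qed
    also have "\<dots> \<le> hausdorff k A" by (intro hausdorff_mono) (auto simp: L_def)
    finally show ?thesis by (simp add: add_right_mono)
  qed
  then show ?thesis
    using tendsto_le[OF _ tendsto_add[OF tendsto_const tail] tendsto_const] by fastforce
qed simp

section \<open>Restriction of the Hausdorff measure to a Borel set\<close>

definition hausdorff_restr :: "nat \<Rightarrow> 'a::metric_space set \<Rightarrow> 'a measure" where
  "hausdorff_restr k E = measure_of UNIV (sets borel) (\<lambda>X. hausdorff k (E \<inter> X))"

lemma hausdorff_caratheodory_borel: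
  fixes X :: "'a::metric_space set"
  assumes k: "k \<ge> 1" and X: "X \<in> sets borel"
  shows "X \<in> lambda_system UNIV UNIV (hausdorff k)"
proof -
  have oms: "outer_measure_space UNIV (hausdorff k :: 'a set \<Rightarrow> _)"
    by (rule hausdorff_outer_measure[OF k])
  interpret S: sigma_algebra UNIV "UNIV :: 'a set set" using sigma_algebra_Pow[of UNIV] by simp
  have "measure_space UNIV (lambda_system UNIV UNIV (hausdorff k :: 'a set \<Rightarrow> _)) (hausdorff k)"
    by (rule S.caratheodory_lemma[OF oms])
  then interpret L: sigma_algebra UNIV "lambda_system UNIV UNIV (hausdorff k :: 'a set \<Rightarrow> _)"
    by (simp add: measure_space_def)
  have "C \<in> lambda_system UNIV UNIV (hausdorff k)" if "closed C" for C :: "'a set"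
  proof (cases "C = {}")
    case False
    have "hausdorff k (A \<inter> C) + hausdorff k (A - C) = hausdorff k A" for A
    proof (rule antisym)
      show "hausdorff k (A \<inter> C) + hausdorff k (A - C) \<le> hausdorff k A"
        by (rule hausdorff_caratheodory_closed[OF k that False])
      have "hausdorff k A = hausdorff k ((A \<inter> C) \<union> (A - C))" by (rule arg_cong) auto
      also have "\<dots> \<le> hausdorff k (A \<inter> C) + hausdorff k (A - C)"
        by (rule hausdorff_subadditive[OF k])
      finally show "hausdorff k A \<le> hausdorff k (A \<inter> C) + hausdorff k (A - C)" .
    qed
    then show ?thesis by (simp add: S.lambda_system_eq)
  qed (use L.empty_sets in simp)
  then have "sigma_sets UNIV {C :: 'a set. closed C} \<subseteq> lambda_system UNIV UNIV (hausdorff k)"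
    by (intro L.sigma_sets_subset) auto
  then show ?thesis using X by (auto simp: borel_eq_closed)
qed

lemma space_hausdorff_restr [simp]: "space (hausdorff_restr k E) = UNIV"
  by (simp add: hausdorff_restr_def space_measure_of_conv)

lemma sets_hausdorff_restr [simp, measurable_cong]: "sets (hausdorff_restr k E) = sets borel"
  unfolding hausdorff_restr_def using sets.sigma_sets_eq[of borel] by (simp add: sets_measure_of_conv)

text \<open>Countable additivity is inherited from the Caratheodory sigma-algebra, which contains
  the Borel sets. From here on continuity from below and outer regularity can be applied to the
  restricted measure.\<close>

lemma emeasure_hausdorff_restr:
  fixes E :: "'a::metric_space set"
  assumes k: "k \<ge> 1" and E: "E \<in> sets borel" and X: "X \<in> sets borel"
  shows "emeasure (hausdorff_restr k E) X = hausdorff k (E \<inter> X)"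
proof -
  have oms: "outer_measure_space UNIV (hausdorff k :: 'a set \<Rightarrow> _)"
    by (rule hausdorff_outer_measure[OF k])
  interpret S: sigma_algebra UNIV "UNIV :: 'a set set" using sigma_algebra_Pow[of UNIV] by simp
  have ms: "measure_space UNIV (lambda_system UNIV UNIV (hausdorff k :: 'a set \<Rightarrow> _)) (hausdorff k)"
    by (rule S.caratheodory_lemma[OF oms])
  show ?thesis
  proof (rule emeasure_measure_of[OF hausdorff_restr_def])
    show "positive (sets (hausdorff_restr k E)) (\<lambda>X. hausdorff k (E \<inter> X))"
      using k by (simp add: positive_def)
    show "countably_additive (sets (hausdorff_restr k E)) (\<lambda>X. hausdorff k (E \<inter> X))"
    proof (rule countably_additiveI)
      fix A :: "nat \<Rightarrow> 'a set"
      assume A: "range A \<subseteq> sets (hausdorff_restr k E)" "disjoint_family A"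
      have "countably_additive (lambda_system UNIV UNIV (hausdorff k :: 'a set \<Rightarrow> _)) (hausdorff k)"
        using ms by (simp add: measure_space_def)
      moreover have r: "range (\<lambda>i. E \<inter> A i) \<subseteq> sets borel" using A E by auto
      then have "range (\<lambda>i. E \<inter> A i) \<subseteq> lambda_system UNIV UNIV (hausdorff k)"
        using hausdorff_caratheodory_borel[OF k] by blast
      moreover have "disjoint_family (\<lambda>i. E \<inter> A i)" using A(2) by (auto simp: disjoint_family_on_def)
      moreover have "(\<Union>i. E \<inter> A i) \<in> lambda_system UNIV UNIV (hausdorff k)"
        using r by (intro hausdorff_caratheodory_borel[OF k]) blast
      ultimately have "(\<Sum>i. hausdorff k (E \<inter> A i)) = hausdorff k (\<Union>i. E \<inter> A i)"
        unfolding countably_additive_def by blast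
      then show "(\<Sum>i. hausdorff k (E \<inter> A i)) = hausdorff k (E \<inter> (\<Union>i. A i))" by simp
    qed
  qed (use X in auto)
qed

subsection \<open>Density theorems\<close>

text \<open>Choose balls of radius r below \<delta> / 10 inside U with mass at least t * r^k. A
  disjoint subfamily has 5-fold enlargements that cover B; each enlargement has diameter 10 * r
  \<le> \<delta> and costs (10 * r)^k, at most 10^k / t times the mass of the original ball. The
  open set U stays free: it is the whole space for the upper density bound and a neighbourhood of
  small mass for density points.\<close>

lemma hausdorff_le_Vitali:
  fixes B :: "'a::euclidean_space set"
  assumes k: "k \<ge> 1" and \<nu>: "sets \<nu> = sets borel" and U: "open U" "B \<subseteq> U" and t: "t > 0"
    and dense: "\<And>x d. x \<in> B \<Longrightarrow> d > 0 \<Longrightarrow> \<exists>r. 0 < r \<and> r < d \<and> ennreal (t * r ^ k) \<le> emeasure \<nu> (cball x r)"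
  shows "hausdorff k B \<le> ennreal (10 ^ k / t) * emeasure \<nu> U"
proof -
  have "hausdorff_pre k \<delta> B \<le> ennreal (10 ^ k / t) * emeasure \<nu> U" if \<delta>: "\<delta> > 0" for \<delta>
  proof -
    define K where "K = {(x, r). x \<in> B \<and> 0 < r \<and> r < \<delta> / 10 \<and> cball x r \<subseteq> U \<and>
      ennreal (t * r ^ k) \<le> emeasure \<nu> (cball x r)}"
    have cov: "B \<subseteq> (\<Union>i\<in>K. cball (fst i) (snd i))"
    proof
      fix x assume x: "x \<in> B"
      then obtain e where e: "e > 0" "cball x e \<subseteq> U"
        using U open_contains_cball_eq by blast
      obtain r where r: "0 < r" "r < min e (\<delta> / 10)" "ennreal (t * r ^ k) \<le> emeasure \<nu> (cball x r)"
        using dense[OF x, of "min e (\<delta> / 10)"] e \<delta> by auto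
      have "cball x r \<subseteq> cball x e" using r by (intro subset_cball) simp
      then have "cball x r \<subseteq> U" using e(2) by blast
      then have "(x, r) \<in> K" using x r by (simp add: K_def)
      then show "x \<in> (\<Union>i\<in>K. cball (fst i) (snd i))"
        by (rule UN_I) (use r(1) in simp)
    qed
    have rad: "0 < snd i \<and> snd i \<le> \<delta> / 10" if "i \<in> K" for i
      using that by (auto simp: K_def)
    obtain C where C: "countable C" "C \<subseteq> K"
      "pairwise (\<lambda>i j. disjnt (cball (fst i) (snd i)) (cball (fst j) (snd j))) C"
      "B \<subseteq> (\<Union>i\<in>C. cball (fst i) (5 * snd i))"
      using Vitali_covering_lemma_cballs[of B fst snd K "\<delta> / 10", OF cov rad] .
    have diam: "diameter (cball (fst i) (5 * snd i)) = 10 * snd i" if "i \<in> C" for i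
      using rad[of i] that C(2) by (auto simp: diameter_cball)
    have "hausdorff_pre k \<delta> B \<le> (\<integral>\<^sup>+i. ennreal (diameter (cball (fst i) (5 * snd i)) ^ k) \<partial>count_space C)"
    proof (rule hausdorff_pre_le_nn_integral[OF C(1) k _ C(4)])
      show "bounded (cball (fst i) (5 * snd i)) \<and> diameter (cball (fst i) (5 * snd i)) \<le> \<delta>"
        if "i \<in> C" for i
        using rad[of i] that C(2) diam[OF that] by auto
    qed (use \<delta> in simp)
    also have "\<dots> \<le> (\<integral>\<^sup>+i. ennreal (10 ^ k / t) * emeasure \<nu> (cball (fst i) (snd i)) \<partial>count_space C)"
    proof (rule nn_integral_mono)
      fix i assume "i \<in> space (count_space C)"
      then have i: "i \<in> C" by simp
      have "ennreal (diameter (cball (fst i) (5 * snd i)) ^ k) = ennreal (10 ^ k / t) * ennreal (t * snd i ^ k)"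
        using t rad[of i] i C(2) by (subst ennreal_mult[symmetric]) (auto simp: diam power_mult_distrib)
      also have "\<dots> \<le> ennreal (10 ^ k / t) * emeasure \<nu> (cball (fst i) (snd i))"
        using i C(2) by (intro mult_left_mono) (auto simp: K_def)
      finally show "ennreal (diameter (cball (fst i) (5 * snd i)) ^ k)
        \<le> ennreal (10 ^ k / t) * emeasure \<nu> (cball (fst i) (snd i))" .
    qed
    also have "\<dots> = ennreal (10 ^ k / t) * (\<integral>\<^sup>+i. emeasure \<nu> (cball (fst i) (snd i)) \<partial>count_space C)"
      by (rule nn_integral_cmult) simp
    also have "(\<integral>\<^sup>+i. emeasure \<nu> (cball (fst i) (snd i)) \<partial>count_space C)
        = emeasure \<nu> (\<Union>i\<in>C. cball (fst i) (snd i))"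
      using C(1,3) by (intro emeasure_UN_countable[symmetric])
        (auto simp: \<nu> disjoint_family_on_def pairwise_def disjnt_def)
    also have "\<dots> \<le> emeasure \<nu> U"
    proof (rule emeasure_mono)
      have "cball (fst i) (snd i) \<subseteq> U" if "i \<in> C" for i
        using subsetD[OF C(2) that] by (simp add: K_def split_beta)
      then show "(\<Union>i\<in>C. cball (fst i) (snd i)) \<subseteq> U" by blast
    qed (use U in \<open>simp add: \<nu>\<close>)
    finally show ?thesis by (simp add: mult_left_mono)
  qed
  then show ?thesis unfolding hausdorff_def by (intro SUP_least) auto
qed

lemma ennreal_eq_0_if_le_small:
  fixes x :: ennreal
  assumes "\<And>n::nat. n > 0 \<Longrightarrow> x \<le> ennreal (c / real n)"
  shows "x = 0"
proof -
  have "(\<lambda>n. ennreal (c / real n)) \<longlonglongrightarrow> ennreal 0"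
    by (intro tendsto_ennrealI lim_const_over_n)
  then have "x \<le> ennreal 0"
    by (rule LIMSEQ_le_const) (use assms in \<open>auto intro!: exI[of _ 1]\<close>)
  then show ?thesis by simp
qed

text \<open>One integer bounds both the density and the inverse scale, so countably many sets
  exhaust the points of finite upper density. Open balls are used because their mass is lower
  semicontinuous in the centre, which makes the condition closed.\<close>

definition upper_regular :: "nat \<Rightarrow> 'a::metric_space set \<Rightarrow> nat \<Rightarrow> 'a set" where
  "upper_regular k E m = {x \<in> E. \<forall>r. 0 < r \<and> r < 1 / real (Suc m) \<longrightarrow>
     hausdorff k (E \<inter> ball x r) \<le> ennreal (real (Suc m) * r ^ k)}"

text \<open>A point in none of the sets violates the bound for every m. Taking m large gives, for
  each n, arbitrarily small balls of mass at least n * r^k, and the Vitali estimate with t = n and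
  total mass finite tends to 0.\<close>

lemma hausdorff_not_upper_regular:
  fixes E :: "'a::euclidean_space set"
  assumes k: "k \<ge> 1" and E: "E \<in> sets borel" and fin: "hausdorff k E < \<infinity>"
  shows "hausdorff k (E - (\<Union>m. upper_regular k E m)) = 0"
proof (rule ennreal_eq_0_if_le_small)
  fix n :: nat assume n: "n > 0"
  define \<nu> where "\<nu> = hausdorff_restr k E"
  have \<nu>: "emeasure \<nu> X = hausdorff k (E \<inter> X)" if "X \<in> sets borel" for X
    unfolding \<nu>_def by (rule emeasure_hausdorff_restr[OF k E that])
  have "hausdorff k (E - (\<Union>m. upper_regular k E m)) \<le> ennreal (10 ^ k / real n) * emeasure \<nu> UNIV"
  proof (rule hausdorff_le_Vitali[OF k])
    fix x and d :: real assume x: "x \<in> E - (\<Union>m. upper_regular k E m)" and d: "d > 0"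
    obtain m where m: "1 / real (Suc m) < d" using d reals_Archimedean[of d] by (auto simp: inverse_eq_divide)
    define m' where "m' = max m n"
    have "x \<notin> upper_regular k E m'" using x by blast
    then obtain r where r: "0 < r" "r < 1 / real (Suc m')"
      "hausdorff k (E \<inter> ball x r) > ennreal (real (Suc m') * r ^ k)"
      using x by (auto simp: upper_regular_def not_le)
    have "1 / real (Suc m') \<le> 1 / real (Suc m)" by (simp add: m'_def frac_le)
    then have "r < d" using r(2) m by linarith
    have "ennreal (real n * r ^ k) \<le> ennreal (real (Suc m') * r ^ k)"
      using r(1) by (intro ennreal_leI mult_right_mono) (auto simp: m'_def)
    also have "\<dots> \<le> hausdorff k (E \<inter> ball x r)" using r(3) by (rule less_imp_le)
    also have "\<dots> \<le> hausdorff k (E \<inter> cball x r)" by (intro hausdorff_mono) auto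
    also have "\<dots> = emeasure \<nu> (cball x r)" by (simp add: \<nu>)
    finally show "\<exists>r. 0 < r \<and> r < d \<and> ennreal (real n * r ^ k) \<le> emeasure \<nu> (cball x r)"
      using r(1) \<open>r < d\<close> by blast
  qed (use n in \<open>auto simp: \<nu>_def\<close>)
  also have "emeasure \<nu> UNIV = ennreal (enn2real (hausdorff k E))"
    using fin by (subst \<nu>) (auto simp: less_top)
  finally show "hausdorff k (E - (\<Union>m. upper_regular k E m)) \<le> ennreal (10 ^ k * enn2real (hausdorff k E) / real n)"
    by (simp add: ennreal_mult[symmetric])
qed

text \<open>By continuity from below, a strict lower bound for the mass of ball x r already holds on
  a slightly smaller ball about x, and that ball lies in ball y r for all y near x. So each single
  condition is closed, and so is the intersection over uncountably many radii.\<close>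

lemma borel_upper_regular:
  fixes E :: "'a::euclidean_space set"
  assumes k: "k \<ge> 1" and E: "E \<in> sets borel"
  shows "upper_regular k E m \<in> sets borel"
proof -
  define \<nu> where "\<nu> = hausdorff_restr k E"
  have \<nu>: "emeasure \<nu> X = hausdorff k (E \<inter> X)" if "X \<in> sets borel" for X
    unfolding \<nu>_def by (rule emeasure_hausdorff_restr[OF k E that])
  have op: "open {x. emeasure \<nu> (ball x r) > t}" for r t
  proof (rule openI)
    fix x assume "x \<in> {x. emeasure \<nu> (ball x r) > t}"
    then have x: "t < emeasure \<nu> (ball x r)" by simp
    have inc: "incseq (\<lambda>n. ball x (r - 1 / real (Suc n)))"
      by (intro incseq_SucI subset_ball) (simp add: frac_le)
    have "(\<Union>n. ball x (r - 1 / real (Suc n))) = ball x r"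
    proof safe
      fix y assume "y \<in> ball x r"
      then obtain n where "1 / real (Suc n) < r - dist x y"
        using reals_Archimedean[of "r - dist x y"] by (auto simp: inverse_eq_divide)
      then have "y \<in> ball x (r - 1 / real (Suc n))" by simp
      then show "y \<in> (\<Union>n. ball x (r - 1 / real (Suc n)))" by blast
    next
      fix y n assume "y \<in> ball x (r - 1 / real (Suc n))"
      then show "y \<in> ball x r" by (smt (verit) mem_ball divide_pos_pos of_nat_0_less_iff zero_less_Suc)
    qed
    then have "emeasure \<nu> (ball x r) = (SUP n. emeasure \<nu> (ball x (r - 1 / real (Suc n))))"
      using SUP_emeasure_incseq[OF _ inc, of \<nu>] by (simp add: \<nu>_def image_subset_iff)
    then obtain n where n: "t < emeasure \<nu> (ball x (r - 1 / real (Suc n)))"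
      using x by (auto simp: less_SUP_iff)
    show "\<exists>e>0. ball x e \<subseteq> {x. emeasure \<nu> (ball x r) > t}"
    proof (intro exI[of _ "1 / real (Suc n)"] conjI subsetI)
      fix y assume y: "y \<in> ball x (1 / real (Suc n))"
      have "ball x (r - 1 / real (Suc n)) \<subseteq> ball y r"
      proof
        fix z assume "z \<in> ball x (r - 1 / real (Suc n))"
        then show "z \<in> ball y r" using y dist_triangle[of y z x] by (simp add: dist_commute)
      qed
      then have "emeasure \<nu> (ball x (r - 1 / real (Suc n))) \<le> emeasure \<nu> (ball y r)"
        by (intro emeasure_mono) (auto simp: \<nu>_def)
      then show "y \<in> {x. emeasure \<nu> (ball x r) > t}" using n by auto
    qed simp
  qed
  have "closed {x. emeasure \<nu> (ball x r) \<le> t}" for r t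
    using op[of t r] by (simp add: closed_def Compl_eq not_le)
  then have "closed {x. \<forall>r. 0 < r \<and> r < 1 / real (Suc m) \<longrightarrow> emeasure \<nu> (ball x r) \<le> ennreal (real (Suc m) * r ^ k)}"
    by (intro closed_Collect_all closed_Collect_imp) auto
  then have "E \<inter> {x. \<forall>r. 0 < r \<and> r < 1 / real (Suc m) \<longrightarrow> emeasure \<nu> (ball x r) \<le> ennreal (real (Suc m) * r ^ k)} \<in> sets borel"
    by (rule sets.Int[OF E borel_closed])
  moreover have "E \<inter> {x. \<forall>r. 0 < r \<and> r < 1 / real (Suc m) \<longrightarrow> emeasure \<nu> (ball x r) \<le> ennreal (real (Suc m) * r ^ k)}
      = upper_regular k E m"
    by (auto simp: upper_regular_def \<nu>)
  ultimately show ?thesis by simp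
qed

text \<open>A density theorem without differentiation of measures: the restriction to E - F gives F
  mass 0, so by outer regularity F lies in an open set of mass below 1 / n, to which the Vitali
  estimate applies with t = e.\<close>

lemma hausdorff_not_density_point:
  fixes E :: "'a::euclidean_space set"
  assumes k: "k \<ge> 1" and E: "E \<in> sets borel" and fin: "hausdorff k E < \<infinity>"
    and F: "F \<in> sets borel" and e: "e > 0"
  shows "hausdorff k {x \<in> F. \<forall>d>0. \<exists>r. 0 < r \<and> r < d \<and> hausdorff k ((E \<inter> cball x r) - F) \<ge> ennreal (e * r ^ k)} = 0"
    (is "hausdorff k ?B = 0")
proof (rule ennreal_eq_0_if_le_small)
  fix n :: nat assume n: "n > 0"
  define \<nu> where "\<nu> = hausdorff_restr k (E - F)"
  have EF: "E - F \<in> sets borel" using E F by auto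
  have \<nu>: "emeasure \<nu> X = hausdorff k ((E - F) \<inter> X)" if "X \<in> sets borel" for X
    unfolding \<nu>_def by (rule emeasure_hausdorff_restr[OF k EF that])
  have "emeasure \<nu> (space \<nu>) \<le> hausdorff k E" by (simp add: \<nu>_def \<nu>[unfolded \<nu>_def] hausdorff_mono)
  then have "emeasure \<nu> (space \<nu>) \<noteq> \<infinity>" using fin by (auto simp: top_unique)
  then have "emeasure \<nu> F = (INF U\<in>{U. F \<subseteq> U \<and> open U}. emeasure \<nu> U)"
    by (intro outer_regular) (use F in \<open>auto simp: \<nu>_def\<close>)
  moreover have "emeasure \<nu> F = 0" using F k by (simp add: \<nu> Int_commute Diff_disjoint)
  ultimately have "(INF U\<in>{U. F \<subseteq> U \<and> open U}. emeasure \<nu> U) < ennreal (1 / real n)"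
    using n by (metis ennreal_less_zero_iff of_nat_0_less_iff zero_less_divide_1_iff)
  then obtain U where U: "F \<subseteq> U" "open U" "emeasure \<nu> U < ennreal (1 / real n)"
    unfolding INF_less_iff by blast
  have "hausdorff k ?B \<le> ennreal (10 ^ k / e) * emeasure \<nu> U"
  proof (rule hausdorff_le_Vitali[OF k _ U(2) _ e])
    show "sets \<nu> = sets borel" by (simp add: \<nu>_def)
    show "?B \<subseteq> U" using Collect_restrict U(1) by (rule subset_trans)
    fix x and d :: real assume "x \<in> ?B" "d > 0"
    then obtain r where "0 < r" "r < d" "hausdorff k ((E \<inter> cball x r) - F) \<ge> ennreal (e * r ^ k)"
      by blast
    moreover have "(E \<inter> cball x r) - F = (E - F) \<inter> cball x r" by auto
    ultimately show "\<exists>r. 0 < r \<and> r < d \<and> ennreal (e * r ^ k) \<le> emeasure \<nu> (cball x r)"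
      by (auto simp: \<nu>)
  qed
  also have "\<dots> \<le> ennreal (10 ^ k / e) * ennreal (1 / real n)"
    using U(3) by (intro mult_left_mono) auto
  finally show "hausdorff k ?B \<le> ennreal (10 ^ k / e / real n)"
    using e by (simp add: ennreal_mult[symmetric])
qed

subsection \<open>Orthogonal projections and slabs\<close>

text \<open>Linear planes are represented by self-adjoint idempotents instead of sets: maps can be
  subtracted, which measures angles, and they have pointwise limits. The plane itself is
  \<open>range P\<close>.\<close>

definition orth_proj :: "('a::euclidean_space \<Rightarrow> 'a) \<Rightarrow> bool" where
  "orth_proj P \<longleftrightarrow> linear P \<and> (\<forall>x y. P x \<bullet> y = x \<bullet> P y) \<and> (\<forall>x. P (P x) = P x)"

lemma orth_projD:
  assumes "orth_proj P"
  shows "linear P" "P x \<bullet> y = x \<bullet> P y" "P (P x) = P x"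
    "P (x + y) = P x + P y" "P (x - y) = P x - P y" "P (c *\<^sub>R x) = c *\<^sub>R P x" "P 0 = 0"
  using assms unfolding orth_proj_def
  by (auto simp: linear_add linear_diff linear_scale linear_0)

lemma orth_proj_norm:
  assumes "orth_proj P"
  shows "(norm x)\<^sup>2 = (norm (P x))\<^sup>2 + (norm (x - P x))\<^sup>2"
proof -
  have "P x \<bullet> (x - P x) = 0"
    using orth_projD[OF assms] by (metis diff_self inner_zero_right)
  then show ?thesis
    using norm_add_Pythagorean[of "P x" "x - P x"] by (simp add: orthogonal_def)
qed

lemma orth_proj_norm_le:
  assumes "orth_proj P"
  shows "norm (P x) \<le> norm x" "norm (x - P x) \<le> norm x"
  by (rule power2_le_imp_le; use orth_proj_norm[OF assms, of x] in simp)+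

lemma orth_proj_range_eq: "orth_proj P \<Longrightarrow> v \<in> range P \<longleftrightarrow> P v = v"
  by (auto simp: orth_projD(3)) (metis rangeI)

lemma subspace_orth_proj_range: "orth_proj P \<Longrightarrow> subspace (range P)"
  using linear_subspace_image orth_projD(1) subspace_UNIV by blast

lemma orth_proj_exists:
  fixes U :: "'a::euclidean_space set"
  assumes U: "subspace U"
  shows "\<exists>P. orth_proj P \<and> range P = U"
proof -
  obtain B where B: "B \<subseteq> U" "pairwise orthogonal B" "\<And>x. x \<in> B \<Longrightarrow> norm x = 1"
      "independent B" "span B = U"
    using orthonormal_basis_subspace[OF U] by metis
  have fin: "finite B" using B(4) by (rule independent_imp_finite)
  define P where "P x = (\<Sum>b\<in>B. (x \<bullet> b) *\<^sub>R b)" for x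
  have rng: "P x \<in> U" for x
    unfolding P_def using B(1) U by (intro subspace_sum subspace_mul) auto
  have id: "P x = x" if "x \<in> U" for x
    unfolding P_def using orthonormal_basis_expand[OF B(2,3) _ fin] that B(5) by blast
  have "linear P"
    unfolding P_def
    by (rule linearI) (auto simp: inner_add_left scaleR_left_distrib sum.distrib scaleR_sum_right)
  moreover have "P x \<bullet> y = x \<bullet> P y" for x y
    by (simp add: P_def inner_sum_left inner_sum_right mult.commute inner_commute)
  ultimately have "orth_proj P" using rng id by (simp add: orth_proj_def)
  moreover have "range P = U"
  proof
    show "U \<subseteq> range P" using id by (metis rangeI subsetI)
  qed (use rng in blast)
  ultimately show ?thesis by blast
qed

text \<open>The identity \<open>P - Q = P (1 - Q) - (1 - P) Q\<close> and self-adjointness reduce the distance of two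
  projections to the one-sided quantities \<open>P (1 - Q)\<close> and \<open>Q (1 - P)\<close>.\<close>

lemma orth_proj_diff_le:
  assumes P: "orth_proj P" and Q: "orth_proj Q"
    and a: "\<And>w. norm (P (w - Q w)) \<le> a * norm w" and b: "\<And>w. norm (Q (w - P w)) \<le> a * norm w"
  shows "norm (P v - Q v) \<le> 2 * a * norm v"
proof -
  \<comment> \<open>The map (1 - P) Q is the adjoint of Q (1 - P), so hypothesis b bounds it after
    testing u against itself.\<close>
  define u where "u = Q v - P (Q v)"
  have "norm u \<le> a * norm v"
  proof (cases "u = 0")
    case True
    then show ?thesis using order_trans[OF norm_ge_zero a] by simp
  next
    case False
    have Pu: "P u = 0" by (simp add: u_def orth_projD[OF P])
    have "(norm u)\<^sup>2 = u \<bullet> Q v"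
    proof -
      have "u \<bullet> P (Q v) = 0" using Pu orth_projD(2)[OF P] by (metis inner_zero_left)
      then show ?thesis by (simp add: power2_norm_eq_inner inner_diff_right u_def)
    qed
    also have "\<dots> = Q (u - P u) \<bullet> v" by (simp add: Pu orth_projD(2)[OF Q])
    also have "\<dots> \<le> norm (Q (u - P u)) * norm v" by (rule norm_cauchy_schwarz)
    also have "\<dots> \<le> a * norm u * norm v" by (intro mult_right_mono b) simp
    finally show ?thesis using False by (simp add: power2_eq_square field_simps)
  qed
  moreover have "P v - Q v = P (v - Q v) - u" by (simp add: u_def orth_projD[OF P])
  then have "norm (P v - Q v) \<le> norm (P (v - Q v)) + norm u" by (simp add: norm_triangle_ineq4)
  ultimately show ?thesis using a[of v] by simp
qed

text \<open>Splits an affine plane into a direction P and a base point p. The normal part of z - p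
  agrees with that of z - v for every v in V, and the strict inequality yields a v with dist z v <
  \<eta>.\<close>

lemma affine_plane_projection:
  fixes V :: "'a::euclidean_space set"
  assumes "affine_plane k V"
  shows "\<exists>P p. orth_proj P \<and> dim (range P) = k \<and>
    (\<forall>z \<eta>. infdist z V < \<eta> \<longrightarrow> norm ((z - p) - P (z - p)) < \<eta>)"
proof -
  have V: "affine V" "aff_dim V = int k" using assms by (auto simp: affine_plane_def)
  then have "V \<noteq> {}" using aff_dim_empty[of V] by auto
  then obtain p where p: "p \<in> V" by blast
  define U where "U = (+) (- p) ` V"
  have U: "subspace U" unfolding U_def using affine_diffs_subspace[OF V(1) p] .
  have "int (dim U) = int k"
    using aff_dim_dim_affine_diffs[OF V(1) p] V(2) by (auto simp: U_def)
  then have dim: "dim U = k" by simp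
  obtain P where P: "orth_proj P" "range P = U" using orth_proj_exists[OF U] by blast
  have "norm ((z - p) - P (z - p)) < \<eta>" if "infdist z V < \<eta>" for z \<eta>
  proof -
    have "(INF v\<in>V. dist z v) < \<eta>" using that \<open>V \<noteq> {}\<close> by (simp add: infdist_notempty)
    then obtain v where v: "v \<in> V" "dist z v < \<eta>"
      using \<open>V \<noteq> {}\<close> by (subst (asm) cINF_less_iff) auto
    have "v - p \<in> range P" unfolding P(2) U_def using v(1) by (auto intro!: image_eqI[of _ _ v])
    then have Pv: "P (v - p) = v - p" using orth_proj_range_eq[OF P(1)] by blast
    have "(z - p) - P (z - p) = (z - v) - P (z - v)"
      using orth_projD(5)[OF P(1), of "z - p" "v - p"] Pv by (simp add: algebra_simps)
    also have "norm \<dots> \<le> norm (z - v)" by (rule orth_proj_norm_le[OF P(1)])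
    finally show ?thesis using v(2) by (simp add: dist_norm)
  qed
  then show ?thesis using P dim by blast
qed

text \<open>The coordinates orthogonal to \<open>\<nu>\<close> in the range of \<open>P\<close>, at the scale \<open>r / n\<close>, define a grid
  with at most \<open>(2 * n + 1) ^ (k - 1)\<close> nonempty cells.\<close>

lemma slab_cover:
  fixes S :: "'a::euclidean_space set"
  assumes P: "orth_proj P" and dim: "dim (range P) \<le> k" and \<nu>: "P \<nu> = \<nu>" "norm \<nu> = 1"
    and n: "n > 0" and r: "r > 0" and S: "S \<subseteq> cball y r"
    and flat: "\<And>s. s \<in> S \<Longrightarrow> norm ((s - p) - P (s - p)) \<le> r / n"
    and slab: "\<And>s. s \<in> S \<Longrightarrow> \<bar>\<nu> \<bullet> (s - s0)\<bar> \<le> r / n"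
  shows "\<exists>D. finite D \<and> card D \<le> (3 * n) ^ (k - 1) \<and> D \<subseteq> S \<and> S \<subseteq> (\<Union>a\<in>D. cball a ((real k + 4) * r / n))"
proof -
  define h where "h = r / n"
  have h: "h > 0" using n r by (simp add: h_def)
  define U where "U = {v \<in> range P. \<nu> \<bullet> v = 0}"
  have "subspace U"
    using subspace_orth_proj_range[OF P] subspace_hyperplane[of \<nu>]
    by (simp add: U_def subspace_inter Collect_conj_eq)
  then obtain B where B: "B \<subseteq> U" "pairwise orthogonal B" "\<And>x. x \<in> B \<Longrightarrow> norm x = 1"
      "independent B" "span B = U"
    using orthonormal_basis_subspace by metis
  have fin: "finite B" using B(4) by (rule independent_imp_finite)
  have card: "card B \<le> k - 1"
  proof -
    have "\<nu> \<notin> B" using B(1) \<nu>(2) by (auto simp: U_def norm_eq_1)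
    have "pairwise orthogonal (insert \<nu> B)"
      using B(1,2) by (auto simp: pairwise_insert U_def orthogonal_def inner_commute)
    moreover have "0 \<notin> insert \<nu> B" using \<nu>(2) B(3) by force
    ultimately have "independent (insert \<nu> B)" by (rule pairwise_orthogonal_independent)
    moreover have "insert \<nu> B \<subseteq> range P"
      using B(1) orth_proj_range_eq[OF P] \<nu>(1) by (auto simp: U_def)
    ultimately have "card (insert \<nu> B) \<le> dim (range P)"
      using independent_card_le_dim by blast
    then show ?thesis using dim fin \<open>\<nu> \<notin> B\<close> by simp
  qed
  \<comment> \<open>No coordinate is spent on \<nu>, since the slab already confines it; this saves
    one factor n in the number of cells.\<close>
  define \<kappa> where "\<kappa> s = (\<lambda>b\<in>B. \<lfloor>(b \<bullet> (s - y)) / h\<rfloor>)" for s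
  have cells: "\<kappa> ` S \<subseteq> (\<Pi>\<^sub>E b\<in>B. {- int n..int n})"
  proof -
    have "\<lfloor>(b \<bullet> (s - y)) / h\<rfloor> \<in> {- int n..int n}" if s: "s \<in> S" and b: "b \<in> B" for s b
    proof -
      have "\<bar>b \<bullet> (s - y)\<bar> \<le> norm b * norm (s - y)" by (rule Cauchy_Schwarz_ineq2)
      also have "\<dots> \<le> r" using s S b B(3) by (auto simp: dist_norm norm_minus_commute)
      finally have "\<bar>(b \<bullet> (s - y)) / h\<bar> \<le> n"
        using r n by (simp add: h_def abs_mult field_simps)
      then have "- real n \<le> (b \<bullet> (s - y)) / h" "(b \<bullet> (s - y)) / h < real n + 1" by linarith+
      then show ?thesis by (simp add: le_floor_iff floor_le_iff)
    qed
    then show ?thesis by (auto simp: \<kappa>_def)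
  qed
  have finE: "finite (\<Pi>\<^sub>E b\<in>B. {- int n..int n})" using fin by (intro finite_PiE) auto
  have "card (\<kappa> ` S) \<le> card (\<Pi>\<^sub>E b\<in>B. {- int n..int n})" using cells finE by (rule card_mono[rotated])
  also have "\<dots> = (2 * n + 1) ^ card B" using fin by (simp add: card_PiE nat_add_distrib nat_mult_distrib)
  also have "\<dots> \<le> (3 * n) ^ card B" using n by (intro power_mono) auto
  also have "\<dots> \<le> (3 * n) ^ (k - 1)" using n card by (intro power_increasing) auto
  finally have cardK: "card (\<kappa> ` S) \<le> (3 * n) ^ (k - 1)" .
  \<comment> \<open>One point of S per nonempty cell, because the upper density bound is available
    only at centres in S.\<close>
  define pick where "pick c = (SOME s. s \<in> S \<and> \<kappa> s = c)" for c
  have pick: "pick c \<in> S \<and> \<kappa> (pick c) = c" if "c \<in> \<kappa> ` S" for c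
    unfolding pick_def using that by (intro someI_ex[of "\<lambda>s. s \<in> S \<and> \<kappa> s = c"]) auto
  \<comment> \<open>Two points of a cell differ by at most h in each of fewer than k coordinates
    along B, by 2 * h along \<nu> and by 2 * h normally to the plane; hence k + 4.\<close>
  have near: "dist a s \<le> (real k + 4) * h" if a: "a \<in> S" and s: "s \<in> S" and e: "\<kappa> a = \<kappa> s" for a s
  proof -
    define u where "u = s - a"
    define w where "w = P u - (\<nu> \<bullet> u) *\<^sub>R \<nu>"
    have "\<nu> \<bullet> P u = \<nu> \<bullet> u" using \<nu>(1) orth_projD(2)[OF P] by metis
    moreover have "w \<in> range P"
      unfolding orth_proj_range_eq[OF P] w_def by (simp add: orth_projD[OF P] \<nu>(1))
    ultimately have wU: "w \<in> U"
      using \<nu>(2) by (simp add: U_def w_def inner_diff_right norm_eq_1)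
    have wb: "\<bar>w \<bullet> b\<bar> \<le> h" if b: "b \<in> B" for b
    proof -
      have "b \<in> range P" "\<nu> \<bullet> b = 0" using b B(1) by (auto simp: U_def)
      then have "w \<bullet> b = b \<bullet> u"
        using orth_proj_range_eq[OF P, of b] orth_projD(2)[OF P, of u b]
        by (simp add: w_def inner_diff_left inner_diff_right inner_commute)
      moreover have "\<lfloor>(b \<bullet> (a - y)) / h\<rfloor> = \<lfloor>(b \<bullet> (s - y)) / h\<rfloor>"
        using fun_cong[OF e, of b] b by (simp add: \<kappa>_def)
      then have "\<bar>(b \<bullet> (s - y)) / h - (b \<bullet> (a - y)) / h\<bar> \<le> 1" by linarith
      then have "\<bar>(b \<bullet> u) / h\<bar> \<le> 1"
        by (simp add: u_def inner_diff_right diff_divide_distrib)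
      ultimately show ?thesis using h by (simp add: field_simps abs_div)
    qed
    have "w = (\<Sum>b\<in>B. (w \<bullet> b) *\<^sub>R b)"
      using orthonormal_basis_expand[OF B(2,3) _ fin, of w] wU B(5) by simp
    then have "norm w \<le> (\<Sum>b\<in>B. norm ((w \<bullet> b) *\<^sub>R b))" by (metis norm_sum)
    also have "\<dots> \<le> (\<Sum>b\<in>B. h)" using B(3) wb by (intro sum_mono) simp
    also have "\<dots> \<le> real k * h" using card h by (auto intro!: mult_right_mono)
    finally have w: "norm w \<le> real k * h" .
    have "\<bar>\<nu> \<bullet> u\<bar> \<le> 2 * h"
      using slab[OF a] slab[OF s] by (simp add: u_def h_def inner_diff_right)
    moreover have "norm (u - P u) \<le> 2 * h"
    proof -
      have "u - P u = ((s - p) - P (s - p)) - ((a - p) - P (a - p))"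
        by (simp add: u_def orth_projD[OF P])
      then have "norm (u - P u) \<le> norm ((s - p) - P (s - p)) + norm ((a - p) - P (a - p))"
        by (simp only: norm_triangle_ineq4)
      then show ?thesis using flat[OF a] flat[OF s] by (simp add: h_def)
    qed
    moreover have "u = w + (\<nu> \<bullet> u) *\<^sub>R \<nu> + (u - P u)" by (simp add: w_def)
    then have "norm u \<le> norm w + norm ((\<nu> \<bullet> u) *\<^sub>R \<nu>) + norm (u - P u)"
      by (metis norm_triangle_ineq norm_triangle_mono order_refl)
    ultimately have "norm u \<le> (real k + 4) * h"
      using w \<nu>(2) by (simp add: distrib_right)
    then show ?thesis by (simp add: u_def dist_norm norm_minus_commute)
  qed
  show ?thesis
  proof (intro exI conjI)
    show "finite (pick ` \<kappa> ` S)" using cells finE finite_subset by blast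
    show "card (pick ` \<kappa> ` S) \<le> (3 * n) ^ (k - 1)"
      using cardK card_image_le[of "\<kappa> ` S" pick] cells finE finite_subset by (meson order_trans)
    show "pick ` \<kappa> ` S \<subseteq> S" using pick by blast
    show "S \<subseteq> (\<Union>a\<in>pick ` \<kappa> ` S. cball a ((real k + 4) * r / n))"
    proof
      fix s assume s: "s \<in> S"
      then have "dist (pick (\<kappa> s)) s \<le> (real k + 4) * h" using near pick by blast
      then show "s \<in> (\<Union>a\<in>pick ` \<kappa> ` S. cball a ((real k + 4) * r / n))"
        using s by (auto simp: h_def)
    qed
  qed
qed

text \<open>The power of 3 belongs to the cell count (3 * n)^(k-1), the other factor to the radius 2
  * (k + 4) * r / n of the covering balls, twice that of \<open>slab_cover\<close>.\<close>

definition slab_const :: "nat \<Rightarrow> real" where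
  "slab_const k = 3 ^ (k - 1) * (2 * (real k + 4)) ^ k"

text \<open>About n^(k-1) balls, each of mass O(M * (r/n)^k), leave one factor 1 / n. The radius is
  doubled to replace closed balls by the open ones of the density bound; n \<ge> k + 4 keeps it at
  most 2 * r, hence below R.\<close>

lemma slab_emeasure_le:
  fixes \<mu> :: "'a::euclidean_space measure"
  assumes \<mu>: "sets \<mu> = sets borel" and k: "k \<ge> 1" and M: "M \<ge> 0"
    and upper: "\<And>a \<rho>. \<lbrakk>a \<in> G; 0 < \<rho>; \<rho> < R\<rbrakk> \<Longrightarrow> emeasure \<mu> (ball a \<rho>) \<le> ennreal (M * \<rho> ^ k)"
    and P: "orth_proj P" "dim (range P) = k" and \<nu>: "P \<nu> = \<nu>" "norm \<nu> = 1"
    and n: "real n \<ge> real k + 4" and r: "0 < r" "2 * r < R" and S: "S \<subseteq> cball y r" "S \<subseteq> G"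
    and flat: "\<And>s. s \<in> S \<Longrightarrow> norm ((s - p) - P (s - p)) \<le> r / n"
    and slab: "\<And>s. s \<in> S \<Longrightarrow> \<bar>\<nu> \<bullet> (s - s0)\<bar> \<le> r / n"
  shows "emeasure \<mu> S \<le> ennreal (M * slab_const k / n * r ^ k)"
proof -
  have n0: "n > 0" using n by (cases n) auto
  obtain D where D: "finite D" "card D \<le> (3 * n) ^ (k - 1)" "D \<subseteq> S"
      "S \<subseteq> (\<Union>a\<in>D. cball a ((real k + 4) * r / n))"
    using slab_cover[OF P(1) eq_refl[OF P(2)] \<nu> n0 r(1) S(1) flat slab] by blast
  define \<sigma> where "\<sigma> = (real k + 4) * r / n"
  define \<rho> where "\<rho> = 2 * \<sigma>"
  have "(real k + 4) / n * r \<le> 1 * r" using n n0 r by (intro mult_right_mono) auto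
  then have \<rho>: "0 < \<rho>" "\<rho> < R" using r n0 by (auto simp: \<rho>_def \<sigma>_def)
  have cov: "S \<subseteq> (\<Union>a\<in>D. ball a \<rho>)"
  proof
    fix s assume "s \<in> S"
    then obtain a where "a \<in> D" "dist a s \<le> \<sigma>" using D(4) by (auto simp: \<sigma>_def)
    moreover have "\<sigma> < \<rho>" using \<rho>(1) unfolding \<rho>_def by linarith
    ultimately show "s \<in> (\<Union>a\<in>D. ball a \<rho>)" by force
  qed
  have "emeasure \<mu> S \<le> emeasure \<mu> (\<Union>a\<in>D. ball a \<rho>)"
    using cov by (rule emeasure_mono) (auto simp: \<mu> intro!: borel_open)
  also have "\<dots> \<le> (\<Sum>a\<in>D. emeasure \<mu> (ball a \<rho>))"
    using D(1) by (intro emeasure_subadditive_finite) (auto simp: \<mu>)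
  also have "\<dots> \<le> (\<Sum>a\<in>D. ennreal (M * \<rho> ^ k))"
    using D(3) S(2) \<rho> by (intro sum_mono upper) auto
  also have "\<dots> = ennreal (real (card D) * (M * \<rho> ^ k))"
    using M \<rho> by (simp add: ennreal_mult ennreal_of_nat_eq_real_of_nat)
  also have "\<dots> \<le> ennreal (real ((3 * n) ^ (k - 1)) * (M * \<rho> ^ k))"
    using D(2) M \<rho> by (intro ennreal_leI mult_right_mono) (auto simp del: of_nat_power of_nat_mult)
  also have "real ((3 * n) ^ (k - 1)) * (M * \<rho> ^ k) = M * slab_const k / n * r ^ k"
  proof -
    obtain j where j: "k = Suc j" using k by (cases k) auto
    define c where "c = 2 * (real k + 4)"
    have "\<rho> = c * r / n" by (simp add: \<rho>_def \<sigma>_def c_def)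
    then have "real n ^ (k - 1) * \<rho> ^ k = c ^ k * r ^ k / n"
      using n0 by (simp add: j power_divide power_mult_distrib)
    then have "M * 3 ^ (k - 1) * (real n ^ (k - 1) * \<rho> ^ k) = M * 3 ^ (k - 1) * (c ^ k * r ^ k / n)"
      by simp
    then show ?thesis unfolding slab_const_def c_def[symmetric]
      by (simp add: power_mult_distrib mult_ac)
  qed
  finally show ?thesis .
qed

text \<open>S has too much mass to fit into a slab of half-width r / n normal to a unit vector \<nu>
  of \<open>range P\<close>. So some s in S is displaced from s0 by more than r / n along \<nu>,
  while s - s0 is within 2 * \<eta> of both directions. If \<nu> is the direction of P (w - Q w),
  this bounds that vector by 4 * n * \<eta> / r * |w|, and \<open>orth_proj_diff_le\<close> doubles
  the constant.\<close>

lemma plane_tilt_le: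
  fixes \<mu> :: "'a::euclidean_space measure"
  assumes \<mu>: "sets \<mu> = sets borel" and k: "k \<ge> 1" and M: "M \<ge> 0"
    and upper: "\<And>a \<rho>. \<lbrakk>a \<in> G; 0 < \<rho>; \<rho> < R\<rbrakk> \<Longrightarrow> emeasure \<mu> (ball a \<rho>) \<le> ennreal (M * \<rho> ^ k)"
    and P: "orth_proj P" "dim (range P) = k" and Q: "orth_proj Q" "dim (range Q) = k"
    and n: "real n \<ge> real k + 4" "M * slab_const k / n < \<theta>"
    and r: "0 < r" "2 * r < R" and S: "S \<subseteq> cball y r" "S \<subseteq> G"
    and mass: "ennreal (\<theta> * r ^ k) \<le> emeasure \<mu> S"
    and flatP: "\<And>s. s \<in> S \<Longrightarrow> norm ((s - p) - P (s - p)) \<le> \<eta>"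
    and flatQ: "\<And>s. s \<in> S \<Longrightarrow> norm ((s - q) - Q (s - q)) \<le> \<eta>"
  shows "norm (P v - Q v) \<le> 8 * real n * \<eta> / r * norm v"
proof -
  have n0: "real n > 0" using n by simp
  have "slab_const k \<ge> 0" by (simp add: slab_const_def)
  then have "M * slab_const k / n \<ge> 0" using M by simp
  then have \<theta>: "\<theta> > 0" using n(2) by linarith
  have "S \<noteq> {}"
  proof
    assume "S = {}"
    then have "ennreal (\<theta> * r ^ k) \<le> 0" using mass by simp
    then show False using \<theta> r by (simp add: mult_le_0_iff)
  qed
  then obtain s0 where s0: "s0 \<in> S" by blast
  have \<eta>: "\<eta> \<ge> 0" using flatP[OF s0] norm_ge_zero order_trans by blast
  \<comment> \<open>For \<eta> > r / n the bound exceeds the trivial estimate 2 * |v|. Otherwise S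
    is flat to order r / n, as the slab estimate demands.\<close>
  show ?thesis
  proof (cases "\<eta> \<le> r / n")
    case False
    then have "1 \<le> n * \<eta> / r" using n0 r by (simp add: field_simps)
    then have "2 * norm v \<le> 8 * (n * \<eta> / r) * norm v" by (intro mult_right_mono) auto
    moreover have "norm (P v - Q v) \<le> norm v + norm v"
      using norm_triangle_ineq4[of "P v" "Q v"] orth_proj_norm_le(1)[OF P(1), of v]
        orth_proj_norm_le(1)[OF Q(1), of v] by linarith
    ultimately show ?thesis by simp
  next
    case True
    have key: "norm (P (w - Q w)) \<le> (4 * real n * \<eta> / r) * norm w"
      if P: "orth_proj P" "dim (range P) = k" and Q: "orth_proj Q"
        and flatP: "\<And>s. s \<in> S \<Longrightarrow> norm ((s - p) - P (s - p)) \<le> \<eta>"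
        and flatQ: "\<And>s. s \<in> S \<Longrightarrow> norm ((s - q) - Q (s - q)) \<le> \<eta>" for P Q p q w
    proof (cases "P (w - Q w) = 0")
      case True
      then show ?thesis using \<eta> r n0 by simp
    next
      case False
      define z where "z = P (w - Q w)"
      define \<nu> where "\<nu> = z /\<^sub>R norm z"
      have \<nu>: "P \<nu> = \<nu>" "norm \<nu> = 1"
        using False by (auto simp: \<nu>_def z_def orth_projD[OF P(1)])
      have "\<exists>s\<in>S. \<bar>\<nu> \<bullet> (s - s0)\<bar> > r / n"
      proof (rule ccontr)
        assume "\<not> (\<exists>s\<in>S. \<bar>\<nu> \<bullet> (s - s0)\<bar> > r / n)"
        then have slab: "\<bar>\<nu> \<bullet> (s - s0)\<bar> \<le> r / n" if "s \<in> S" for s using that not_le by blast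
        have flat: "norm ((s - p) - P (s - p)) \<le> r / n" if "s \<in> S" for s
          using flatP[OF that] \<open>\<eta> \<le> r / n\<close> by (rule order_trans)
        have "emeasure \<mu> S \<le> ennreal (M * slab_const k / n * r ^ k)"
          by (rule slab_emeasure_le[OF \<mu> k M upper P \<nu> n(1) r S flat slab])
        then have "ennreal (\<theta> * r ^ k) \<le> ennreal (M * slab_const k / n * r ^ k)"
          using mass by (rule order_trans[rotated])
        moreover have "M * slab_const k / n * r ^ k < \<theta> * r ^ k"
          using n(2) r by (intro mult_strict_right_mono) auto
        moreover have "0 < \<theta> * r ^ k" using \<theta> r by simp
        ultimately show False by (simp add: ennreal_le_iff2)
      qed
      then obtain s where s: "s \<in> S" "\<bar>\<nu> \<bullet> (s - s0)\<bar> > r / n" by blast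
      define u where "u = s - s0"
      have uP: "norm (u - P u) \<le> 2 * \<eta>"
      proof -
        have "u - P u = ((s - p) - P (s - p)) - ((s0 - p) - P (s0 - p))"
          by (simp add: u_def orth_projD[OF P(1)])
        then show ?thesis using flatP[OF s(1)] flatP[OF s0] norm_triangle_ineq4 by (smt (verit))
      qed
      have uQ: "norm (u - Q u) \<le> 2 * \<eta>"
      proof -
        have "u - Q u = ((s - q) - Q (s - q)) - ((s0 - q) - Q (s0 - q))"
          by (simp add: u_def orth_projD[OF Q])
        then show ?thesis using flatQ[OF s(1)] flatQ[OF s0] norm_triangle_ineq4 by (smt (verit))
      qed
      have "P u - Q (P u) = (u - Q u) - ((u - P u) - Q (u - P u))"
        by (simp add: orth_projD[OF Q])
      then have "norm (P u - Q (P u)) \<le> norm (u - Q u) + norm ((u - P u) - Q (u - P u))"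
        by (simp only: norm_triangle_ineq4)
      also have "\<dots> \<le> 2 * \<eta> + 2 * \<eta>"
        using uQ uP orth_proj_norm_le(2)[OF Q, of "u - P u"] by linarith
      finally have 4: "norm (P u - Q (P u)) \<le> 4 * \<eta>" by simp
      \<comment> \<open>Self-adjointness moves P and 1 - Q from w to u, and (1 - Q) P u is small
        because u nearly lies in both planes.\<close>
      have "z \<bullet> u = (w - Q w) \<bullet> P u" by (simp add: z_def orth_projD(2)[OF P(1)])
      also have "\<dots> = w \<bullet> (P u - Q (P u))"
        by (simp add: inner_diff_left inner_diff_right orth_projD(2)[OF Q])
      finally have "\<bar>z \<bullet> u\<bar> \<le> norm w * norm (P u - Q (P u))" by (simp only: Cauchy_Schwarz_ineq2)
      also have "\<dots> \<le> norm w * (4 * \<eta>)" using 4 by (intro mult_left_mono) auto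
      finally have le: "\<bar>z \<bullet> u\<bar> \<le> norm w * (4 * \<eta>)" .
      have "z = norm z *\<^sub>R \<nu>" using False by (simp add: \<nu>_def z_def)
      then have "\<bar>z \<bullet> u\<bar> = norm z * \<bar>\<nu> \<bullet> u\<bar>"
        by (metis abs_mult abs_norm_cancel inner_scaleR_left)
      then have "norm z * (r / n) \<le> \<bar>z \<bullet> u\<bar>"
        using s(2) by (simp add: u_def mult_left_mono del: times_divide_eq_right)
      then have "norm z * (r / n) \<le> norm w * (4 * \<eta>)" using le by linarith
      then show ?thesis using r n0 by (simp add: z_def field_simps)
    qed
    show ?thesis
      using orth_proj_diff_le[OF P(1) Q(1) key[OF P Q(1) flatP flatQ] key[OF Q P(1) flatQ flatP]]
      by (simp add: mult.assoc)
  qed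
qed

subsection \<open>Convergence of planes over dyadic scales\<close>

lemma geometric_Cauchy_limit:
  fixes X :: "nat \<Rightarrow> 'a::banach"
  assumes q: "0 < q" "q < 1" and step: "\<And>i. i \<ge> N \<Longrightarrow> norm (X (Suc i) - X i) \<le> c * q ^ i"
  shows "\<exists>l. X \<longlonglongrightarrow> l \<and> (\<forall>i\<ge>N. norm (l - X i) \<le> c / (1 - q) * q ^ i)"
proof -
  have s: "summable (\<lambda>j. c * q ^ (i + j))" for i
    using q by (simp add: power_add summable_mult summable_geometric)
  have main: "\<exists>l. X \<longlonglongrightarrow> l \<and> norm (l - X i) \<le> c / (1 - q) * q ^ i" if i: "i \<ge> N" for i
  proof -
    define Y where "Y j = X (i + Suc j) - X (i + j)" for j
    have Y: "norm (Y j) \<le> c * q ^ (i + j)" for j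
      using step[of "i + j"] i by (simp add: Y_def)
    have sn: "summable (\<lambda>j. norm (Y j))"
      by (rule summable_comparison_test'[OF s[of i], of 0]) (use Y in auto)
    have tel: "(\<Sum>j<n. Y j) = X (i + n) - X i" for n
      using sum_lessThan_telescope[of "\<lambda>j. X (i + j)" n] by (simp add: Y_def)
    have "(\<lambda>n. X (i + n) - X i) \<longlonglongrightarrow> suminf Y"
      using summable_LIMSEQ[OF summable_norm_cancel[OF sn]] by (simp add: tel)
    then have "(\<lambda>n. X (i + n) - X i + X i) \<longlonglongrightarrow> suminf Y + X i" by (intro tendsto_intros)
    then have "(\<lambda>n. X (n + i)) \<longlonglongrightarrow> suminf Y + X i" by (simp add: add.commute)
    then have "X \<longlonglongrightarrow> suminf Y + X i" by (rule LIMSEQ_offset)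
    moreover have "norm (suminf Y) \<le> (\<Sum>j. norm (Y j))" by (rule summable_norm[OF sn])
    then have "norm (suminf Y) \<le> (\<Sum>j. c * q ^ (i + j))"
      using suminf_le[OF Y sn s[of i]] by linarith
    moreover have "(\<Sum>j. c * q ^ (i + j)) = c / (1 - q) * q ^ i"
      using q suminf_mult[of "\<lambda>j. q ^ j" "c * q ^ i"]
      by (simp add: power_add suminf_geometric summable_geometric mult.assoc)
    ultimately show ?thesis by (intro exI[of _ "suminf Y + X i"]) simp
  qed
  then obtain l where l: "X \<longlonglongrightarrow> l" by blast
  then have "norm (l - X i) \<le> c / (1 - q) * q ^ i" if "i \<ge> N" for i
    using main[OF that] LIMSEQ_unique by blast
  then show ?thesis using l by blast
qed

text \<open>Idempotence is the only condition that does not pass to pointwise limits at once. It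
  follows from P (Q x) - P x = - P (P x - Q x), since each P is a contraction.\<close>

lemma orth_proj_limit:
  assumes P: "\<And>i. i \<ge> N \<Longrightarrow> orth_proj (P i)" and lim: "\<And>v. (\<lambda>i. P i v) \<longlonglongrightarrow> Q v"
    and unif: "\<And>i v. i \<ge> N \<Longrightarrow> norm (P i v - Q v) \<le> e i * norm v" and e: "e \<longlonglongrightarrow> (0::real)"
  shows "orth_proj Q"
proof -
  have lim': "(\<lambda>i. P (i + N) v) \<longlonglongrightarrow> Q v" for v using lim by (rule LIMSEQ_ignore_initial_segment)
  have P': "orth_proj (P (i + N))" for i using P by simp
  have "Q (x + y) = Q x + Q y" for x y
    using tendsto_add[OF lim'[of x] lim'[of y]] lim'[of "x + y"]
    by (simp add: orth_projD(4)[OF P', symmetric] LIMSEQ_unique)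
  moreover have "Q (c *\<^sub>R x) = c *\<^sub>R Q x" for c x
    using tendsto_scaleR[OF tendsto_const lim'[of x], of c] lim'[of "c *\<^sub>R x"]
    by (simp add: orth_projD(6)[OF P', symmetric] LIMSEQ_unique)
  ultimately have "linear Q" by (intro linearI)
  moreover have "Q x \<bullet> y = x \<bullet> Q y" for x y
    using tendsto_inner[OF lim'[of x] tendsto_const[of y]] tendsto_inner[OF tendsto_const[of x] lim'[of y]]
    by (simp add: orth_projD(2)[OF P'] LIMSEQ_unique)
  moreover have "Q (Q x) = Q x" for x
  proof -
    have "(\<lambda>i. P (i + N) (Q x) - P (i + N) x) \<longlonglongrightarrow> 0"
    proof (rule Lim_null_comparison)
      show "\<forall>\<^sub>F i in sequentially. norm (P (i + N) (Q x) - P (i + N) x) \<le> e (i + N) * norm x"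
      proof (intro always_eventually allI)
        fix i
        have "P (i + N) (Q x) - P (i + N) x = - P (i + N) (P (i + N) x - Q x)"
          by (simp add: orth_projD[OF P'])
        also have "norm \<dots> \<le> norm (P (i + N) x - Q x)" using orth_proj_norm_le(1)[OF P'] by simp
        also have "\<dots> \<le> e (i + N) * norm x" by (rule unif) simp
        finally show "norm (P (i + N) (Q x) - P (i + N) x) \<le> e (i + N) * norm x" .
      qed
      show "(\<lambda>i. e (i + N) * norm x) \<longlonglongrightarrow> 0"
        by (intro tendsto_mult_left_zero LIMSEQ_ignore_initial_segment e)
    qed
    then have "Q (Q x) - Q x = 0"
      using tendsto_diff[OF lim'[of "Q x"] lim'[of x]] LIMSEQ_unique by blast
    then show ?thesis by simp
  qed
  ultimately show ?thesis by (simp add: orth_proj_def)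
qed

lemma dyadic_scale_exists:
  fixes d :: real
  assumes "0 < d" "d \<le> (1/2) ^ N"
  shows "\<exists>i\<ge>N. d \<le> (1/2) ^ i \<and> (1/2) ^ Suc i < d"
proof -
  obtain m where m: "(1/2) ^ m < d" using assms real_arch_pow_inv[of d "1/2"] by auto
  define j where "j = (LEAST j. (1/2) ^ j < d)"
  have j: "(1/2) ^ j < d" unfolding j_def using m by (rule LeastI)
  have nj: "\<not> (1/2) ^ i < d" if "i < j" for i using not_less_Least that unfolding j_def by blast
  have "N < j"
  proof (rule ccontr)
    assume "\<not> N < j"
    then have "(1/2::real) ^ N \<le> (1/2) ^ j" by (intro power_decreasing) auto
    then show False using j assms by linarith
  qed
  then obtain i where "j = Suc i" "i \<ge> N" by (cases j) auto
  then show ?thesis using j nj[of i] by (intro exI[of _ i]) auto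
qed

text \<open>Q is injective on \<open>range P\<close>: a vector w there with Q w = 0 satisfies |w|
  \<le> c * |w|.\<close>

lemma orth_proj_dim_le:
  assumes P: "orth_proj P" and Q: "orth_proj Q"
    and c: "c < 1" and close: "\<And>v. norm (P v - Q v) \<le> c * norm v"
  shows "dim (range P) \<le> dim (range Q)"
proof -
  have "inj_on Q (range P)"
  proof (subst linear_inj_on_iff_eq_0[OF orth_projD(1)[OF Q] subspace_orth_proj_range[OF P]], safe)
    fix w assume "Q (P w) = 0"
    then have "norm (P w) \<le> c * norm (P w)" using close[of "P w"] by (simp add: orth_projD(3)[OF P])
    then have "(1 - c) * norm (P w) \<le> 0" by (simp add: algebra_simps)
    then show "P w = 0" using c by (simp add: mult_le_0_iff)
  qed
  then have "inj_on Q (span (range P))"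
    using subspace_orth_proj_range[OF P] by (metis span_eq_iff)
  then have "dim (Q ` range P) = dim (range P)"
    by (rule dim_image_eq[OF orth_projD(1)[OF Q]])
  then show ?thesis using dim_subset[of "Q ` range P" "range Q"] by auto
qed

lemma orth_proj_dim_eq:
  assumes P: "orth_proj P" and Q: "orth_proj Q"
    and c: "c < 1" and close: "\<And>v. norm (P v - Q v) \<le> c * norm v"
  shows "dim (range P) = dim (range Q)"
proof (rule antisym)
  show "dim (range P) \<le> dim (range Q)" by (rule orth_proj_dim_le[OF P Q c close])
  show "dim (range Q) \<le> dim (range P)"
    by (rule orth_proj_dim_le[OF Q P c]) (subst norm_minus_commute, rule close)
qed

text \<open>Measure theory enters only through \<open>tilt\<close> and \<open>near\<close>, at scale
  (1/2)^i. With y = x, \<open>tilt\<close> compares consecutive scales and gives the limit plane;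
  with y at distance comparable to the scale it gives the Hoelder bound. The point s close to both
  planes is needed because the planes may miss x and y.\<close>

lemma multiscale_planes:
  fixes T :: "'a::euclidean_space set" and P :: "'a \<Rightarrow> nat \<Rightarrow> 'a \<Rightarrow> 'a" and p :: "'a \<Rightarrow> nat \<Rightarrow> 'a"
  assumes \<alpha>: "0 < \<alpha>" and K: "K \<ge> 0"
    and P: "\<And>x i. x \<in> T \<Longrightarrow> i \<ge> N \<Longrightarrow> orth_proj (P x i) \<and> dim (range (P x i)) = k"
    and tilt: "\<And>x y i v. \<lbrakk>x \<in> T; y \<in> T; i \<ge> N; dist x y \<le> (1/2) ^ Suc i\<rbrakk> \<Longrightarrow>
      norm (P x i v - P y (Suc i) v) \<le> K * ((1/2) ^ i) powr \<alpha> * norm v"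
    and near: "\<And>x y i. \<lbrakk>x \<in> T; y \<in> T; i \<ge> N; dist x y \<le> (1/2) ^ Suc i\<rbrakk> \<Longrightarrow>
      \<exists>s. dist y s \<le> (1/2) ^ Suc i \<and>
        norm ((s - p x i) - P x i (s - p x i)) \<le> K * ((1/2) ^ i) powr (1 + \<alpha>) \<and>
        norm ((s - p y (Suc i)) - P y (Suc i) (s - p y (Suc i))) \<le> K * ((1/2) ^ i) powr (1 + \<alpha>)"
  shows "\<exists>Q C. C \<ge> 0 \<and> (\<forall>x\<in>T. orth_proj (Q x) \<and> dim (range (Q x)) = k) \<and>
    (\<forall>x\<in>T. \<forall>y\<in>T. dist x y \<le> (1/2) ^ Suc N \<longrightarrow>
      (\<forall>v. norm (Q x v - Q y v) \<le> C * dist x y powr \<alpha> * norm v) \<and>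
      norm ((y - x) - Q x (y - x)) \<le> C * dist x y powr (1 + \<alpha>))"
proof -
  define q where "q = (1/2::real) powr \<alpha>"
  have q: "0 < q" "q < 1" using \<alpha> powr_less_mono2[of \<alpha> "1/2" 1] by (auto simp: q_def)
  define \<rho> where "\<rho> = (1/2) * q"
  have \<rho>: "0 < \<rho>" "\<rho> < 1" using q by (auto simp: \<rho>_def)
  have qi: "((1/2) ^ i) powr \<alpha> = q ^ i" for i unfolding q_def by (rule dyadic_powr)
  have \<rho>i: "((1/2) ^ i) powr (1 + \<alpha>) = \<rho> ^ i" for i
    unfolding \<rho>_def power_mult_distrib by (simp add: powr_add qi)
  define K1 where "K1 = K / (1 - q)"
  have K1: "K1 \<ge> 0" using K q by (simp add: K1_def)
  have "\<exists>l. (\<lambda>i. P x i v) \<longlonglongrightarrow> l \<and> (\<forall>i\<ge>N. norm (l - P x i v) \<le> (K * norm v) / (1 - q) * q ^ i)"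
    if x: "x \<in> T" for x v
  proof (rule geometric_Cauchy_limit[OF q])
    show "norm (P x (Suc i) v - P x i v) \<le> K * norm v * q ^ i" if "i \<ge> N" for i
      using tilt[OF x x that, of v] by (simp add: qi norm_minus_commute mult_ac)
  qed
  then obtain Q where lim: "\<And>x v. x \<in> T \<Longrightarrow> (\<lambda>i. P x i v) \<longlonglongrightarrow> Q x v"
    and est: "\<And>x v i. x \<in> T \<Longrightarrow> i \<ge> N \<Longrightarrow> norm (Q x v - P x i v) \<le> (K * norm v) / (1 - q) * q ^ i"
    by metis
  have est: "norm (P x i v - Q x v) \<le> K1 * q ^ i * norm v" if "x \<in> T" "i \<ge> N" for x i v
    using est[OF that, of v] by (simp add: K1_def norm_minus_commute mult_ac)
  have e0: "(\<lambda>i. K1 * q ^ i) \<longlonglongrightarrow> 0"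
    using q by (intro tendsto_mult_right_zero LIMSEQ_power_zero) auto
  have Q: "orth_proj (Q x)" if "x \<in> T" for x
    by (rule orth_proj_limit[of N "P x"]) (use P lim est e0 that in auto)
  have dimQ: "dim (range (Q x)) = k" if x: "x \<in> T" for x
  proof -
    have "\<forall>\<^sub>F i in sequentially. K1 * q ^ i < 1 \<and> i \<ge> N"
      using order_tendstoD(2)[OF e0, of 1] eventually_ge_at_top[of N] by (simp add: eventually_conj_iff)
    then obtain i where i: "K1 * q ^ i < 1" "i \<ge> N" by (auto dest!: eventually_happens)
    have "dim (range (P x i)) = dim (range (Q x))"
      using P[OF x i(2)] Q[OF x] i(1) est[OF x i(2)] by (intro orth_proj_dim_eq) auto
    then show ?thesis using P[OF x i(2)] by simp
  qed
  define D where "D x i y = norm ((y - p x i) - P x i (y - p x i))" for x i y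
  \<comment> \<open>Pass from one plane to the other through s: two flatness errors and the tilt
    over the distance |y - s| each contribute K * \<rho>^i.\<close>
  have step: "D x i y \<le> D y (Suc i) y + 3 * K * \<rho> ^ i"
    if x: "x \<in> T" and y: "y \<in> T" and i: "i \<ge> N" and d: "dist x y \<le> (1/2) ^ Suc i" for x y i
  proof -
    have Px: "orth_proj (P x i)" and Py: "orth_proj (P y (Suc i))" using P x y i by auto
    obtain s where s: "dist y s \<le> (1/2) ^ Suc i"
      "norm ((s - p x i) - P x i (s - p x i)) \<le> K * \<rho> ^ i"
      "norm ((s - p y (Suc i)) - P y (Suc i) (s - p y (Suc i))) \<le> K * \<rho> ^ i"
      using near[OF x y i d] by (auto simp: \<rho>i)
    have "(y - p x i) - P x i (y - p x i) = ((s - p x i) - P x i (s - p x i))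
        + ((y - p y (Suc i)) - P y (Suc i) (y - p y (Suc i)))
        - ((s - p y (Suc i)) - P y (Suc i) (s - p y (Suc i)))
        - (P x i (y - s) - P y (Suc i) (y - s))"
      by (simp add: orth_projD[OF Px] orth_projD[OF Py])
    also have "norm \<dots> \<le> K * \<rho> ^ i + D y (Suc i) y + K * \<rho> ^ i + norm (P x i (y - s) - P y (Suc i) (y - s))"
    proof -
      have "norm (a + b - c - d) \<le> norm a + norm b + norm c + norm d" for a b c d :: 'a
        by norm
      from this[of "(s - p x i) - P x i (s - p x i)" "(y - p y (Suc i)) - P y (Suc i) (y - p y (Suc i))"
          "(s - p y (Suc i)) - P y (Suc i) (s - p y (Suc i))" "P x i (y - s) - P y (Suc i) (y - s)"]
      show ?thesis unfolding D_def using s(2,3) by linarith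
    qed
    also have "norm (P x i (y - s) - P y (Suc i) (y - s)) \<le> K * q ^ i * norm (y - s)"
      using tilt[OF x y i d] by (simp add: qi)
    also have "\<dots> \<le> K * q ^ i * (1/2) ^ i"
    proof (intro mult_left_mono)
      have "norm (y - s) \<le> (1/2) ^ Suc i" using s(1) by (simp add: dist_norm)
      also have "\<dots> \<le> (1/2) ^ i" by (intro power_decreasing) auto
      finally show "norm (y - s) \<le> (1/2) ^ i" .
    qed (use K q in simp)
    also have "\<dots> = K * \<rho> ^ i" unfolding \<rho>_def power_mult_distrib by simp
    finally show ?thesis by (simp add: D_def)
  qed
  define C1 where "C1 = 3 * K / (1 - \<rho>)"
  have C1: "C1 \<ge> 0" using K \<rho> by (simp add: C1_def)
  \<comment> \<open>C1 is chosen so that C1 * (1 - \<rho>) = 3 * K absorbs the error of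
    \<open>step\<close>, which makes e nondecreasing. Since s lies within (1/2)^(i+1) of y, e also
    has an upper bound tending to 0, so e \<le> 0: the planes approach y although they need not
    contain it.\<close>
  have self: "D y j y \<le> C1 * \<rho> ^ j" if y: "y \<in> T" and j: "j \<ge> N" for y j
  proof -
    define e where "e i = D y i y - C1 * \<rho> ^ i" for i
    have inc: "e i \<le> e (Suc i)" if "i \<ge> N" for i
    proof -
      have "C1 * \<rho> ^ i - C1 * \<rho> ^ Suc i = C1 * (1 - \<rho>) * \<rho> ^ i" by (simp add: algebra_simps)
      also have "\<dots> = 3 * K * \<rho> ^ i" using \<rho> by (simp add: C1_def)
      finally show ?thesis using step[OF y y that] by (simp add: e_def)
    qed
    have le: "e j \<le> e i" if "i \<ge> j" for i
      using that by (induction rule: dec_induct) (use inc j in \<open>auto intro: order_trans\<close>)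
    have up: "e i \<le> K * \<rho> ^ i + (1/2) ^ i" if i: "i \<ge> N" for i
    proof -
      obtain s where s: "dist y s \<le> (1/2) ^ Suc i"
        "norm ((s - p y i) - P y i (s - p y i)) \<le> K * \<rho> ^ i"
        using near[OF y y i] by (auto simp: \<rho>i)
      have Py: "orth_proj (P y i)" using P y i by auto
      have "(y - p y i) - P y i (y - p y i) = ((s - p y i) - P y i (s - p y i)) + ((y - s) - P y i (y - s))"
        by (simp add: orth_projD[OF Py])
      then have "D y i y \<le> norm ((s - p y i) - P y i (s - p y i)) + norm ((y - s) - P y i (y - s))"
        unfolding D_def by (simp only: norm_triangle_ineq)
      also have "\<dots> \<le> K * \<rho> ^ i + norm (y - s)"
        using s(2) orth_proj_norm_le(2)[OF Py, of "y - s"] by (rule add_mono)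
      also have "norm (y - s) \<le> (1/2) ^ Suc i" using s(1) by (simp add: dist_norm)
      also have "\<dots> \<le> (1/2) ^ i" by (intro power_decreasing) auto
      finally have "D y i y \<le> K * \<rho> ^ i + (1/2) ^ i" by simp
      moreover have "0 \<le> C1 * \<rho> ^ i" using C1 \<rho> by simp
      ultimately show ?thesis unfolding e_def by linarith
    qed
    have "(\<lambda>i. K * \<rho> ^ i + (1/2) ^ i) \<longlonglongrightarrow> K * 0 + 0"
      using \<rho> by (intro tendsto_intros LIMSEQ_power_zero) auto
    then have "e j \<le> K * 0 + 0"
      by (rule LIMSEQ_le_const) (use le up j in \<open>auto intro!: exI[of _ j] intro: order_trans\<close>)
    then show ?thesis by (simp add: e_def)
  qed
  define C2 where "C2 = 2 * (C1 + 3 * K)"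
  have C2: "C2 \<ge> 0" using C1 K by (simp add: C2_def)
  define C where "C = 4 powr (1 + \<alpha>) * (C2 + 2 * K1 + K)"
  have "C \<ge> 0" using C2 K1 K by (simp add: C_def)
  moreover have "(\<forall>v. norm (Q x v - Q y v) \<le> C * dist x y powr \<alpha> * norm v) \<and>
      norm ((y - x) - Q x (y - x)) \<le> C * dist x y powr (1 + \<alpha>)"
    if x: "x \<in> T" and y: "y \<in> T" and d: "dist x y \<le> (1/2) ^ Suc N" for x y
  proof (cases "x = y")
    case True
    then show ?thesis using orth_projD(7)[OF Q[OF x]] by simp
  next
    case False
    then obtain j where j: "j \<ge> Suc N" "dist x y \<le> (1/2) ^ j" "(1/2) ^ Suc j < dist x y"
      using dyadic_scale_exists[of "dist x y" "Suc N"] d by auto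
    \<comment> \<open>\<open>tilt\<close> and \<open>near\<close> at level i ask for dist x y \<le>
      (1/2) ^ Suc i, so i is one below the dyadic index of the distance. Hence the factor 4 in
      r.\<close>
    then obtain i where i: "i \<ge> N" "j = Suc i" by (cases j) auto
    have d': "dist x y \<le> (1/2) ^ Suc i" using j i by simp
    have r: "(1/2) ^ i \<le> 4 * dist x y" using j(3) i by simp
    have qle: "q ^ i \<le> 4 powr \<alpha> * dist x y powr \<alpha>"
      unfolding qi[symmetric] using powr_mono2[OF _ _ r, of \<alpha>] \<alpha> by (simp add: powr_mult)
    have \<rho>le: "\<rho> ^ i \<le> 4 powr (1 + \<alpha>) * dist x y powr (1 + \<alpha>)"
      unfolding \<rho>i[symmetric] using powr_mono2[OF _ _ r, of "1 + \<alpha>"] \<alpha> by (simp add: powr_mult)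
    have "norm (Q x v - Q y v) \<le> C * dist x y powr \<alpha> * norm v" for v
    proof -
      have "Q x v - Q y v = (P x i v - P y (Suc i) v) + (P y (Suc i) v - Q y v) - (P x i v - Q x v)" by simp
      also have "norm \<dots> \<le> K * q ^ i * norm v + K1 * q ^ Suc i * norm v + K1 * q ^ i * norm v"
      proof -
        have "norm (P x i v - P y (Suc i) v) \<le> K * q ^ i * norm v"
          using tilt[OF x y i(1) d'] by (simp add: qi)
        moreover have "norm (P y (Suc i) v - Q y v) \<le> K1 * q ^ Suc i * norm v"
          by (rule est[OF y]) (use i(1) in simp)
        moreover have "norm (P x i v - Q x v) \<le> K1 * q ^ i * norm v" by (rule est[OF x i(1)])
        moreover have tri: "norm (a + b - c) \<le> norm a + norm b + norm c" for a b c :: 'a by norm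
        ultimately show ?thesis
          using tri[of "P x i v - P y (Suc i) v" "P y (Suc i) v - Q y v" "P x i v - Q x v"] by linarith
      qed
      also have "K1 * q ^ Suc i * norm v \<le> K1 * q ^ i * norm v"
        using K1 q by (intro mult_right_mono mult_left_mono power_decreasing) auto
      finally have "norm (Q x v - Q y v) \<le> (2 * K1 + K) * q ^ i * norm v" by (simp add: algebra_simps)
      also have "\<dots> \<le> (C2 + 2 * K1 + K) * (4 powr (1 + \<alpha>) * dist x y powr \<alpha>) * norm v"
      proof (intro mult_right_mono mult_mono)
        have "4 powr \<alpha> * dist x y powr \<alpha> \<le> 4 powr (1 + \<alpha>) * dist x y powr \<alpha>"
          by (intro mult_right_mono powr_mono) auto
        then show "q ^ i \<le> 4 powr (1 + \<alpha>) * dist x y powr \<alpha>" using qle by linarith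
      qed (use K1 K C2 q in auto)
      finally show ?thesis by (simp add: C_def mult_ac)
    qed
    moreover have "norm ((y - x) - Q x (y - x)) \<le> C * dist x y powr (1 + \<alpha>)"
    proof -
      have Px: "orth_proj (P x i)" using P x i by auto
      have "D x i y \<le> (C1 + 3 * K) * \<rho> ^ i"
      proof -
        have "D y (Suc i) y \<le> C1 * \<rho> ^ Suc i" using i by (intro self[OF y]) simp
        also have "\<dots> \<le> C1 * \<rho> ^ i" using C1 \<rho> by (intro mult_left_mono power_decreasing) auto
        finally show ?thesis using step[OF x y i(1) d'] by (simp add: algebra_simps)
      qed
      moreover have "D x i x \<le> C1 * \<rho> ^ i" using self[OF x i(1)] .
      moreover have "0 \<le> 3 * K * \<rho> ^ i" using K \<rho> by simp
      moreover have "norm ((y - x) - P x i (y - x)) \<le> D x i y + D x i x"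
      proof -
        have "(y - x) - P x i (y - x) = ((y - p x i) - P x i (y - p x i)) - ((x - p x i) - P x i (x - p x i))"
          by (simp add: orth_projD[OF Px])
        then show ?thesis unfolding D_def by (simp only: norm_triangle_ineq4)
      qed
      ultimately have "norm ((y - x) - P x i (y - x)) \<le> C2 * \<rho> ^ i" by (simp add: C2_def algebra_simps)
      moreover have "norm (P x i (y - x) - Q x (y - x)) \<le> K1 * \<rho> ^ i"
      proof -
        have "norm (P x i (y - x) - Q x (y - x)) \<le> K1 * q ^ i * norm (y - x)" by (rule est[OF x i(1)])
        also have "\<dots> \<le> K1 * q ^ i * (1/2) ^ i"
        proof (rule mult_left_mono)
          have "norm (y - x) \<le> (1/2) ^ Suc i" using d' by (simp add: dist_norm norm_minus_commute)
          also have "\<dots> \<le> (1/2) ^ i" by (intro power_decreasing) auto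
          finally show "norm (y - x) \<le> (1/2) ^ i" .
        qed (use K1 q in simp)
        also have "\<dots> = K1 * \<rho> ^ i" unfolding \<rho>_def power_mult_distrib by simp
        finally show ?thesis .
      qed
      moreover have "(y - x) - Q x (y - x) = ((y - x) - P x i (y - x)) + (P x i (y - x) - Q x (y - x))" by simp
      then have "norm ((y - x) - Q x (y - x)) \<le> norm ((y - x) - P x i (y - x)) + norm (P x i (y - x) - Q x (y - x))"
        by (simp only: norm_triangle_ineq)
      ultimately have "norm ((y - x) - Q x (y - x)) \<le> (C2 + K1) * \<rho> ^ i" by (simp add: algebra_simps)
      also have "\<dots> \<le> (C2 + 2 * K1 + K) * (4 powr (1 + \<alpha>) * dist x y powr (1 + \<alpha>))"
        using \<rho>le K1 K C2 \<rho> by (intro mult_mono) auto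
      finally show ?thesis by (simp add: C_def mult_ac)
    qed
    ultimately show ?thesis by blast
  qed
  ultimately show ?thesis using Q dimQ by (intro exI[of _ Q] exI[of _ C]) blast
qed

subsection \<open>Graphs from families of planes\<close>

lemma orth_proj_orthogonal_comp:
  assumes P: "orth_proj P"
  shows "v - P v \<in> orthogonal_comp (range P)"
  by (auto simp: orthogonal_comp_def orthogonal_def orth_projD[OF P] inner_diff_right)

text \<open>A continuous family of planes close to \<open>range P0\<close> is parametrized over \<open>range P0\<close> by inverses of
  the restrictions of \<open>P0\<close>.\<close>

lemma graph_of_planes:
  fixes T :: "'a::euclidean_space set" and Q :: "'a \<Rightarrow> 'a \<Rightarrow> 'a"
  assumes \<alpha>: "0 < \<alpha>" "\<alpha> \<le> 1" and C: "C \<ge> 0" and T: "x0 \<in> T"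
    and Q: "\<And>x. x \<in> T \<Longrightarrow> orth_proj (Q x)" and dim: "\<And>x. x \<in> T \<Longrightarrow> dim (range (Q x)) = k"
    and small: "\<And>x y. x \<in> T \<Longrightarrow> y \<in> T \<Longrightarrow> C * dist x y powr \<alpha> \<le> 1 / 4"
    and tilt: "\<And>x y v. x \<in> T \<Longrightarrow> y \<in> T \<Longrightarrow> norm (Q x v - Q y v) \<le> C * dist x y powr \<alpha> * norm v"
    and flat: "\<And>x y. x \<in> T \<Longrightarrow> y \<in> T \<Longrightarrow> norm ((y - x) - Q x (y - x)) \<le> C * dist x y powr (1 + \<alpha>)"
  shows "\<exists>\<Gamma>. C1_holder_graph k \<alpha> \<Gamma> \<and> T \<subseteq> \<Gamma>"
proof -
  define P where "P = Q x0"
  have P: "orth_proj P" "dim (range P) = k" using Q dim T by (auto simp: P_def)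
  have close: "norm (Q x v - P v) \<le> 1 / 4 * norm v" if "x \<in> T" for x v
  proof -
    have "norm (Q x v - P v) \<le> C * dist x x0 powr \<alpha> * norm v" unfolding P_def by (rule tilt[OF that T])
    also have "\<dots> \<le> 1 / 4 * norm v" by (intro mult_right_mono small that T) simp
    finally show ?thesis .
  qed
  have "\<exists>J. linear J \<and> range J \<subseteq> range (Q x) \<and> (\<forall>z. P (J (P z)) = P z)" if x: "x \<in> T" for x
  proof -
    note Qx = Q[OF x]
    have inj: "inj_on P (range (Q x))"
    proof (subst linear_inj_on_iff_eq_0[OF orth_projD(1)[OF P(1)] subspace_orth_proj_range[OF Qx]], safe)
      fix w assume "P (Q x w) = 0"
      then have "norm (Q x w) \<le> 1 / 4 * norm (Q x w)"
        using close[OF x, of "Q x w"] by (simp add: orth_projD(3)[OF Qx])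
      then show "Q x w = 0" by simp
    qed
    have sub: "subspace (P ` range (Q x))"
      by (intro linear_subspace_image orth_projD(1)[OF P(1)] subspace_orth_proj_range[OF Qx])
    have "inj_on P (span (range (Q x)))"
      using subspace_orth_proj_range[OF Qx] inj by (metis span_eq_iff)
    then have "dim (P ` range (Q x)) = dim (range (Q x))"
      by (rule dim_image_eq[OF orth_projD(1)[OF P(1)]])
    then have "dim (P ` range (Q x)) = dim (range P)" using dim[OF x] P(2) by simp
    then have eq: "P ` range (Q x) = range P"
      using subspace_dim_equal[OF sub subspace_orth_proj_range[OF P(1)]] by auto
    obtain J where J: "range J \<subseteq> range (Q x)" "linear J" "\<forall>v\<in>range (Q x). J (P v) = v"
      using linear_exists_left_inverse_on[OF orth_projD(1)[OF P(1)] subspace_orth_proj_range[OF Qx] inj]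
      by blast
    have "P (J (P z)) = P z" for z
    proof -
      obtain v where "v \<in> range (Q x)" "P z = P v" using eq by (metis imageE rangeI)
      moreover from this have "J (P v) = v" using J(3) by blast
      ultimately show ?thesis by simp
    qed
    then show ?thesis using J by blast
  qed
  then obtain J where J: "\<And>x. x \<in> T \<Longrightarrow> linear (J x)" "\<And>x z. x \<in> T \<Longrightarrow> J x z \<in> range (Q x)"
      "\<And>x z. x \<in> T \<Longrightarrow> P (J x (P z)) = P z"
    by (metis rangeI subsetD)
  have QJ: "Q x (J x z) = J x z" if "x \<in> T" for x z
    using J(2)[OF that] orth_proj_range_eq[OF Q[OF that]] by blast
  \<comment> \<open>A vector killed by P is nearly normal to \<open>range (Q x)\<close>, so its
    normal part controls it. \<open>Jlip\<close> and \<open>Jflat\<close> apply this to differences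
    of vectors with equal P-image.\<close>
  have ker: "norm d \<le> 2 * norm (d - Q x d)" if x: "x \<in> T" and d: "P d = 0" for x d
  proof -
    have "norm (Q x d) \<le> 1 / 4 * norm d" using close[OF x, of d] d by simp
    moreover have "norm d \<le> norm (d - Q x d) + norm (Q x d)" by (metis diff_add_cancel norm_triangle_ineq)
    ultimately show ?thesis using norm_ge_zero[of d] by linarith
  qed
  have Jnorm: "norm (J x (P z)) \<le> 2 * norm (P z)" if x: "x \<in> T" for x z
  proof -
    have "norm (J x (P z) - P z) \<le> 1 / 4 * norm (J x (P z))"
      using close[OF x, of "J x (P z)"] QJ[OF x] J(3)[OF x] by simp
    moreover have "norm (J x (P z)) \<le> norm (J x (P z) - P z) + norm (P z)"
      by (metis diff_add_cancel norm_triangle_ineq)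
    ultimately show ?thesis using norm_ge_zero[of "J x (P z)"] by linarith
  qed
  have Jlip: "norm (J x (P z) - J y (P z)) \<le> 4 * C * dist x y powr \<alpha> * norm (P z)"
    if x: "x \<in> T" and y: "y \<in> T" for x y z
  proof -
    define d where "d = J x (P z) - J y (P z)"
    have "P d = 0" by (simp add: d_def orth_projD[OF P(1)] J(3) x y)
    then have "norm d \<le> 2 * norm (d - Q x d)" by (rule ker[OF x])
    also have "d - Q x d = Q x (J y (P z)) - Q y (J y (P z))"
      by (simp add: d_def orth_projD[OF Q[OF x]] QJ x y)
    also have "norm \<dots> \<le> C * dist x y powr \<alpha> * norm (J y (P z))" by (rule tilt[OF x y])
    also have "\<dots> \<le> C * dist x y powr \<alpha> * (2 * norm (P z))"
      using C by (intro mult_left_mono Jnorm y) auto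
    finally show ?thesis by (simp add: d_def)
  qed
  have Jflat: "norm ((y - x) - J x (P (y - x))) \<le> 2 * C * dist x y powr (1 + \<alpha>)"
    if x: "x \<in> T" and y: "y \<in> T" for x y
  proof -
    define d where "d = (y - x) - J x (P (y - x))"
    have "P d = 0"
      unfolding d_def orth_projD(5)[OF P(1), of "y - x" "J x (P (y - x))"] J(3)[OF x] by simp
    then have "norm d \<le> 2 * norm (d - Q x d)" by (rule ker[OF x])
    also have "d - Q x d = (y - x) - Q x (y - x)"
      using orth_projD(5)[OF Q[OF x], of "y - x" "J x (P (y - x))"] QJ[OF x] by (simp add: d_def)
    also have "norm \<dots> \<le> C * dist x y powr (1 + \<alpha>)" by (rule flat[OF x y])
    finally show ?thesis by (simp add: d_def)
  qed
  have bilip: "norm (y - x) \<le> 4 * norm (P (y - x))" if x: "x \<in> T" and y: "y \<in> T" for x y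
  proof -
    have "norm ((y - x) - Q x (y - x)) \<le> C * dist x y powr \<alpha> * norm (y - x)"
      using flat[OF x y] by (cases "x = y") (auto simp: powr_add dist_norm norm_minus_commute mult_ac)
    also have "\<dots> \<le> 1 / 4 * norm (y - x)" by (intro mult_right_mono small x y) simp
    finally have "norm ((y - x) - Q x (y - x)) \<le> 1 / 4 * norm (y - x)" .
    moreover have "norm (y - x) \<le> norm ((y - x) - Q x (y - x)) + norm (Q x (y - x) - P (y - x)) + norm (P (y - x))"
      by (rule order_trans[OF _ norm_triangle_ineq, THEN order_trans[rotated, OF add_right_mono[OF norm_triangle_ineq]]]) simp
    ultimately show ?thesis using close[OF x, of "y - x"] norm_ge_zero[of "y - x"] by linarith
  qed
  define A where "A = P ` T"
  define \<sigma> where "\<sigma> = inv_into T P"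
  have injP: "inj_on P T"
  proof (rule inj_onI)
    fix x y assume "x \<in> T" "y \<in> T" "P x = P y"
    then show "x = y" using bilip[of x y] by (simp add: orth_projD[OF P(1)])
  qed
  have \<sigma>: "\<sigma> a \<in> T" "P (\<sigma> a) = a" if "a \<in> A" for a
    using that by (auto simp: A_def \<sigma>_def inv_into_into f_inv_into_f)
  have \<sigma>P: "\<sigma> (P x) = x" if "x \<in> T" for x using injP that by (simp add: \<sigma>_def)
  \<comment> \<open>f is the normal coordinate of the point of T over a, and G a is the slope of its
    plane: J lifts P v to the plane and subtracting P v leaves the normal part. Precomposing with P
    defines G a on the whole space.\<close>
  define f where "f a = \<sigma> a - a" for a
  define G where "G a v = J (\<sigma> a) (P v) - P v" for a v
  define M where "M = (2 * C * 4 powr (1 + \<alpha>) + 4 * C * 4 powr \<alpha>) * 2 powr (1 + \<alpha>)"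
  have M: "M \<ge> 0" using C by (simp add: M_def)
  have PA: "P a = a" if "a \<in> A" for a using that by (auto simp: A_def orth_projD(3)[OF P(1)])
  have jet: "norm (f a + G a (z - a) - (f b + G b (z - b)))
      \<le> M * (norm (z - a) powr (1 + \<alpha>) + norm (z - b) powr (1 + \<alpha>))" if a: "a \<in> A" and b: "b \<in> A" for a b z
  proof -
    define x where "x = \<sigma> a"
    define y where "y = \<sigma> b"
    have xy: "x \<in> T" "y \<in> T" "P x = a" "P y = b" using \<sigma> a b by (auto simp: x_def y_def)
    define D where "D = norm (z - a) + norm (z - b)"
    have D: "D \<ge> 0" by (simp add: D_def)
    have "norm (y - x) \<le> 4 * norm (b - a)" using bilip[OF xy(1,2)] xy by (simp add: orth_projD[OF P(1)])
    also have "b - a = (z - a) - (z - b)" by simp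
    also have "norm \<dots> \<le> D" unfolding D_def by (rule norm_triangle_ineq4)
    finally have yx: "dist x y \<le> 4 * D" by (simp add: dist_norm norm_minus_commute)
    have "f a + G a (z - a) - (f b + G b (z - b))
        = (J x (P (z - b)) - J y (P (z - b))) - ((y - x) - J x (P (y - x)))"
    proof -
      have "J x (P (z - a)) = J x (P (z - b)) + J x (P (y - x))"
      proof -
        have "P (z - a) = P (z - b) + P (y - x)"
          by (simp add: orth_projD[OF P(1)] xy PA a b)
        then show ?thesis using linear_add[OF J(1)[OF xy(1)]] by simp
      qed
      then show ?thesis
        by (simp add: f_def G_def x_def[symmetric] y_def[symmetric] orth_projD[OF P(1)] PA a b)
    qed
    also have "norm \<dots> \<le> 4 * C * dist x y powr \<alpha> * norm (P (z - b)) + 2 * C * dist x y powr (1 + \<alpha>)"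
      using Jlip[OF xy(1,2), of "z - b"] Jflat[OF xy(1,2)]
      by (rule order_trans[OF norm_triangle_ineq4 add_mono])
    also have "\<dots> \<le> 4 * C * (4 powr \<alpha> * D powr \<alpha>) * D + 2 * C * (4 powr (1 + \<alpha>) * D powr (1 + \<alpha>))"
    proof (intro add_mono mult_mono mult_left_mono)
      show "dist x y powr \<alpha> \<le> 4 powr \<alpha> * D powr \<alpha>"
        using powr_mono2[OF _ _ yx, of \<alpha>] \<alpha> D by (simp add: powr_mult)
      show "dist x y powr (1 + \<alpha>) \<le> 4 powr (1 + \<alpha>) * D powr (1 + \<alpha>)"
        using powr_mono2[OF _ _ yx, of "1 + \<alpha>"] \<alpha> D by (simp add: powr_mult)
      have "norm (P (z - b)) \<le> norm (z - b)" by (rule orth_proj_norm_le[OF P(1)])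
      then show "norm (P (z - b)) \<le> D" by (simp add: D_def add_increasing)
    qed (use C D in auto)
    also have "\<dots> = (2 * C * 4 powr (1 + \<alpha>) + 4 * C * 4 powr \<alpha>) * D powr (1 + \<alpha>)"
      using D by (cases "D = 0") (auto simp: powr_add algebra_simps)
    also have "\<dots> \<le> (2 * C * 4 powr (1 + \<alpha>) + 4 * C * 4 powr \<alpha>) *
        (2 powr (1 + \<alpha>) * (norm (z - a) powr (1 + \<alpha>) + norm (z - b) powr (1 + \<alpha>)))"
      unfolding D_def using C \<alpha> by (intro mult_left_mono powr_sum_le) auto
    finally show ?thesis by (simp add: M_def mult_ac)
  qed
  have ne: "A \<noteq> {}" using T by (auto simp: A_def)
  have linG: "linear (G a)" if "a \<in> A" for a
  proof -
    note Ja = J(1)[OF \<sigma>(1)[OF that]]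
    show ?thesis
      by (rule linearI) (simp_all add: G_def orth_projD[OF P(1)] linear_add[OF Ja] linear_scale[OF Ja] scaleR_diff_right)
  qed
  have "\<exists>F F' K. (\<forall>a\<in>A. F a = f a \<bullet> b) \<and> (\<forall>x. (F has_derivative F' x) (at x)) \<and>
      (\<forall>x y h. \<bar>F' x h - F' y h\<bar> \<le> K * dist x y powr \<alpha> * norm h)" if b: "b \<in> Basis" for b
  proof (rule C1_holder_extension[OF \<alpha> M ne, where G = "\<lambda>a v. G a v \<bullet> b"])
    show "bounded_linear (\<lambda>v. G a v \<bullet> b)" if "a \<in> A" for a
      using linG[OF that] by (intro bounded_linear_compose[OF bounded_linear_inner_left]) (simp add: linear_conv_bounded_linear)
    show "f a \<bullet> b + G a (z - a) \<bullet> b - (f a' \<bullet> b + G a' (z - a') \<bullet> b)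
      \<le> M * (norm (z - a) powr (1 + \<alpha>) + norm (z - a') powr (1 + \<alpha>))" if "a \<in> A" "a' \<in> A" for a a' z
    proof -
      have "f a \<bullet> b + G a (z - a) \<bullet> b - (f a' \<bullet> b + G a' (z - a') \<bullet> b)
          = (f a + G a (z - a) - (f a' + G a' (z - a'))) \<bullet> b" by (simp add: inner_diff_left inner_add_left)
      also have "\<dots> \<le> norm (f a + G a (z - a) - (f a' + G a' (z - a')))"
        using Basis_le_norm[OF b] by (metis abs_le_D1)
      finally show ?thesis using jet[OF that] by (rule order_trans)
    qed
  qed
  then obtain F F' K where F: "\<And>b a. b \<in> Basis \<Longrightarrow> a \<in> A \<Longrightarrow> F b a = f a \<bullet> b"
    and F': "\<And>b x. b \<in> Basis \<Longrightarrow> (F b has_derivative F' b x) (at x)"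
    and K: "\<And>b x y h. b \<in> Basis \<Longrightarrow> \<bar>F' b x h - F' b y h\<bar> \<le> K b * dist x y powr \<alpha> * norm h"
    by metis
  \<comment> \<open>The coordinatewise extensions may leave the orthogonal complement of
    \<open>range P\<close>. Projecting back by q does not increase the Hoelder bounds and changes
    nothing on A, where f is already normal.\<close>
  define q where "q v = v - P v" for v :: 'a
  have q: "bounded_linear q"
    unfolding q_def using orth_projD(1)[OF P(1)]
    by (intro bounded_linear_sub bounded_linear_ident) (simp add: linear_conv_bounded_linear)
  define g where "g v = q (\<Sum>b\<in>Basis. F b v *\<^sub>R b)" for v
  define g' where "g' v h = q (\<Sum>b\<in>Basis. F' b v h *\<^sub>R b)" for v h
  have der: "(g has_derivative g' v) (at v within range P)" for v
  proof -
    have "((\<lambda>v. \<Sum>b\<in>Basis. F b v *\<^sub>R b) has_derivative (\<lambda>h. \<Sum>b\<in>Basis. F' b v h *\<^sub>R b)) (at v)"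
      using F' by (intro has_derivative_sum has_derivative_scaleR_left)
    then have "(g has_derivative g' v) (at v)"
      unfolding g_def g'_def by (rule bounded_linear.has_derivative[OF q])
    then show ?thesis by (rule has_derivative_at_withinI)
  qed
  have hol: "norm (g' v h - g' w h) \<le> (\<Sum>b\<in>Basis. K b) * dist v w powr \<alpha> * norm h" for v w h
  proof -
    have "g' v h - g' w h = q (\<Sum>b\<in>Basis. (F' b v h - F' b w h) *\<^sub>R b)"
      by (simp add: g'_def linear_diff[OF bounded_linear.linear[OF q], symmetric] sum_subtractf scaleR_left_diff_distrib)
    also have "norm \<dots> \<le> norm (\<Sum>b\<in>Basis. (F' b v h - F' b w h) *\<^sub>R b)"
      unfolding q_def by (rule orth_proj_norm_le[OF P(1)])
    also have "\<dots> \<le> (\<Sum>b\<in>Basis. norm ((F' b v h - F' b w h) *\<^sub>R b))" by (rule norm_sum)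
    also have "\<dots> \<le> (\<Sum>b\<in>Basis. K b * dist v w powr \<alpha> * norm h)"
      using K by (intro sum_mono) simp
    finally show ?thesis by (simp add: sum_distrib_right)
  qed
  have "C1_holder_on \<alpha> (range P) g"
    unfolding C1_holder_on_def using der hol by blast
  moreover have "g v \<in> orthogonal_comp (range P)" for v
    unfolding g_def q_def by (rule orth_proj_orthogonal_comp[OF P(1)])
  ultimately have "C1_holder_graph k \<alpha> {v + g v |v. v \<in> range P}"
    unfolding C1_holder_graph_def using subspace_orth_proj_range[OF P(1)] P(2) by blast
  moreover have "T \<subseteq> {v + g v |v. v \<in> range P}"
  proof
    fix x assume x: "x \<in> T"
    then have Px: "P x \<in> A" by (simp add: A_def)
    have "(\<Sum>b\<in>Basis. F b (P x) *\<^sub>R b) = (\<Sum>b\<in>Basis. (f (P x) \<bullet> b) *\<^sub>R b)"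
      using F[OF _ Px] by (intro sum.cong) auto
    also have "\<dots> = f (P x)" by (rule euclidean_representation)
    finally have "g (P x) = x - P x"
      by (simp add: g_def q_def f_def \<sigma>P[OF x] orth_projD[OF P(1)])
    then have "x = P x + g (P x)" by simp
    then show "x \<in> {v + g v |v. v \<in> range P}" by blast
  qed
  ultimately show ?thesis by blast
qed

subsection \<open>Decomposition into uniform pieces\<close>

text \<open>N bounds the scale and also replaces the width factor; enlarging it weakens both
  conditions. The exceptional masses are measured against the same \<theta> as the lower mass, so
  that they can be subtracted from it.\<close>

definition flat_piece :: "nat \<Rightarrow> real \<Rightarrow> real \<Rightarrow> 'a::euclidean_space set \<Rightarrow> real \<Rightarrow> nat \<Rightarrow> nat \<Rightarrow> 'a set" where
  "flat_piece k \<alpha> c E \<theta> m N = {x \<in> upper_regular k E m. \<forall>r. 0 < r \<and> r \<le> (1/2) ^ N \<longrightarrow>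
     ennreal (\<theta> * (2 * r) ^ k) \<le> hausdorff k (E \<inter> cball x r) \<and>
     hausdorff k ((E \<inter> cball x r) - upper_regular k E m) \<le> ennreal (c * \<theta> * r ^ k) \<and>
     (\<exists>V. affine_plane k V \<and>
       hausdorff k ((E \<inter> cball x r) - plane_nbhd V (real N * r powr (1 + \<alpha>))) \<le> ennreal (c * \<theta> * r ^ k))}"

lemma flat_pieceD:
  assumes "x \<in> flat_piece k \<alpha> c E \<theta> m N" "0 < r" "r \<le> (1/2) ^ N"
  shows "ennreal (\<theta> * (2 * r) ^ k) \<le> hausdorff k (E \<inter> cball x r)"
    "hausdorff k ((E \<inter> cball x r) - upper_regular k E m) \<le> ennreal (c * \<theta> * r ^ k)"
    "\<exists>V. affine_plane k V \<and>
       hausdorff k ((E \<inter> cball x r) - plane_nbhd V (real N * r powr (1 + \<alpha>))) \<le> ennreal (c * \<theta> * r ^ k)"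
  using assms unfolding flat_piece_def by blast+

lemma open_plane_nbhd: "open (plane_nbhd V \<eta>)"
  unfolding plane_nbhd_def by (intro open_Collect_less continuous_intros)

lemma flat_piece_multiscale:
  fixes E :: "'a::euclidean_space set"
  assumes k: "k \<ge> 1" and \<alpha>: "0 < \<alpha>" and c: "0 < c" "c \<le> 1 / 4" and \<theta>: "\<theta> > 0"
    and E: "E \<in> sets borel"
  shows "\<exists>Q C N'. C \<ge> 0 \<and> (\<forall>x\<in>flat_piece k \<alpha> c E \<theta> m N. orth_proj (Q x) \<and> dim (range (Q x)) = k) \<and>
    (\<forall>x\<in>flat_piece k \<alpha> c E \<theta> m N. \<forall>y\<in>flat_piece k \<alpha> c E \<theta> m N. dist x y \<le> (1/2) ^ Suc N' \<longrightarrow>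
      (\<forall>v. norm (Q x v - Q y v) \<le> C * dist x y powr \<alpha> * norm v) \<and>
      norm ((y - x) - Q x (y - x)) \<le> C * dist x y powr (1 + \<alpha>))"
proof -
  define T where "T = flat_piece k \<alpha> c E \<theta> m N"
  define G where "G = upper_regular k E m"
  define \<mu> where "\<mu> = hausdorff_restr k E"
  have \<mu>sets: "sets \<mu> = sets borel" by (simp add: \<mu>_def)
  have \<mu>: "emeasure \<mu> X = hausdorff k (E \<inter> X)" if "X \<in> sets borel" for X
    unfolding \<mu>_def by (rule emeasure_hausdorff_restr[OF k E that])
  have Gb: "G \<in> sets borel" unfolding G_def by (rule borel_upper_regular[OF k E])
  have GE: "G \<subseteq> E" by (auto simp: G_def upper_regular_def)
  define M where "M = real (Suc m)"
  define R where "R = 1 / real (Suc m)"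
  have M: "M \<ge> 0" and R: "R > 0" by (simp_all add: M_def R_def)
  have upper: "emeasure \<mu> (ball a \<rho>) \<le> ennreal (M * \<rho> ^ k)" if "a \<in> G" "0 < \<rho>" "\<rho> < R" for a \<rho>
    using that by (simp add: \<mu> G_def upper_regular_def M_def R_def)
  obtain j where j: "(1/2) ^ j < R" using real_arch_pow_inv[of R "1/2"] R by auto
  define N' where "N' = max N j"
  have rN: "(1/2::real) ^ i \<le> (1/2) ^ N" if "i \<ge> N'" for i
    using that by (intro power_decreasing) (auto simp: N'_def)
  have rR: "(1/2) ^ i < R" if "i \<ge> N'" for i
  proof -
    have "(1/2::real) ^ i \<le> (1/2) ^ j" using that by (intro power_decreasing) (auto simp: N'_def)
    then show ?thesis using j by (rule le_less_trans)
  qed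
  \<comment> \<open>n depends only on the constants of the piece: it makes slabs of width r / n
    lighter than \<theta> * r^k at every scale.\<close>
  obtain n :: nat where n: "real n \<ge> real k + 4" "M * slab_const k / n < \<theta>"
  proof -
    obtain n1 :: nat where n1: "M * slab_const k / \<theta> < real n1" using reals_Archimedean2 by blast
    define n where "n = max n1 (k + 4)"
    have "M * slab_const k / \<theta> < real n" using n1 by (simp add: n_def)
    moreover have "real n > 0" by (simp add: n_def)
    ultimately have "M * slab_const k / real n < \<theta>"
      using \<theta> by (simp add: divide_less_eq mult.commute)
    moreover have "real n \<ge> real k + 4" by (simp add: n_def)
    ultimately show ?thesis using that by blast
  qed
  have "\<exists>V P p. hausdorff k ((E \<inter> cball x ((1/2) ^ i)) - plane_nbhd V (real N * ((1/2) ^ i) powr (1 + \<alpha>)))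
        \<le> ennreal (c * \<theta> * ((1/2) ^ i) ^ k) \<and> orth_proj P \<and> dim (range P) = k \<and>
        (\<forall>z \<eta>. infdist z V < \<eta> \<longrightarrow> norm ((z - p) - P (z - p)) < \<eta>)"
    if x: "x \<in> T" and i: "i \<ge> N'" for x i
  proof -
    obtain V where "affine_plane k V" "hausdorff k ((E \<inter> cball x ((1/2) ^ i)) - plane_nbhd V (real N * ((1/2) ^ i) powr (1 + \<alpha>)))
        \<le> ennreal (c * \<theta> * ((1/2) ^ i) ^ k)"
      using flat_pieceD(3)[OF x[unfolded T_def] _ rN[OF i]] by auto
    then show ?thesis using affine_plane_projection by blast
  qed
  then obtain V P p where V: "\<And>x i. x \<in> T \<Longrightarrow> i \<ge> N' \<Longrightarrow>
      hausdorff k ((E \<inter> cball x ((1/2) ^ i)) - plane_nbhd (V x i) (real N * ((1/2) ^ i) powr (1 + \<alpha>)))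
        \<le> ennreal (c * \<theta> * ((1/2) ^ i) ^ k)"
    and P: "\<And>x i. x \<in> T \<Longrightarrow> i \<ge> N' \<Longrightarrow> orth_proj (P x i) \<and> dim (range (P x i)) = k"
    and Pp: "\<And>x i z \<eta>. x \<in> T \<Longrightarrow> i \<ge> N' \<Longrightarrow> infdist z (V x i) < \<eta> \<Longrightarrow>
       norm ((z - p x i) - P x i (z - p x i)) < \<eta>"
    by metis
  \<comment> \<open>From 8 * n * \<eta> / r with \<eta> = N * (2 * r) powr (1 + \<alpha>), as (2 *
    r) / r contributes another factor 2.\<close>
  define K where "K = 16 * real n * real N"
  have K: "K \<ge> 0" by (simp add: K_def)
  have NK: "real N \<le> K" using n by (simp add: K_def mult_le_cancel_right1)
  have both: "(\<forall>v. norm (P x i v - P y (Suc i) v) \<le> K * ((1/2) ^ i) powr \<alpha> * norm v) \<and>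
     (\<exists>s. dist y s \<le> (1/2) ^ Suc i \<and>
        norm ((s - p x i) - P x i (s - p x i)) \<le> K * ((1/2) ^ i) powr (1 + \<alpha>) \<and>
        norm ((s - p y (Suc i)) - P y (Suc i) (s - p y (Suc i))) \<le> K * ((1/2) ^ i) powr (1 + \<alpha>))"
    if x: "x \<in> T" and y: "y \<in> T" and i: "i \<ge> N'" and d: "dist x y \<le> (1/2) ^ Suc i" for x y i
  proof -
    define r where "r = (1/2::real) ^ Suc i"
    have r: "r > 0" "2 * r = (1/2) ^ i" by (simp_all add: r_def)
    have r2R: "2 * r < R" using rR[OF i] r by simp
    define \<eta> where "\<eta> = real N * (2 * r) powr (1 + \<alpha>)"
    define A where "A = plane_nbhd (V x i) \<eta>"
    define B where "B = plane_nbhd (V y (Suc i)) (real N * r powr (1 + \<alpha>))"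
    have \<eta>le: "real N * r powr (1 + \<alpha>) \<le> \<eta>"
      unfolding \<eta>_def using r \<alpha> by (intro mult_left_mono powr_mono2) auto
    \<comment> \<open>The common mass: regular points of the smaller ball that are near the plane of
      x at radius 2 * r and near the plane of y at radius r.\<close>
    define S where "S = G \<inter> cball y r \<inter> A \<inter> B"
    have Sb: "S \<in> sets borel"
      unfolding S_def A_def B_def
      by (rule sets.Int[OF sets.Int[OF sets.Int[OF Gb]]]) (auto intro: borel_open open_plane_nbhd)
    have sub: "cball y r \<subseteq> cball x (2 * r)"
    proof
      fix z assume "z \<in> cball y r"
      then show "z \<in> cball x (2 * r)"
        using d[folded r_def] dist_triangle[of x z y] by (simp add: dist_commute)
    qed
    have "E \<inter> cball y r \<subseteq> ((E \<inter> S) \<union> ((E \<inter> cball y r) - G)) \<union> (((E \<inter> cball x (2 * r)) - A) \<union> ((E \<inter> cball y r) - B))"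
      using sub by (auto simp: S_def)
    then have "hausdorff k (E \<inter> cball y r) \<le> (hausdorff k (E \<inter> S) + hausdorff k ((E \<inter> cball y r) - G))
        + (hausdorff k ((E \<inter> cball x (2 * r)) - A) + hausdorff k ((E \<inter> cball y r) - B))"
      by (intro order_trans[OF hausdorff_mono order_trans[OF hausdorff_subadditive[OF k]
            add_mono[OF hausdorff_subadditive[OF k] hausdorff_subadditive[OF k]]]])
    also have "\<dots> \<le> (emeasure \<mu> S + ennreal (c * \<theta> * r ^ k)) + (ennreal (c * \<theta> * (2 * r) ^ k) + ennreal (c * \<theta> * r ^ k))"
    proof (intro add_mono)
      have "r \<le> (1/2) ^ N" using rN[of "Suc i"] i by (simp add: r_def)
      then show "hausdorff k ((E \<inter> cball y r) - G) \<le> ennreal (c * \<theta> * r ^ k)"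
        unfolding G_def using flat_pieceD(2)[OF y[unfolded T_def] r(1)] by blast
      show "hausdorff k ((E \<inter> cball x (2 * r)) - A) \<le> ennreal (c * \<theta> * (2 * r) ^ k)"
        using V[OF x i] unfolding A_def \<eta>_def r(2) .
      show "hausdorff k ((E \<inter> cball y r) - B) \<le> ennreal (c * \<theta> * r ^ k)"
        using V[OF y, of "Suc i"] i unfolding B_def r_def by simp
    qed (simp add: \<mu>[OF Sb])
    also have "\<dots> = ennreal (c * \<theta> * r ^ k * (2 + 2 ^ k)) + emeasure \<mu> S"
      using c \<theta> r(1) by (simp add: algebra_simps power_mult_distrib flip: ennreal_plus)
    finally have *: "hausdorff k (E \<inter> cball y r) \<le> ennreal (c * \<theta> * r ^ k * (2 + 2 ^ k)) + emeasure \<mu> S" .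
    have "r \<le> (1/2) ^ N" using rN[of "Suc i"] i by (simp add: r_def)
    from order_trans[OF flat_pieceD(1)[OF y[unfolded T_def] r(1) this] *]
    have "ennreal (\<theta> * (2 * r) ^ k) \<le> ennreal (c * \<theta> * r ^ k * (2 + 2 ^ k)) + emeasure \<mu> S" .
    then have "ennreal (\<theta> * (2 * r) ^ k) - ennreal (c * \<theta> * r ^ k * (2 + 2 ^ k)) \<le> emeasure \<mu> S"
      by (simp add: ennreal_minus_le_iff)
    then have le: "ennreal (\<theta> * (2 * r) ^ k - c * \<theta> * r ^ k * (2 + 2 ^ k)) \<le> emeasure \<mu> S"
      using c \<theta> r(1) by (simp add: ennreal_minus)
    \<comment> \<open>This is 1 \<le> 2^k - c * (2 + 2^k); for k = 1 and c = 1/4 it is an equality,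
      which explains the bound on c.\<close>
    have "\<theta> * r ^ k \<le> \<theta> * (2 * r) ^ k - c * \<theta> * r ^ k * (2 + 2 ^ k)"
    proof -
      have "(2::real) ^ 1 \<le> 2 ^ k" using k by (intro power_increasing) auto
      then have "c * (2 + 2 ^ k) \<le> 1 / 4 * (2 + 2 ^ k)" "1 / 4 * (2 + 2 ^ k) \<le> (2 ^ k - 1 :: real)"
        using c by (auto intro: mult_right_mono)
      then have "1 \<le> 2 ^ k - c * (2 + 2 ^ k)" by linarith
      then have "\<theta> * r ^ k * 1 \<le> \<theta> * r ^ k * (2 ^ k - c * (2 + 2 ^ k))"
        using \<theta> r(1) by (intro mult_left_mono) auto
      then show ?thesis by (simp add: algebra_simps power_mult_distrib)
    qed
    then have mass: "ennreal (\<theta> * r ^ k) \<le> emeasure \<mu> S" using le by (meson ennreal_leI order_trans)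
    have flatx: "norm ((s - p x i) - P x i (s - p x i)) \<le> \<eta>" if "s \<in> S" for s
      using Pp[OF x i, of s \<eta>] that by (auto simp: S_def A_def plane_nbhd_def)
    have flaty: "norm ((s - p y (Suc i)) - P y (Suc i) (s - p y (Suc i))) \<le> \<eta>" if "s \<in> S" for s
      using Pp[OF y, of "Suc i" s "real N * r powr (1 + \<alpha>)"] that i \<eta>le
      by (auto simp: S_def B_def plane_nbhd_def)
    have S: "S \<subseteq> cball y r" "S \<subseteq> G" by (auto simp: S_def)
    have "norm (P x i v - P y (Suc i) v) \<le> K * ((1/2) ^ i) powr \<alpha> * norm v" for v
    proof -
      have "norm (P x i v - P y (Suc i) v) \<le> 8 * real n * \<eta> / r * norm v"
        using P[OF x i] P[OF y, of "Suc i"] i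
        by (intro plane_tilt_le[OF \<mu>sets k M upper _ _ _ _ n r(1) r2R S mass flatx flaty]) auto
      also have "8 * real n * \<eta> / r = K * (2 * r) powr \<alpha>"
        using r(1) by (simp add: \<eta>_def K_def powr_add)
      finally show ?thesis by (simp only: r(2))
    qed
    moreover have "\<exists>s. s \<in> S"
    proof (rule ccontr)
      assume "\<not> (\<exists>s. s \<in> S)"
      then have "S = {}" by blast
      then have "ennreal (\<theta> * r ^ k) \<le> 0" using mass by simp
      moreover have "\<theta> * r ^ k > 0" using \<theta> r(1) by simp
      ultimately show False using \<theta> r(1) by (simp add: ennreal_le_iff2)
    qed
    then obtain s where s: "s \<in> S" by blast
    have "\<eta> \<le> K * ((1/2) ^ i) powr (1 + \<alpha>)"
      unfolding \<eta>_def r(2) using NK by (intro mult_right_mono) auto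
    then have "\<exists>s. dist y s \<le> (1/2) ^ Suc i \<and>
        norm ((s - p x i) - P x i (s - p x i)) \<le> K * ((1/2) ^ i) powr (1 + \<alpha>) \<and>
        norm ((s - p y (Suc i)) - P y (Suc i) (s - p y (Suc i))) \<le> K * ((1/2) ^ i) powr (1 + \<alpha>)"
      using flatx[OF s] flaty[OF s] S(1) s unfolding r_def
      by (intro exI[of _ s]) (auto intro: order_trans)
    ultimately show ?thesis by blast
  qed
  have "\<exists>Q C. C \<ge> 0 \<and> (\<forall>x\<in>T. orth_proj (Q x) \<and> dim (range (Q x)) = k) \<and>
    (\<forall>x\<in>T. \<forall>y\<in>T. dist x y \<le> (1/2) ^ Suc N' \<longrightarrow>
      (\<forall>v. norm (Q x v - Q y v) \<le> C * dist x y powr \<alpha> * norm v) \<and>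
      norm ((y - x) - Q x (y - x)) \<le> C * dist x y powr (1 + \<alpha>))"
    by (rule multiscale_planes[where p = p, OF \<alpha> K P]) (use both in blast)+
  then show ?thesis unfolding T_def by blast
qed

text \<open>The plane estimates are local and \<open>graph_of_planes\<close> needs planes of small
  mutual tilt, so the piece is cut by balls around a countable dense set.\<close>

lemma flat_piece_graph_cover:
  fixes E :: "'a::euclidean_space set"
  assumes k: "k \<ge> 1" and \<alpha>: "0 < \<alpha>" "\<alpha> \<le> 1" and c: "0 < c" "c \<le> 1 / 4" and \<theta>: "\<theta> > 0"
    and E: "E \<in> sets borel"
  shows "\<exists>\<G>. countable \<G> \<and> (\<forall>\<Gamma>\<in>\<G>. C1_holder_graph k \<alpha> \<Gamma>) \<and> flat_piece k \<alpha> c E \<theta> m N \<subseteq> \<Union>\<G>"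
proof -
  define T where "T = flat_piece k \<alpha> c E \<theta> m N"
  obtain Q C N' where C: "C \<ge> 0" and Q: "\<forall>x\<in>T. orth_proj (Q x) \<and> dim (range (Q x)) = k"
    and tilt_flat: "\<forall>x\<in>T. \<forall>y\<in>T. dist x y \<le> (1/2) ^ Suc N' \<longrightarrow>
      (\<forall>v. norm (Q x v - Q y v) \<le> C * dist x y powr \<alpha> * norm v) \<and>
      norm ((y - x) - Q x (y - x)) \<le> C * dist x y powr (1 + \<alpha>)"
    using flat_piece_multiscale[OF k \<alpha>(1) c \<theta> E, of m N, folded T_def]
    by (elim exE conjE) (rule that)
  \<comment> \<open>The second entry solves (C + 1) * \<delta> powr \<alpha> = 1/4; adding 1 covers
    C = 0.\<close>
  define \<delta> where "\<delta> = min ((1/2) ^ Suc N') ((1 / (4 * (C + 1))) powr (1 / \<alpha>))"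
  have \<delta>: "\<delta> > 0" using C by (simp add: \<delta>_def)
  have small: "C * d powr \<alpha> \<le> 1 / 4" if "0 \<le> d" "d \<le> \<delta>" for d
  proof -
    have "d powr \<alpha> \<le> ((1 / (4 * (C + 1))) powr (1 / \<alpha>)) powr \<alpha>"
      using that \<alpha> by (intro powr_mono2) (auto simp: \<delta>_def)
    also have "\<dots> = 1 / (4 * (C + 1))" using \<alpha> C by (simp add: powr_powr)
    finally have "C * d powr \<alpha> \<le> C * (1 / (4 * (C + 1)))" using C by (rule mult_left_mono)
    also have "\<dots> \<le> 1 / 4" using C by (simp add: field_simps)
    finally show ?thesis .
  qed
  obtain D :: "'a set" where D: "countable D" "\<And>X. open X \<Longrightarrow> X \<noteq> {} \<Longrightarrow> \<exists>d\<in>D. d \<in> X"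
    using countable_dense_exists by blast
  have "\<exists>\<Gamma>. C1_holder_graph k \<alpha> \<Gamma> \<and> T \<inter> ball d (\<delta> / 2) \<subseteq> \<Gamma>" if ne: "T \<inter> ball d (\<delta> / 2) \<noteq> {}" for d
  proof -
    obtain x0 where x0: "x0 \<in> T \<inter> ball d (\<delta> / 2)" using ne by blast
    have dist: "dist x y \<le> \<delta>" if "x \<in> T \<inter> ball d (\<delta> / 2)" "y \<in> T \<inter> ball d (\<delta> / 2)" for x y
      using that dist_triangle3[of x y d] by simp
    have dist': "dist x y \<le> (1/2) ^ Suc N'" if "x \<in> T \<inter> ball d (\<delta> / 2)" "y \<in> T \<inter> ball d (\<delta> / 2)" for x y
      using dist[OF that] by (simp add: \<delta>_def)
    show ?thesis
    proof (rule graph_of_planes[OF \<alpha> C x0, of Q])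
      fix x y v assume x: "x \<in> T \<inter> ball d (\<delta> / 2)" and y: "y \<in> T \<inter> ball d (\<delta> / 2)"
      show "C * dist x y powr \<alpha> \<le> 1 / 4" by (rule small[OF zero_le_dist dist[OF x y]])
      show "norm (Q x v - Q y v) \<le> C * dist x y powr \<alpha> * norm v"
        "norm ((y - x) - Q x (y - x)) \<le> C * dist x y powr (1 + \<alpha>)"
        using tilt_flat dist'[OF x y] x y by blast+
    qed (use Q in blast)+
  qed
  then obtain \<Gamma> where \<Gamma>: "\<And>d. T \<inter> ball d (\<delta> / 2) \<noteq> {} \<Longrightarrow> C1_holder_graph k \<alpha> (\<Gamma> d)"
    "\<And>d. T \<inter> ball d (\<delta> / 2) \<noteq> {} \<Longrightarrow> T \<inter> ball d (\<delta> / 2) \<subseteq> \<Gamma> d"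
    by metis
  define \<G> where "\<G> = \<Gamma> ` {d \<in> D. T \<inter> ball d (\<delta> / 2) \<noteq> {}}"
  have "T \<subseteq> \<Union>\<G>"
  proof
    fix x assume x: "x \<in> T"
    obtain d where d: "d \<in> D" "d \<in> ball x (\<delta> / 2)" using D(2)[of "ball x (\<delta> / 2)"] \<delta> by auto
    then have xd: "x \<in> T \<inter> ball d (\<delta> / 2)" using x by (simp add: dist_commute)
    then have "\<Gamma> d \<in> \<G>" using d(1) unfolding \<G>_def by blast
    moreover have "x \<in> \<Gamma> d" using \<Gamma>(2)[of d] xd by blast
    ultimately show "x \<in> \<Union>\<G>" by blast
  qed
  moreover have "countable \<G>" unfolding \<G>_def using D(1) by simp
  moreover have "\<forall>\<Gamma>\<in>\<G>. C1_holder_graph k \<alpha> \<Gamma>" using \<Gamma>(1) by (auto simp: \<G>_def)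
  ultimately show ?thesis unfolding T_def by blast
qed

section \<open>From pointwise asymptotics to the countable decomposition\<close>

lemma eps0_bounds:
  assumes "k \<ge> 1"
  shows "0 < (1 - 1 / 2 ^ k) * eps0 k" "(1 - 1 / 2 ^ k) * eps0 k \<le> 1 / 4"
proof -
  have "(2::real) ^ 1 \<le> 2 ^ k" using assms by (intro power_increasing) auto
  then have a: "0 < 1 - 1 / (2::real) ^ k" "1 - 1 / (2::real) ^ k \<le> 1" by (auto simp: field_simps)
  have "(2::real) ^ k \<le> 240 ^ k" by (intro power_mono) auto
  then have "eps0 k \<le> 1 / 240" by (simp add: eps0_def field_simps)
  moreover have "eps0 k > 0" by (simp add: eps0_def)
  ultimately have "(1 - 1 / 2 ^ k) * eps0 k \<le> 1 * (1 / 240)" using a by (intro mult_mono) auto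
  then show "(1 - 1 / 2 ^ k) * eps0 k \<le> 1 / 4" by linarith
  show "0 < (1 - 1 / 2 ^ k) * eps0 k" using a(1) \<open>eps0 k > 0\<close> by (rule mult_pos_pos)
qed

text \<open>The Liminf, the Limsup and the density condition each hold for all sufficiently small
  radii; one N serves for these scales and dominates l.\<close>

lemma in_flat_pieceI:
  fixes E :: "'a::euclidean_space set"
  assumes c: "c > 0" and m: "x \<in> upper_regular k E m"
    and dens: "\<not> (\<forall>d>0. \<exists>r. 0 < r \<and> r < d \<and>
      hausdorff k ((E \<inter> cball x r) - upper_regular k E m) \<ge> ennreal (c * \<theta> * r ^ k))"
    and \<theta>: "\<theta> > 0" "ennreal \<theta> < lower_density k E x"
    and V: "\<And>r. r > 0 \<Longrightarrow> affine_plane k (V r)"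
    and lim: "Limsup (at_right 0) (\<lambda>r. hausdorff k ((E \<inter> cball x r) - plane_nbhd (V r) (l * r powr (1 + \<alpha>))) / ennreal (r ^ k))
      < ennreal (c * \<theta>)"
  shows "\<exists>N. x \<in> flat_piece k \<alpha> c E \<theta> m N"
proof -
  have "\<forall>\<^sub>F r in at_right 0. ennreal \<theta> < hausdorff k (E \<inter> cball x r) / ennreal ((2 * r) ^ k)"
    using \<theta>(2) unfolding lower_density_def by (rule less_LiminfD)
  moreover have "\<forall>\<^sub>F r in at_right 0.
      hausdorff k ((E \<inter> cball x r) - plane_nbhd (V r) (l * r powr (1 + \<alpha>))) / ennreal (r ^ k) < ennreal (c * \<theta>)"
    using lim by (rule Limsup_lessD)
  ultimately have "\<forall>\<^sub>F r in at_right 0. ennreal \<theta> < hausdorff k (E \<inter> cball x r) / ennreal ((2 * r) ^ k) \<and>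
      hausdorff k ((E \<inter> cball x r) - plane_nbhd (V r) (l * r powr (1 + \<alpha>))) / ennreal (r ^ k) < ennreal (c * \<theta>)"
    by (rule eventually_conj)
  then obtain b where b: "b > 0" "\<And>r. 0 < r \<Longrightarrow> r < b \<Longrightarrow>
      ennreal \<theta> < hausdorff k (E \<inter> cball x r) / ennreal ((2 * r) ^ k) \<and>
      hausdorff k ((E \<inter> cball x r) - plane_nbhd (V r) (l * r powr (1 + \<alpha>))) / ennreal (r ^ k) < ennreal (c * \<theta>)"
    unfolding eventually_at_right_field by auto
  obtain d where d: "d > 0" "\<And>r. 0 < r \<Longrightarrow> r < d \<Longrightarrow>
      hausdorff k ((E \<inter> cball x r) - upper_regular k E m) < ennreal (c * \<theta> * r ^ k)"
    using dens not_le by blast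
  obtain N1 where N1: "(1/2) ^ N1 < min b d" using real_arch_pow_inv[of "min b d" "1/2"] b d by auto
  obtain N2 :: nat where N2: "l \<le> real N2" using real_arch_simple by blast
  define N where "N = max N1 N2"
  have "ennreal (\<theta> * (2 * r) ^ k) \<le> hausdorff k (E \<inter> cball x r) \<and>
     hausdorff k ((E \<inter> cball x r) - upper_regular k E m) \<le> ennreal (c * \<theta> * r ^ k) \<and>
     (\<exists>V. affine_plane k V \<and>
       hausdorff k ((E \<inter> cball x r) - plane_nbhd V (real N * r powr (1 + \<alpha>))) \<le> ennreal (c * \<theta> * r ^ k))"
    if r: "0 < r" "r \<le> (1/2) ^ N" for r
  proof -
    have "(1/2::real) ^ N \<le> (1/2) ^ N1" by (intro power_decreasing) (auto simp: N_def)
    then have "r < min b d" using r(2) N1 by linarith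
    then have rb: "r < b" "r < d" by simp_all
    have cancel: "X = X / ennreal a * ennreal a" if "a > 0" for X :: ennreal and a
      using that by (simp add: ennreal_divide_times ennreal_divide_self)
    have "ennreal (\<theta> * (2 * r) ^ k) = ennreal \<theta> * ennreal ((2 * r) ^ k)"
      using \<theta> r by (simp add: ennreal_mult)
    also have "\<dots> \<le> hausdorff k (E \<inter> cball x r) / ennreal ((2 * r) ^ k) * ennreal ((2 * r) ^ k)"
      using b(2)[OF r(1) rb(1)] by (intro mult_right_mono) auto
    also have "\<dots> = hausdorff k (E \<inter> cball x r)" using cancel[of "(2 * r) ^ k"] r by simp
    finally have 1: "ennreal (\<theta> * (2 * r) ^ k) \<le> hausdorff k (E \<inter> cball x r)" .
    have "l * r powr (1 + \<alpha>) \<le> real N * r powr (1 + \<alpha>)"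
      using N2 by (intro mult_right_mono) (auto simp: N_def)
    then have "hausdorff k ((E \<inter> cball x r) - plane_nbhd (V r) (real N * r powr (1 + \<alpha>)))
        \<le> hausdorff k ((E \<inter> cball x r) - plane_nbhd (V r) (l * r powr (1 + \<alpha>)))"
      by (intro hausdorff_mono) (auto simp: plane_nbhd_def)
    also have "\<dots> = hausdorff k ((E \<inter> cball x r) - plane_nbhd (V r) (l * r powr (1 + \<alpha>))) / ennreal (r ^ k) * ennreal (r ^ k)"
      using r by (intro cancel) simp
    also have "\<dots> \<le> ennreal (c * \<theta>) * ennreal (r ^ k)"
      using b(2)[OF r(1) rb(1)] by (intro mult_right_mono) auto
    also have "\<dots> = ennreal (c * \<theta> * r ^ k)" using c \<theta> r by (simp add: ennreal_mult)
    finally show ?thesis using 1 V[OF r(1)] d(2)[OF r(1) rb(2)] less_imp_le by blast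
  qed
  then show ?thesis using m unfolding flat_piece_def by blast
qed

theorem theorem1p3:
  fixes E :: "(real ^ 'n) set" and k :: nat and \<alpha> :: real
  assumes "1 \<le> k" and "k \<le> CARD('n) - 1"
    and "0 < \<alpha>" and "\<alpha> \<le> 1"
    and "E \<in> sets borel"
    and "hausdorff k E < \<infinity>"
    and "hausdorff k {x \<in> E. \<not> (lower_density k E x > 0 \<and>
           (\<exists>l>0. \<exists>V :: real \<Rightarrow> (real ^ 'n) set.
              (\<forall>r>0. affine_plane k (V r)) \<and>
              Limsup (at_right 0)
                (\<lambda>r. hausdorff k ((E \<inter> cball x r) - plane_nbhd (V r) (l * r powr (1 + \<alpha>))) / ennreal (r ^ k))
              < ennreal ((1 - 1 / 2 ^ k) * eps0 k) * lower_density k E x))} = 0"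
  shows "C1_holder_rectifiable k \<alpha> E"
proof -
  define c where "c = (1 - 1 / 2 ^ k) * eps0 k"
  have c: "0 < c" "c \<le> 1 / 4" using eps0_bounds[OF \<open>1 \<le> k\<close>] by (auto simp: c_def)
  define Good where "Good x \<longleftrightarrow> lower_density k E x > 0 \<and>
           (\<exists>l>0. \<exists>V :: real \<Rightarrow> (real ^ 'n) set.
              (\<forall>r>0. affine_plane k (V r)) \<and>
              Limsup (at_right 0)
                (\<lambda>r. hausdorff k ((E \<inter> cball x r) - plane_nbhd (V r) (l * r powr (1 + \<alpha>))) / ennreal (r ^ k))
              < ennreal c * lower_density k E x)" for x
  \<comment> \<open>Rational \<theta> keeps the family of exceptional sets \<open>Sparse\<close>,
    and with it the family of pieces, countable.\<close>
  define I where "I = {\<theta> \<in> \<rat>. \<theta> > (0::real)} \<times> (UNIV :: nat set)"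
  have I: "countable I" unfolding I_def
    by (intro countable_SIGMA countable_subset[OF _ countable_rat]) auto
  define Sparse where "Sparse i = (case i of (\<theta>, m) \<Rightarrow>
    {x \<in> upper_regular k E m. \<forall>d>0. \<exists>r. 0 < r \<and> r < d \<and>
      hausdorff k ((E \<inter> cball x r) - upper_regular k E m) \<ge> ennreal (c * \<theta> * r ^ k)})" for i
  define Null where "Null = {{x \<in> E. \<not> Good x}, E - (\<Union>m. upper_regular k E m)} \<union> Sparse ` I"
  have "hausdorff k (\<Union>Null) = 0"
  proof (rule hausdorff_countable_null[OF \<open>1 \<le> k\<close>])
    show "countable Null" unfolding Null_def using I by simp
    have "hausdorff k {x \<in> E. \<not> Good x} = 0" using assms(7) unfolding Good_def c_def .
    moreover have "hausdorff k (E - (\<Union>m. upper_regular k E m)) = 0"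
      by (rule hausdorff_not_upper_regular[OF assms(1,5,6)])
    moreover have "hausdorff k (Sparse i) = 0" if "i \<in> I" for i
      using that c unfolding Sparse_def I_def
      by (auto split: prod.split intro!: hausdorff_not_density_point assms borel_upper_regular)
    ultimately show "hausdorff k N = 0" if "N \<in> Null" for N
      using that by (auto simp: Null_def)
  qed
  have "\<exists>\<G>. countable \<G> \<and> (\<forall>\<Gamma>\<in>\<G>. C1_holder_graph k \<alpha> \<Gamma>) \<and> flat_piece k \<alpha> c E (fst i) (snd i) N \<subseteq> \<Union>\<G>"
    if "i \<in> I" for i N
    using that by (intro flat_piece_graph_cover assms c) (auto simp: I_def)
  then obtain \<G> where \<G>: "\<And>i N. i \<in> I \<Longrightarrow> countable (\<G> i N)"
    "\<And>i N \<Gamma>. i \<in> I \<Longrightarrow> \<Gamma> \<in> \<G> i N \<Longrightarrow> C1_holder_graph k \<alpha> \<Gamma>"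
    "\<And>i N. i \<in> I \<Longrightarrow> flat_piece k \<alpha> c E (fst i) (snd i) N \<subseteq> \<Union>(\<G> i N)"
    by metis
  define \<H> where "\<H> = (\<Union>i\<in>I. \<Union>N. \<G> i N)"
  have "E - \<Union>\<H> \<subseteq> \<Union>Null"
  proof (rule subsetI, rule ccontr)
    fix x assume x: "x \<in> E - \<Union>\<H>" "x \<notin> \<Union>Null"
    have "{x \<in> E. \<not> Good x} \<in> Null" "E - (\<Union>m. upper_regular k E m) \<in> Null"
      by (simp_all add: Null_def)
    then have "Good x" "x \<in> (\<Union>m. upper_regular k E m)" using x by blast+
    from \<open>Good x\<close> obtain l V where V: "\<And>r. r > 0 \<Longrightarrow> affine_plane k (V r)"
      and lim: "Limsup (at_right 0)
          (\<lambda>r. hausdorff k ((E \<inter> cball x r) - plane_nbhd (V r) (l * r powr (1 + \<alpha>))) / ennreal (r ^ k))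
          < ennreal c * lower_density k E x" (is "?L < _")
      unfolding Good_def by blast
    \<comment> \<open>Dividing by c turns the strict hypothesis into an interval that contains a
      rational \<theta>; in \<open>ennreal\<close> this also covers infinite lower density.\<close>
    have "?L / ennreal c < lower_density k E x"
      using lim c(1) by (subst divide_less_ennreal) (simp_all add: mult.commute)
    then obtain r :: rat where r: "?L / ennreal c < ennreal (real_of_rat r)" "ennreal (real_of_rat r) < lower_density k E x"
      using ennreal_rat_dense by blast
    define \<theta> where "\<theta> = real_of_rat r"
    have "0 < ennreal \<theta>" using le_less_trans[OF zero_le r(1)] by (simp add: \<theta>_def)
    then have \<theta>: "\<theta> > 0" by (simp add: ennreal_less_zero_iff)
    have "?L < ennreal \<theta> * ennreal c"
      using r(1) c(1) unfolding \<theta>_def[symmetric] by (subst (asm) divide_less_ennreal) simp_all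
    then have L: "?L < ennreal (c * \<theta>)" using c(1) \<theta> by (simp add: ennreal_mult mult.commute)
    obtain m where m: "x \<in> upper_regular k E m"
      using \<open>x \<in> (\<Union>m. upper_regular k E m)\<close> by blast
    have i: "(\<theta>, m) \<in> I" using \<theta> by (simp add: I_def \<theta>_def)
    then have "Sparse (\<theta>, m) \<in> Null" unfolding Null_def by blast
    then have "x \<notin> Sparse (\<theta>, m)" using x(2) by blast
    then have "\<not> (\<forall>d>0. \<exists>r. 0 < r \<and> r < d \<and>
      hausdorff k ((E \<inter> cball x r) - upper_regular k E m) \<ge> ennreal (c * \<theta> * r ^ k))"
      using m by (simp add: Sparse_def)
    then obtain N where "x \<in> flat_piece k \<alpha> c E \<theta> m N"
      using in_flat_pieceI[OF c(1) m _ \<theta> _ V L] r(2) unfolding \<theta>_def by blast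
    then have "x \<in> \<Union>(\<G> (\<theta>, m) N)" using \<G>(3)[OF i, of N] by auto
    then show False using x(1) i by (auto simp: \<H>_def)
  qed
  then have "hausdorff k (E - \<Union>\<H>) \<le> hausdorff k (\<Union>Null)" by (rule hausdorff_mono)
  then have "hausdorff k (E - \<Union>\<H>) = 0" using \<open>hausdorff k (\<Union>Null) = 0\<close> by simp
  moreover have "countable \<H>" unfolding \<H>_def using I \<G>(1) by (intro countable_UN) auto
  moreover have "\<forall>\<Gamma>\<in>\<H>. C1_holder_graph k \<alpha> \<Gamma>" using \<G>(2) by (auto simp: \<H>_def)
  ultimately show ?thesis unfolding C1_holder_rectifiable_def using assms(5) by blast
qed

end
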